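(* There is an absolute constant $K>0$ such that the following holds for all $n\ge1$, $d\ge 2$, $T\ge 1$ and every nonempty closed $C_0\subseteq S^d$ with $\alpha(C_0)<\pi/2$. Let $\pi$ be the policy given by the algorithm EllipsoidalCones run with parameter $\epsilon=d/T$. If $\alpha(C_0)>\arctan(d/T)$, then $$\mathcal{WCR}_T^\pi(C_0)\le K\,d^2\ln\bigl(T\tan\alpha(C_0)\bigr).$$ If $\alpha(C_0)\le\arctan(d/T)$, then $\mathcal{WCR}_T^\pi(C_0)\le K d$. Moreover, the algorithm runs in time polynomial in $d$ and $T$.
   Context: Notation: $S^d$ is the unit Euclidean sphere of $\mathbb R^d$; $\mathcal B$ is the set of nonempty compact subsets of $\mathbb R^n$ of diameter at most $1$; $\mathcal F$ is the set of $1$-Lipschitz functions $\mathbb R^n\to\mathbb R^d$; $\psi(c,\mathcal X,f)=\arg\min_{x\in\mathcal X}f(x)'c$; $e_1$ is the first canonical vector; for $c\in\mathbb R^d$, $c_{[i:j]}$ denotes the vector of entries $i,\dots,j$. Angles: $\theta(c,\hat c)=\arccos\frac{c'\hat c}{\|c\|\|\hat c\|}$. For a nonempty $C\subseteq\mathbb R^d$, $\alpha(C)=\inf_{\hat c\in S^d}\sup_{c\in C}\theta(c,\hat c)$ is the uncertainty angle, and the circumcenter $\hat c(C)\in S^d$ is a minimizer (it exists, and is unique when $C\setminus\{0\}\neq\emptyset$ and $\alpha(C)<\pi/2$). Online problem with horizon $T$: an unknown $c^\star\in C_0$ is fixed. In each period $t=1,\dots,T$, $\mathcal X_t\in\mathcal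 B$ and $f_t\in\mathcal F$ are revealed, the decision-maker chooses $x_t^\pi\in\mathcal X_t$ based on the past observations and $(\mathcal X_t,f_t)$, and then an optimal action $x_t^\star\in\psi(c^\star,\mathcal X_t,f_t)$ is revealed. $\mathcal{WCR}^\pi_T(C_0)=\sup\sum_{t=1}^T(f_t(x_t^\pi)-f_t(x_t^\star))'c^\star$, the supremum being over $c^\star\in C_0$, $(\mathcal X_t)_{t\le T}\in\mathcal B^T$, $(f_t)_{t\le T}\in\mathcal F^T$ (and all selections of optimal actions). Algorithm EllipsoidalCones (parameter $\epsilon>0$). It maintains a diagonal $(d-1)\times(d-1)$ matrix $W_t$ and an orthogonal $d\times d$ matrix $U_t$. Initialize $W_1=\tan^2(\alpha(C_0))\,I_{d-1}$ and $U_1$ any orthogonal matrix whose first column is $\hat c(C_0)$. In period $t=1,\dots,T$: set $c_t^\pi=U_te_1$; choose $x_t^\pi\in\psi(c_t^\pi,\mathcal X_t,f_t)$ (arbitrary selection); observe $x_t^\star$; set $\delta_t=\frac{f_t(x_t^\pi)-f_t(x_t^\star)}{\|f_t(x_t^\pi)-f_t(x_t^\star)\|}$ (and $\delta_t=0$ if the numerator is $0$), and $v=(U_t^{-1}\delta_t)_{[2:d]}\in\mathbb R^{d-1}$. If $v'W_tv\le\epsilon^2$, set $(W_{t+1},U_{t+1})=(W_t,U_t)$. Otherwise perform a cone update: let $\bar\delta=v/\|v\|$, $W=W_t$, and - if $d=2$ (scalars): $a=\tfrac12\sqrt W\,\bar\delta$, $V$ any orthogonal $2\times2$ matrix with first column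 $(1,a)'/\sqrt{1+a^2}$, $U_{t+1}=U_tV$, $W_{t+1}=W/2$; - if $d\ge3$: $b=\frac{W\bar\delta}{\sqrt{\bar\delta'W\bar\delta}}$, $a=\frac1d b$, $N=\frac{(d-1)^2}{(d-1)^2-1}\left(W-\frac2d bb'\right)$, $M=\begin{pmatrix}1&a'\\ a&aa'-N\end{pmatrix}$; let $M=V\Lambda V'$ be a spectral decomposition with $V$ orthogonal, the eigenvalues in $\Lambda$ in nonincreasing order, and the first column of $V$ (eigenvector of the unique positive eigenvalue) oriented so that its first coordinate is positive; set $U_{t+1}=U_tV$ and let $W_{t+1}$ be the diagonal matrix with $(W_{t+1})_{ii}=\lambda_{d-i}(N)$, $i=1,\dots,d-1$, where $\lambda_1(N)\ge\dots\ge\lambda_{d-1}(N)$. Running time counts the vector/matrix arithmetic and spectral decompositions performed by the algorithm; $\hat c(C_0)$, $\alpha(C_0)$ and solutions of the problems $\min_{x\in\mathcal X_t}f_t(x)'c$ are taken as available. *)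

theory Defs
  imports
    "HOL-Analysis.Abstract_Metric_Spaces"
    "HOL-Analysis.L2_Norm"
    "HOL-Library.Extended_Real"
    "HOL-Library.Monad_Syntax"
    "HOL-Computational_Algebra.Polynomial"
    "Jordan_Normal_Form.Matrix"
begin

no_notation inner (infix \<open>\<bullet>\<close> 70)

section \<open>Euclidean space with a numeric dimension\<close>

text \<open>The dimensions are quantified inside the theorem (after the constant), so \<open>R^n\<close> is
  \<^term>\<open>carrier_vec n :: real vec set\<close> rather than a type. All indices start at 0.\<close>

definition vnorm :: "real vec \<Rightarrow> real" where
  "vnorm v = sqrt (v \<bullet> v)"

text \<open>For vectors of dimension \<open>n\<close> this is \<open>vnorm (x - y)\<close>, see \<open>vdist_eq_vnorm\<close>; this form is
  symmetric also outside the carrier, as the locale \<^locale>\<open>Metric_space\<close> demands.\<close>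

definition vdist :: "nat \<Rightarrow> real vec \<Rightarrow> real vec \<Rightarrow> real" where
  "vdist n x y = L2_set (\<lambda>i. x $ i - y $ i) {..<n}"

lemma vdist_eq_vnorm:
  assumes "x \<in> carrier_vec n" "y \<in> carrier_vec n"
  shows "vdist n x y = vnorm (x - y)"
  using assms
  by (simp add: vdist_def vnorm_def L2_set_def scalar_prod_def power2_eq_square lessThan_atLeast0)

lemma Metric_space_vec: "Metric_space (carrier_vec n) (vdist n)"
proof
  fix x y z :: "real vec"
  show "0 \<le> vdist n x y"
    by (simp add: vdist_def)
  show "vdist n x y = vdist n y x"
    by (simp add: vdist_def L2_set_def power2_commute)
  show "vdist n x y = 0 \<longleftrightarrow> x = y" if "x \<in> carrier_vec n" "y \<in> carrier_vec n"
    using that by (auto simp: vdist_def L2_set_eq_0_iff intro!: eq_vecI)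
  have "L2_set (\<lambda>i. (x $ i - y $ i) + (y $ i - z $ i)) {..<n}
      \<le> L2_set (\<lambda>i. x $ i - y $ i) {..<n} + L2_set (\<lambda>i. y $ i - z $ i) {..<n}"
    by (rule L2_set_triangle_ineq)
  then show "vdist n x z \<le> vdist n x y + vdist n y z"
    by (simp add: vdist_def)
qed

definition vec_topology :: "nat \<Rightarrow> real vec topology" where
  "vec_topology n = Metric_space.mtopology (carrier_vec n) (vdist n)"

definition unit_sphere :: "nat \<Rightarrow> real vec set" where
  "unit_sphere d = {c \<in> carrier_vec d. vnorm c = 1}"

definition angle :: "real vec \<Rightarrow> real vec \<Rightarrow> real" where
  "angle c u = arccos ((c \<bullet> u) / (vnorm c * vnorm u))"

text \<open>Angles lie in \<open>[0, pi]\<close>, so the real \<open>INF\<close> and \<open>SUP\<close> are genuine for nonempty \<open>C\<close> and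
  \<open>d \<ge> 1\<close>.\<close>

definition uncertainty_angle :: "nat \<Rightarrow> real vec set \<Rightarrow> real" where
  "uncertainty_angle d C = (INF u\<in>unit_sphere d. SUP c\<in>C. angle c u)"

definition is_circumcenter :: "nat \<Rightarrow> real vec set \<Rightarrow> real vec \<Rightarrow> bool" where
  "is_circumcenter d C u \<longleftrightarrow>
     u \<in> unit_sphere d \<and> (SUP c\<in>C. angle c u) = uncertainty_angle d C"


section \<open>The online problem\<close>

definition decision_sets :: "nat \<Rightarrow> real vec set set" where
  "decision_sets n =
     {X. X \<noteq> {} \<and> compactin (vec_topology n) X \<and> (\<forall>x\<in>X. \<forall>y\<in>X. vdist n x y \<le> 1)}"

definition context_maps :: "nat \<Rightarrow> nat \<Rightarrow> (real vec \<Rightarrow> real vec) set" where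
  "context_maps n d =
     {f \<in> carrier_vec n \<rightarrow> carrier_vec d.
        \<forall>x\<in>carrier_vec n. \<forall>y\<in>carrier_vec n. vdist d (f x) (f y) \<le> vdist n x y}"

definition optimal_actions ::
    "real vec \<Rightarrow> real vec set \<Rightarrow> (real vec \<Rightarrow> real vec) \<Rightarrow> real vec set" where
  "optimal_actions c X f = {x. is_arg_min (\<lambda>x. f x \<bullet> c) (\<lambda>x. x \<in> X) x}"

text \<open>What one period reveals: \<open>(X\<^sub>t, f\<^sub>t, x\<^sub>t\<^sup>\<star>)\<close>. A history lists the past periods in
  chronological order. The decision-maker's own past actions are determined by the history.\<close>

type_synonym observation = "real vec set \<times> (real vec \<Rightarrow> real vec) \<times> real vec"

type_synonym policy =
  "observation list \<Rightarrow> real vec set \<Rightarrow> (real vec \<Rightarrow> real vec) \<Rightarrow> real vec"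

text \<open>The possible moves of nature over \<open>T\<close> periods, including all selections of optimal
  actions for the hidden cost vector \<open>c\<close>.\<close>

definition plays :: "nat \<Rightarrow> nat \<Rightarrow> nat \<Rightarrow> real vec set \<Rightarrow> (real vec \<times> observation list) set" where
  "plays n d T C0 =
     {(c, h). c \<in> C0 \<and> length h = T \<and>
        (\<forall>(X, f, x)\<in>set h. X \<in> decision_sets n \<and> f \<in> context_maps n d \<and>
           x \<in> optimal_actions c X f)}"

definition regret :: "policy \<Rightarrow> real vec \<Rightarrow> observation list \<Rightarrow> real" where
  "regret \<pi> c h =
     (\<Sum>t<length h. case h ! t of (X, f, x) \<Rightarrow> (f (\<pi> (take t h) X f) - f x) \<bullet> c)"

definition worst_case_regret ::
    "nat \<Rightarrow> nat \<Rightarrow> nat \<Rightarrow> real vec set \<Rightarrow> policy \<Rightarrow> ereal" where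
  "worst_case_regret n d T C0 \<pi> = (SUP (c, h)\<in>plays n d T C0. ereal (regret \<pi> c h))"


section \<open>Nondeterministic programs with a running time\<close>

text \<open>A program is the set of its possible outcomes: a result paired with the time spent.
  Nondeterminism expresses the arbitrary selections of the algorithm. The machine works on exact
  reals; an arithmetic operation, square root, tangent or comparison on scalars costs one unit,
  while indexing, transposing and copying are free.\<close>

type_synonym 'a program = "('a \<times> nat) set"

definition bind_program :: "'a program \<Rightarrow> ('a \<Rightarrow> 'b program) \<Rightarrow> 'b program" where
  "bind_program m g = {(y, j + k) | x j y k. (x, j) \<in> m \<and> (y, k) \<in> g x}"

no_adhoc_overloading Monad_Syntax.bind \<rightleftharpoons> Set.bind
adhoc_overloading Monad_Syntax.bind \<rightleftharpoons> bind_program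

definition any_of :: "nat \<Rightarrow> 'a set \<Rightarrow> 'a program" where
  "any_of k A = A \<times> {k}"

text \<open>\<open>ops k x\<close> is used where the scalar \<open>x\<close> takes \<open>k\<close> scalar operations.\<close>

definition ops :: "nat \<Rightarrow> 'a \<Rightarrow> 'a program" where
  "ops k x = any_of k {x}"

abbreviation ret :: "'a \<Rightarrow> 'a program" where
  "ret x \<equiv> ops 0 x"

fun sum_program :: "nat \<Rightarrow> (nat \<Rightarrow> real program) \<Rightarrow> real program" where
  "sum_program 0 g = ret 0"
| "sum_program (Suc k) g = do { s \<leftarrow> sum_program k g; x \<leftarrow> g k; ops 1 (s + x) }"

definition vec_program :: "nat \<Rightarrow> (nat \<Rightarrow> real program) \<Rightarrow> real vec program" where
  "vec_program n g =
     {(v, \<Sum>i<n. k i) | v k. v \<in> carrier_vec n \<and> (\<forall>i<n. (v $ i, k i) \<in> g i)}"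

definition mat_program ::
    "nat \<Rightarrow> nat \<Rightarrow> (nat \<Rightarrow> nat \<Rightarrow> real program) \<Rightarrow> real mat program" where
  "mat_program m n g =
     {(A, \<Sum>i<m. \<Sum>j<n. k i j) | A k.
        A \<in> carrier_mat m n \<and> (\<forall>i<m. \<forall>j<n. (A $$ (i, j), k i j) \<in> g i j)}"

definition inner_program :: "real vec \<Rightarrow> real vec \<Rightarrow> real program" where
  "inner_program u v = sum_program (dim_vec v) (\<lambda>i. ops 1 (u $ i * v $ i))"

definition norm_program :: "real vec \<Rightarrow> real program" where
  "norm_program v = do { s \<leftarrow> inner_program v v; ops 1 (sqrt s) }"

definition mult_vec_program :: "real mat \<Rightarrow> real vec \<Rightarrow> real vec program" where
  "mult_vec_program A v = vec_program (dim_row A) (\<lambda>i. inner_program (row A i) v)"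

definition mult_mat_program :: "real mat \<Rightarrow> real mat \<Rightarrow> real mat program" where
  "mult_mat_program A B =
     mat_program (dim_row A) (dim_col B) (\<lambda>i j. inner_program (row A i) (col B j))"

text \<open>The results of these programs are the library operations.\<close>

lemma inner_program_eq: "inner_program u v = ops (2 * dim_vec v) (u \<bullet> v)"
proof -
  have "sum_program n (\<lambda>i. ops 1 (u $ i * v $ i)) = ops (2 * n) (\<Sum>i<n. u $ i * v $ i)" for n
    by (induction n) (auto simp: ops_def any_of_def bind_program_def)
  then show ?thesis
    by (simp add: inner_program_def scalar_prod_def lessThan_atLeast0)
qed

lemma norm_program_eq: "norm_program v = ops (2 * dim_vec v + 1) (vnorm v)"
  by (auto simp: norm_program_def inner_program_eq vnorm_def ops_def any_of_def bind_program_def)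

lemma mult_vec_program_eq:
  "mult_vec_program A v = ops (dim_row A * (2 * dim_vec v)) (A *\<^sub>v v)"
proof -
  have "(w, t) \<in> mult_vec_program A v
      \<longleftrightarrow> w = A *\<^sub>v v \<and> t = dim_row A * (2 * dim_vec v)" for w t
  proof
    assume "(w, t) \<in> mult_vec_program A v"
    then obtain k where k: "t = (\<Sum>i<dim_row A. k i)" "w \<in> carrier_vec (dim_row A)"
      "\<forall>i<dim_row A. w $ i = row A i \<bullet> v \<and> k i = 2 * dim_vec v"
      unfolding mult_vec_program_def vec_program_def inner_program_eq ops_def any_of_def by blast
    have "t = (\<Sum>i<dim_row A. 2 * dim_vec v)"
      unfolding k(1) using k(3) by (intro sum.cong) auto
    then show "w = A *\<^sub>v v \<and> t = dim_row A * (2 * dim_vec v)"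
      using k by (auto intro!: eq_vecI)
  next
    assume "w = A *\<^sub>v v \<and> t = dim_row A * (2 * dim_vec v)"
    then show "(w, t) \<in> mult_vec_program A v"
      by (auto simp: mult_vec_program_def vec_program_def inner_program_eq ops_def any_of_def
          intro!: exI[of _ "\<lambda>_. 2 * dim_vec v"] carrier_vecI)
  qed
  then show ?thesis
    by (auto simp: ops_def any_of_def)
qed

lemma mult_mat_program_eq:
  "mult_mat_program A B = ops (dim_row A * (dim_col B * (2 * dim_row B))) (A * B)"
proof -
  have "(C, t) \<in> mult_mat_program A B
      \<longleftrightarrow> C = A * B \<and> t = dim_row A * (dim_col B * (2 * dim_row B))" for C t
  proof
    assume "(C, t) \<in> mult_mat_program A B"
    then obtain k where k: "t = (\<Sum>i<dim_row A. \<Sum>j<dim_col B. k i j)"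
      "C \<in> carrier_mat (dim_row A) (dim_col B)"
      "\<forall>i<dim_row A. \<forall>j<dim_col B. C $$ (i, j) = row A i \<bullet> col B j \<and> k i j = 2 * dim_row B"
      unfolding mult_mat_program_def mat_program_def inner_program_eq ops_def any_of_def
        dim_col by blast
    have "t = (\<Sum>i<dim_row A. \<Sum>j<dim_col B. 2 * dim_row B)"
      unfolding k(1) using k(3) by (intro sum.cong) auto
    then show "C = A * B \<and> t = dim_row A * (dim_col B * (2 * dim_row B))"
      using k by (auto intro!: eq_matI)
  next
    assume "C = A * B \<and> t = dim_row A * (dim_col B * (2 * dim_row B))"
    then show "(C, t) \<in> mult_mat_program A B"
      by (auto simp: mult_mat_program_def mat_program_def inner_program_eq ops_def any_of_def
          intro!: exI[of _ "\<lambda>_ _. 2 * dim_row B"])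
  qed
  then show ?thesis
    by (auto simp: ops_def any_of_def)
qed

text \<open>Not \<open>orthogonal_mat\<close> of the matrix library, whose columns need not have norm 1.\<close>

definition orthonormal_mat :: "nat \<Rightarrow> real mat \<Rightarrow> bool" where
  "orthonormal_mat d V \<longleftrightarrow> V \<in> carrier_mat d d \<and> transpose_mat V * V = 1\<^sub>m d"

text \<open>The two matrix subroutines. They are not finite sequences of arithmetic operations, so a
  call in dimension \<open>k\<close> is charged \<open>poly p k\<close> for a polynomial \<open>p\<close> that is a parameter
  throughout.\<close>

definition spectral_program :: "nat poly \<Rightarrow> real mat \<Rightarrow> (real mat \<times> real mat) program" where
  "spectral_program p A = (let k = dim_row A in
     any_of (poly p k)
       {(V, L). orthonormal_mat k V \<and> L \<in> carrier_mat k k \<and> diagonal_mat L \<and>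
          (\<forall>i j. i \<le> j \<and> j < k \<longrightarrow> L $$ (j, j) \<le> L $$ (i, i)) \<and>
          A = V * L * transpose_mat V})"

definition completion_program :: "nat poly \<Rightarrow> real vec \<Rightarrow> real mat program" where
  "completion_program p u = (let k = dim_vec u in
     any_of (poly p k) {V. orthonormal_mat k V \<and> col V 0 = u})"


section \<open>EllipsoidalCones\<close>

text \<open>The state is \<open>(W\<^sub>t, U\<^sub>t)\<close>. Matrix and vector indices are shifted by one, so
  \<open>(W\<^sub>t\<^sub>+\<^sub>1)\<^sub>i\<^sub>i = \<lambda>\<^sub>d\<^sub>-\<^sub>i(N)\<close> becomes entry \<open>(i, i)\<close> being the sorted eigenvalue number
  \<open>d - 2 - i\<close>.\<close>

type_synonym ec_state = "real mat \<times> real mat"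

definition ec_init :: "nat poly \<Rightarrow> nat \<Rightarrow> real vec set \<Rightarrow> ec_state program" where
  "ec_init p d C0 = do {
     c \<leftarrow> any_of 0 {c. is_circumcenter d C0 c};
     w \<leftarrow> ops 2 ((tan (uncertainty_angle d C0))\<^sup>2);
     U \<leftarrow> completion_program p c;
     ret (w \<cdot>\<^sub>m 1\<^sub>m (d - 1), U)
   }"

definition orient_program :: "real mat \<Rightarrow> real mat program" where
  "orient_program V = do {
     flip \<leftarrow> ops 1 (V $$ (0, 0) < 0);
     mat_program (dim_row V) (dim_col V)
       (\<lambda>i j. if flip \<and> j = 0 then ops 1 (- (V $$ (i, j))) else ret (V $$ (i, j)))
   }"

definition cone_update_2 :: "nat poly \<Rightarrow> real vec \<Rightarrow> ec_state \<Rightarrow> ec_state program" where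
  "cone_update_2 p \<delta> = (\<lambda>(W, U). do {
     a \<leftarrow> ops 3 (1 / 2 * sqrt (W $$ (0, 0)) * \<delta> $ 0);
     r \<leftarrow> ops 3 (sqrt (1 + a * a));
     u \<leftarrow> vec_program 2 (\<lambda>i. ops 1 ((if i = 0 then 1 else a) / r));
     V \<leftarrow> completion_program p u;
     U' \<leftarrow> mult_mat_program U V;
     w \<leftarrow> ops 1 (W $$ (0, 0) / 2);
     ret (mat 1 1 (\<lambda>_. w), U')
   })"

definition cone_update_ge3 :: "nat poly \<Rightarrow> nat \<Rightarrow> real vec \<Rightarrow> ec_state \<Rightarrow> ec_state program" where
  "cone_update_ge3 p d \<delta> = (\<lambda>(W, U). do {
     g \<leftarrow> mult_vec_program W \<delta>;
     q \<leftarrow> inner_program \<delta> g;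
     r \<leftarrow> ops 1 (sqrt q);
     b \<leftarrow> vec_program (d - 1) (\<lambda>i. ops 1 (g $ i / r));
     a \<leftarrow> vec_program (d - 1) (\<lambda>i. ops 2 (1 / real d * b $ i));
     \<mu> \<leftarrow> ops 6 ((real d - 1)\<^sup>2 / ((real d - 1)\<^sup>2 - 1));
     N \<leftarrow> mat_program (d - 1) (d - 1)
       (\<lambda>i j. ops 5 (\<mu> * (W $$ (i, j) - 2 / real d * (b $ i * b $ j))));
     B \<leftarrow> mat_program (d - 1) (d - 1) (\<lambda>i j. ops 2 (a $ i * a $ j - N $$ (i, j)));
     let M = four_block_mat (1\<^sub>m 1) (mat_of_rows (d - 1) [a]) (mat_of_cols (d - 1) [a]) B;
     (V0, L) \<leftarrow> spectral_program p M;
     V \<leftarrow> orient_program V0;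
     U' \<leftarrow> mult_mat_program U V;
     (Q, E) \<leftarrow> spectral_program p N;
     ret (mat (d - 1) (d - 1)
       (\<lambda>(i, j). if i = j then E $$ (d - 2 - i, d - 2 - i) else 0), U')
   })"

text \<open>One period, returning the action and the next state. The action does not use the
  revealed optimal action \<open>xs\<close>. \<open>U\<close> is orthogonal, so its inverse is its transpose. Access to
  the minimizer and to the values of \<open>f\<close> costs one unit per call.\<close>

definition ec_period ::
    "nat poly \<Rightarrow> nat \<Rightarrow> real \<Rightarrow> real vec set \<Rightarrow> (real vec \<Rightarrow> real vec) \<Rightarrow> real vec \<Rightarrow>
     ec_state \<Rightarrow> (real vec \<times> ec_state) program" where
  "ec_period p d \<epsilon> X f xs = (\<lambda>(W, U). do {
     c \<leftarrow> mult_vec_program U (unit_vec d 0);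
     x \<leftarrow> any_of 1 (optimal_actions c X f);
     y \<leftarrow> any_of 1 {f x};
     ys \<leftarrow> any_of 1 {f xs};
     g \<leftarrow> vec_program d (\<lambda>i. ops 1 (y $ i - ys $ i));
     m \<leftarrow> norm_program g;
     zero \<leftarrow> ops 1 (m = 0);
     \<delta> \<leftarrow> (if zero then ret (0\<^sub>v d) else vec_program d (\<lambda>i. ops 1 (g $ i / m)));
     w \<leftarrow> mult_vec_program (transpose_mat U) \<delta>;
     let v = vec_last w (d - 1);
     Wv \<leftarrow> mult_vec_program W v;
     q \<leftarrow> inner_program v Wv;
     small \<leftarrow> ops 2 (q \<le> \<epsilon>\<^sup>2);
     if small then ret (x, W, U)
     else do {
       r \<leftarrow> norm_program v;
       \<delta>' \<leftarrow> vec_program (d - 1) (\<lambda>i. ops 1 (v $ i / r));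
       s \<leftarrow> (if d = 2 then cone_update_2 p \<delta>' (W, U) else cone_update_ge3 p d \<delta>' (W, U));
       ret (x, s)
     }
   })"

text \<open>\<open>\<pi>\<close> is a policy obtained from the algorithm by fixing all its arbitrary selections, which
  may depend on the history; \<open>\<sigma> h\<close> is the state after the history \<open>h\<close> together with the total
  time spent until then. Only histories that can occur are constrained. The same action
  \<open>\<pi> h X f\<close> serves all optimal actions \<open>x\<close> that may be revealed afterwards.\<close>

definition ellipsoidal_cones ::
    "nat poly \<Rightarrow> nat \<Rightarrow> nat \<Rightarrow> nat \<Rightarrow> real \<Rightarrow> real vec set \<Rightarrow> policy \<Rightarrow>
     (observation list \<Rightarrow> ec_state \<times> nat) \<Rightarrow> bool" where
  "ellipsoidal_cones p n d T \<epsilon> C0 \<pi> \<sigma> \<longleftrightarrow>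
     \<sigma> [] \<in> ec_init p d C0 \<and>
     (\<forall>c h X f x. length h < T \<and> (c, h @ [(X, f, x)]) \<in> plays n d (Suc (length h)) C0 \<longrightarrow>
        (\<exists>s k. ((\<pi> h X f, s), k) \<in> ec_period p d \<epsilon> X f x (fst (\<sigma> h)) \<and>
           \<sigma> (h @ [(X, f, x)]) = (s, snd (\<sigma> h) + k)))"

end

theory Submission
  imports Defs "Jordan_Normal_Form.Determinant"
begin

no_notation Finite_Cartesian_Product.vec.vec_nth (infixl "$" 90)

text \<open>The state \<open>(W, U)\<close> describes the cone of all \<open>c\<close> such that \<open>y = U\<^sup>T c\<close> satisfies \<open>y\<^sub>0 > 0\<close> and
  \<open>(y\<^sub>1, \<dots>) / y\<^sub>0\<close> lies in the ellipsoid of \<open>W\<close>, and the hidden cost vector always stays in it. A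
  period without update costs at most \<open>\<epsilon>\<close>, since \<open>\<delta> \<bullet> c \<le> v \<bullet> y \<le> y\<^sub>0 sqrt (v \<bullet> W v)\<close>; a period with
  update costs at most 1 and cuts the ellipsoid through its centre, which multiplies \<open>det W\<close> by at
  most \<open>exp (- 1 / d)\<close>. Since only directions of width above \<open>\<epsilon>\<close> are cut, no eigenvalue of \<open>W\<close> drops
  below \<open>\<epsilon>\<^sup>2 / (60 d)\<close>. Comparing the two bounds on \<open>det W\<close> leaves room for only
  \<open>O(d\<^sup>2 ln (T tan \<alpha>))\<close> updates.\<close>

section \<open>Spectral decompositions\<close>

text \<open>Ellipsoids enter through their support functions: \<open>z\<close> lies in the ellipsoid
  of a positive definite \<open>W\<close> iff \<open>(z . q)^2 <= q . W q\<close> for all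
  \<open>q\<close>. This form needs no inverse, still makes sense for \<open>W = 0\<close> (the
  start if the uncertainty angle is 0), and yields the regret bound at once by taking
  \<open>q = v\<close>. The delicate point of an update is the change of frame. The cut ellipsoid is
  no longer centred on the axis; the eigenvectors of \<open>M\<close> supply a frame in which the
  cone over it is centred again, with squared semiaxes equal to the moduli of the negative
  eigenvalues divided by the top one. The algorithm stores the eigenvalues of \<open>N\<close>
  instead. That is safe because the top eigenvalue is at least 1 and each modulus is at most the
  matching eigenvalue of \<open>N\<close>; and it makes the volume computable, since
  \<open>det N\<close> is \<open>det W\<close> times an explicit factor. The factor
  \<open>(d - 1)^2 / ((d - 1)^2 - 1)\<close> has a pole at \<open>d = 2\<close>, hence the separate
  planar argument. With \<open>\<epsilon> = d / T\<close> the periods without update cost at most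
  \<open>d\<close> in total, which the logarithmic term absorbs.\<close>

lemma homogeneous_nontrivial_solution:
  fixes A :: "nat \<Rightarrow> nat \<Rightarrow> real"
  assumes "k < n"
  shows "\<exists>x. (\<exists>i<n. x i \<noteq> 0) \<and> (\<forall>r<k. (\<Sum>j<n. A r j * x j) = 0)"
proof -
  \<comment> \<open>Zero rows pad the system to a square matrix; its row \<open>k\<close> vanishes,
    hence so does its determinant.\<close>
  define B where "B = mat n n (\<lambda>(r, j). if r < k then A r j else 0)"
  have B: "B \<in> carrier_mat n n" by (simp add: B_def)
  have 0: "row B k = 0\<^sub>v n" using assms by (intro eq_vecI) (auto simp: B_def)
  have "det B = 0"
  proof -
    have "B $$ (k, j) = 0" if "j < n" for j using that assms by (simp add: B_def)
    then show ?thesis using laplace_expansion_row[OF B assms] by simp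
  qed
  then obtain v where v: "v \<in> carrier_vec n" "v \<noteq> 0\<^sub>v n" "B *\<^sub>v v = 0\<^sub>v n"
    using det_0_iff_vec_prod_zero[OF B] by auto
  have "\<exists>i<n. v $ i \<noteq> 0"
    using v(1,2) by (metis carrier_vecD eq_vecI index_zero_vec(1) index_zero_vec(2))
  moreover have "(\<Sum>j<n. A r j * v $ j) = 0" if r: "r < k" for r
  proof -
    have "(B *\<^sub>v v) $ r = 0" using v(3) r assms by simp
    then show ?thesis using r assms v(1)
      by (auto simp: B_def scalar_prod_def lessThan_atLeast0)
  qed
  ultimately show ?thesis by (intro exI[of _ "\<lambda>i. v $ i"]) auto
qed

text \<open>The bordered matrix with blocks 1, \<open>v\<close>, \<open>u\<close> and the identity
  has two block-triangular factorizations, sharing the factor \<open>?L\<close> of determinant 1.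
  Comparing the determinants of the other factors gives this matrix determinant lemma.\<close>

lemma det_one_minus_rank_one:
  fixes u v :: "nat \<Rightarrow> real"
  shows "det (mat n n (\<lambda>(i, j). (if i = j then 1 else 0) - u i * v j)) = 1 - (\<Sum>i<n. u i * v i)"
proof -
  let ?D = "mat n n (\<lambda>(i, j). (if i = j then 1 else 0) - u i * v j)"
  let ?u = "mat n 1 (\<lambda>(i, j). u i)" and ?v = "mat 1 n (\<lambda>(i, j). v j)"
  let ?s = "mat 1 1 (\<lambda>(i, j). 1 - (\<Sum>i<n. u i * v i))"
  let ?L = "four_block_mat (1\<^sub>m 1) (0\<^sub>m 1 n) ?u (1\<^sub>m n)"
  let ?R = "four_block_mat (1\<^sub>m 1) ?v (0\<^sub>m n 1) ?D"
  let ?R' = "four_block_mat ?s ?v (0\<^sub>m n 1) (1\<^sub>m n)"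
  have L: "?L \<in> carrier_mat (1 + n) (1 + n)" "?R \<in> carrier_mat (1 + n) (1 + n)"
     "?R' \<in> carrier_mat (1 + n) (1 + n)" by auto
  have D: "?u * ?v + 1\<^sub>m n * ?D = 1\<^sub>m n"
    by (intro eq_matI) (auto simp: scalar_prod_def)
  have S: "?s * 1\<^sub>m 1 + ?v * ?u = 1\<^sub>m 1"
    by (intro eq_matI) (auto simp: scalar_prod_def lessThan_atLeast0 mult.commute)
  have "?L * ?R = four_block_mat (1\<^sub>m 1) ?v ?u (1\<^sub>m n)"
    by (subst mult_four_block_mat[of _ 1 1 _ n _ n]) (auto simp: D[simplified])
  also have "\<dots> = ?R' * ?L"
    by (subst mult_four_block_mat[of _ 1 1 _ n _ n]) (auto simp: S[simplified])
  finally have "det ?L * det ?R = det ?R' * det ?L"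
    using det_mult[OF L(1,2)] det_mult[OF L(3,1)] by simp
  moreover have "det ?L = 1"
    by (subst det_four_block_mat_upper_right_zero[of _ 1 _ n]) auto
  moreover have "det ?R = det ?D"
    by (subst det_four_block_mat_lower_left_zero[of _ 1 _ n]) auto
  moreover have "det ?R' = det ?s"
    by (subst det_four_block_mat_lower_left_zero[of _ 1 _ n]) auto
  moreover have "det ?s = 1 - (\<Sum>i<n. u i * v i)" by (simp add: det_single)
  ultimately show ?thesis by simp
qed

text \<open>Columns and rows are recorded together. For square arrays each condition implies the
  other, and \<open>orthonormal_mat_imp_family\<close> settles this once, so that expansions and
  Parseval reduce to exchanging sums.\<close>

definition orthonormal_family :: "nat \<Rightarrow> (nat \<Rightarrow> nat \<Rightarrow> real) \<Rightarrow> bool" where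
  "orthonormal_family m V \<longleftrightarrow>
     (\<forall>k<m. \<forall>l<m. (\<Sum>i<m. V i k * V i l) = (if k = l then 1 else 0)) \<and>
     (\<forall>i<m. \<forall>j<m. (\<Sum>k<m. V i k * V j k) = (if i = j then 1 else 0))"

definition quad_form :: "nat \<Rightarrow> (nat \<Rightarrow> nat \<Rightarrow> real) \<Rightarrow> (nat \<Rightarrow> real) \<Rightarrow> real" where
  "quad_form m A x = (\<Sum>i<m. \<Sum>j<m. A i j * x i * x j)"

definition spectral :: "nat \<Rightarrow> (nat \<Rightarrow> nat \<Rightarrow> real) \<Rightarrow> (nat \<Rightarrow> nat \<Rightarrow> real) \<Rightarrow> (nat \<Rightarrow> real) \<Rightarrow> bool"
  where "spectral m A V l \<longleftrightarrow> orthonormal_family m V \<and>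
     (\<forall>i j. i \<le> j \<and> j < m \<longrightarrow> l j \<le> l i) \<and>
     (\<forall>i<m. \<forall>j<m. A i j = (\<Sum>k<m. l k * V i k * V j k))"

lemma orthonormal_family_expand:
  assumes "orthonormal_family m V" "i < m"
  shows "(\<Sum>k<m. V i k * (\<Sum>j<m. V j k * x j)) = x i"
proof -
  have "(\<Sum>k<m. V i k * (\<Sum>j<m. V j k * x j)) = (\<Sum>k<m. \<Sum>j<m. V i k * V j k * x j)"
    by (simp add: sum_distrib_left mult.assoc)
  also have "\<dots> = (\<Sum>j<m. (\<Sum>k<m. V i k * V j k) * x j)"
    by (subst sum.swap) (simp add: sum_distrib_right)
  also have "\<dots> = (\<Sum>j<m. (if i = j then 1 else 0) * x j)"
    using assms by (intro sum.cong) (auto simp: orthonormal_family_def)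
  also have "\<dots> = x i" using assms(2) by (simp add: if_distrib[of "\<lambda>z. z * _"] cong: if_cong)
  finally show ?thesis .
qed

lemma orthonormal_family_coords:
  assumes "orthonormal_family m V" "l < m"
  shows "(\<Sum>j<m. V j l * (\<Sum>k<m. V j k * y k)) = y l"
proof -
  have "(\<Sum>j<m. V j l * (\<Sum>k<m. V j k * y k)) = (\<Sum>j<m. \<Sum>k<m. V j l * V j k * y k)"
    by (simp add: sum_distrib_left mult.assoc)
  also have "\<dots> = (\<Sum>k<m. (\<Sum>j<m. V j l * V j k) * y k)"
    by (subst sum.swap) (simp add: sum_distrib_right)
  also have "\<dots> = (\<Sum>k<m. (if l = k then 1 else 0) * y k)"
    using assms by (intro sum.cong) (auto simp: orthonormal_family_def)
  also have "\<dots> = y l" using assms(2) by (simp add: if_distrib[of "\<lambda>z. z * _"] cong: if_cong)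
  finally show ?thesis .
qed

lemma orthonormal_family_inner:
  assumes "orthonormal_family m V"
  shows "(\<Sum>k<m. (\<Sum>j<m. V j k * x j) * (\<Sum>j<m. V j k * y j)) = (\<Sum>i<m. x i * y i)"
proof -
  have "(\<Sum>k<m. (\<Sum>j<m. V j k * x j) * (\<Sum>j<m. V j k * y j))
      = (\<Sum>k<m. \<Sum>i<m. x i * (V i k * (\<Sum>j<m. V j k * y j)))"
    by (simp only: sum_distrib_right mult_ac)
  also have "\<dots> = (\<Sum>i<m. x i * (\<Sum>k<m. V i k * (\<Sum>j<m. V j k * y j)))"
    by (subst sum.swap) (simp add: sum_distrib_left)
  also have "\<dots> = (\<Sum>i<m. x i * y i)"
    using orthonormal_family_expand[OF assms] by (intro sum.cong) auto
  finally show ?thesis .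
qed

lemma spectral_quad_form:
  assumes "spectral m A V l"
  shows "quad_form m A x = (\<Sum>k<m. l k * (\<Sum>i<m. V i k * x i)\<^sup>2)"
proof -
  have "quad_form m A x = (\<Sum>i<m. \<Sum>j<m. \<Sum>k<m. l k * ((V i k * x i) * (V j k * x j)))"
    unfolding quad_form_def
  proof (intro sum.cong refl)
    fix i j assume "i \<in> {..<m}" "j \<in> {..<m}"
    then have A: "A i j = (\<Sum>k<m. l k * V i k * V j k)" using assms by (auto simp: spectral_def)
    show "A i j * x i * x j = (\<Sum>k<m. l k * ((V i k * x i) * (V j k * x j)))"
      unfolding A sum_distrib_right by (intro sum.cong) auto
  qed
  also have "\<dots> = (\<Sum>i<m. \<Sum>k<m. \<Sum>j<m. l k * ((V i k * x i) * (V j k * x j)))"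
    by (intro sum.cong refl sum.swap)
  also have "\<dots> = (\<Sum>k<m. \<Sum>i<m. \<Sum>j<m. l k * ((V i k * x i) * (V j k * x j)))"
    by (rule sum.swap)
  also have "\<dots> = (\<Sum>k<m. l k * (\<Sum>i<m. V i k * x i)\<^sup>2)"
    unfolding power2_eq_square sum_product by (simp only: sum_distrib_left)
  finally show ?thesis .
qed

lemma spectral_mult_vec:
  assumes "spectral m A V l" "i < m"
  shows "(\<Sum>j<m. A i j * x j) = (\<Sum>k<m. l k * V i k * (\<Sum>j<m. V j k * x j))"
proof -
  have "(\<Sum>j<m. A i j * x j) = (\<Sum>j<m. \<Sum>k<m. l k * V i k * (V j k * x j))"
  proof (intro sum.cong refl)
    fix j assume "j \<in> {..<m}"
    then have A: "A i j = (\<Sum>k<m. l k * V i k * V j k)" using assms by (auto simp: spectral_def)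
    show "A i j * x j = (\<Sum>k<m. l k * V i k * (V j k * x j))"
      unfolding A sum_distrib_right by (intro sum.cong) auto
  qed
  also have "\<dots> = (\<Sum>k<m. l k * V i k * (\<Sum>j<m. V j k * x j))"
    by (subst sum.swap) (simp add: sum_distrib_left)
  finally show ?thesis .
qed

lemma spectral_eigenvalue:
  assumes "spectral m A V l" "k < m"
  shows "quad_form m A (\<lambda>i. V i k) = l k" "(\<Sum>i<m. (V i k)\<^sup>2) = 1"
proof -
  have *: "(\<Sum>i<m. V i j * V i k) = (if j = k then 1 else 0)" if "j < m" for j
    using assms that by (auto simp: spectral_def orthonormal_family_def)
  have "quad_form m A (\<lambda>i. V i k) = (\<Sum>j<m. l j * (if j = k then 1 else 0)\<^sup>2)"
    unfolding spectral_quad_form[OF assms(1)] by (intro sum.cong) (auto simp: *)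
  also have "\<dots> = (\<Sum>j<m. if j = k then l j else 0)" by (intro sum.cong) auto
  also have "\<dots> = l k" using assms(2) by simp
  finally show "quad_form m A (\<lambda>i. V i k) = l k" .
  show "(\<Sum>i<m. (V i k)\<^sup>2) = 1" using *[OF assms(2)] by (simp add: power2_eq_square)
qed

text \<open>One half of Courant-Fischer: in the eigenbasis the form is a weighted sum of squares
  that add up to the squared norm of \<open>x\<close>, and orthogonality removes the terms that come
  before \<open>l j\<close>.\<close>

lemma spectral_le_above:
  assumes S: "spectral m A V l" and j: "j < m"
    and orth: "\<And>k. k < j \<Longrightarrow> (\<Sum>i<m. V i k * x i) = 0"
  shows "quad_form m A x \<le> l j * (\<Sum>i<m. (x i)\<^sup>2)"
proof -
  have "(\<Sum>i<m. (x i)\<^sup>2) = (\<Sum>k<m. (\<Sum>i<m. V i k * x i)\<^sup>2)"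
    using orthonormal_family_inner[of m V x x] S by (simp add: power2_eq_square spectral_def)
  moreover have "l k * (\<Sum>i<m. V i k * x i)\<^sup>2 \<le> l j * (\<Sum>i<m. V i k * x i)\<^sup>2" if "k < m" for k
  proof (cases "k < j")
    case False
    then have "l k \<le> l j" using S that j by (auto simp: spectral_def)
    then show ?thesis by (intro mult_right_mono) auto
  qed (simp add: orth)
  ultimately show ?thesis
    unfolding spectral_quad_form[OF S] by (auto simp: sum_distrib_left intro!: sum_mono)
qed

lemma spectral_ge_least:
  assumes S: "spectral m A V l" and b: "\<And>k. k < m \<Longrightarrow> b \<le> l k"
  shows "b * (\<Sum>i<m. (x i)\<^sup>2) \<le> quad_form m A x"
proof -
  have "(\<Sum>i<m. (x i)\<^sup>2) = (\<Sum>k<m. (\<Sum>i<m. V i k * x i)\<^sup>2)"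
    using orthonormal_family_inner[of m V x x] S by (simp add: power2_eq_square spectral_def)
  then show ?thesis
    unfolding spectral_quad_form[OF S]
    by (auto simp: sum_distrib_left intro!: sum_mono mult_right_mono b)
qed

section \<open>Central cuts of an ellipsoid\<close>

lemma four_xy_le: "4 * x * y \<le> (x + y)\<^sup>2" for x y :: real
  using zero_le_power2[of "x - y"] by (simp add: power2_eq_square algebra_simps)

text \<open>A half-ball is contained in the ellipsoid with centre \<open>u / D\<close> that the
  ellipsoid method in dimension \<open>D - 1\<close> assigns to it. Here \<open>s\<close> is a point
  of the half-ball, and \<open>p\<close> is the argument of the support function.\<close>

lemma central_cut:
  fixes s u p :: "nat \<Rightarrow> real"
  assumes s: "(\<Sum>i<m. (s i)\<^sup>2) \<le> 1" and u: "(\<Sum>i<m. (u i)\<^sup>2) = 1"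
    and su: "(\<Sum>i<m. s i * u i) \<ge> 0" and D: "D > 2"
  shows "(\<Sum>i<m. (s i - u i / D) * p i)\<^sup>2
    \<le> (D - 1)\<^sup>2 / (D * (D - 2)) * ((\<Sum>i<m. (p i)\<^sup>2) - 2 / D * (\<Sum>i<m. u i * p i)\<^sup>2)"
proof -
  define \<sigma> where "\<sigma> = (\<Sum>i<m. s i * u i)"
  define t where "t = (\<Sum>i<m. u i * p i)"
  define S where "S = (\<Sum>i<m. (s i)\<^sup>2)"
  define P where "P = (\<Sum>i<m. (p i)\<^sup>2)"
  define q where "q = (\<Sum>i<m. s i * p i)"
  have 1: "(\<Sum>i<m. (s i - \<sigma> * u i) * (p i - t * u i)) = q - \<sigma> * t"
  proof -
    have "(\<Sum>i<m. (s i - \<sigma> * u i) * (p i - t * u i))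
      = (\<Sum>i<m. s i * p i - t * (s i * u i) - \<sigma> * (u i * p i) + \<sigma> * t * (u i)\<^sup>2)"
      by (intro sum.cong) (auto simp: algebra_simps power2_eq_square)
    also have "\<dots> = q - t * \<sigma> - \<sigma> * t + \<sigma> * t * 1"
      unfolding sum.distrib sum_subtractf sum_distrib_left[symmetric] u
      by (simp add: \<sigma>_def t_def q_def)
    finally show ?thesis by simp
  qed
  have 2: "(\<Sum>i<m. (s i - \<sigma> * u i)\<^sup>2) = S - \<sigma>\<^sup>2"
  proof -
    have "(\<Sum>i<m. (s i - \<sigma> * u i)\<^sup>2)
      = (\<Sum>i<m. (s i)\<^sup>2 - 2 * \<sigma> * (s i * u i) + \<sigma>\<^sup>2 * (u i)\<^sup>2)"
      by (intro sum.cong) (auto simp: algebra_simps power2_eq_square)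
    also have "\<dots> = S - 2 * \<sigma> * \<sigma> + \<sigma>\<^sup>2 * 1"
      unfolding sum.distrib sum_subtractf sum_distrib_left[symmetric] u
      by (simp add: \<sigma>_def S_def)
    finally show ?thesis by (simp add: power2_eq_square)
  qed
  have 3: "(\<Sum>i<m. (p i - t * u i)\<^sup>2) = P - t\<^sup>2"
  proof -
    have "(\<Sum>i<m. (p i - t * u i)\<^sup>2)
      = (\<Sum>i<m. (p i)\<^sup>2 - 2 * t * (u i * p i) + t\<^sup>2 * (u i)\<^sup>2)"
      by (intro sum.cong) (auto simp: algebra_simps power2_eq_square)
    also have "\<dots> = P - 2 * t * t + t\<^sup>2 * 1"
      unfolding sum.distrib sum_subtractf sum_distrib_left[symmetric] u
      by (simp add: t_def P_def)
    finally show ?thesis by (simp add: power2_eq_square)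
  qed
  \<comment> \<open>\<open>\<sigma>\<close> and \<open>t\<close> are the components of
    \<open>s\<close> and \<open>p\<close> along \<open>u\<close>. Cauchy-Schwarz is applied only to
    the parts orthogonal to \<open>u\<close>, with inner product \<open>r\<close>; \<open>R\<close>
    is the squared norm of that part of \<open>p\<close>.\<close>
  define r where "r = q - \<sigma> * t"
  define R where "R = P - t\<^sup>2"
  have R: "R \<ge> 0" unfolding R_def 3[symmetric] by (intro sum_nonneg) auto
  have "0 \<le> S - \<sigma>\<^sup>2" unfolding 2[symmetric] by (intro sum_nonneg) auto
  then have s1: "\<sigma>\<^sup>2 \<le> 1" using s by (simp add: S_def)
  have \<sigma>: "0 \<le> \<sigma>" "\<sigma> \<le> 1" using su s1 power2_le_imp_le[of \<sigma> 1] by (auto simp: \<sigma>_def)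
  have "r\<^sup>2 \<le> (S - \<sigma>\<^sup>2) * R"
    using Cauchy_Schwarz_ineq_sum[of "\<lambda>i. s i - \<sigma> * u i" "\<lambda>i. p i - t * u i" "{..<m}"]
    unfolding 1 2 3 r_def R_def .
  also have "\<dots> \<le> (1 - \<sigma>\<^sup>2) * R"
    using s R by (intro mult_right_mono) (auto simp: S_def)
  finally have r: "r\<^sup>2 \<le> (1 - \<sigma>\<^sup>2) * R" .
  define \<alpha> where "\<alpha> = \<sigma> - 1 / D"
  define \<kappa> where "\<kappa> = 1 - 2 / D"
  define \<beta> where "\<beta> = 1 - \<sigma>\<^sup>2"
  have \<kappa>: "\<kappa> > 0" using D by (simp add: \<kappa>_def field_simps)
  have \<beta>: "\<beta> \<ge> 0" using s1 by (simp add: \<beta>_def)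
  \<comment> \<open>Arithmetic-geometric mean inequality, weighted by \<open>\<kappa>\<close> so
    that the expanded square then factors as \<open>(\<alpha>\<^sup>2 / \<kappa> + \<beta>) *
    (\<kappa> * t\<^sup>2 + R)\<close>.\<close>
  have cross: "2 * \<alpha> * t * r \<le> \<alpha>\<^sup>2 * R / \<kappa> + \<beta> * \<kappa> * t\<^sup>2"
  proof -
    have "(2 * \<alpha> * t * r)\<^sup>2 = 4 * \<alpha>\<^sup>2 * t\<^sup>2 * r\<^sup>2" by (simp add: power_mult_distrib)
    also have "\<dots> \<le> 4 * \<alpha>\<^sup>2 * t\<^sup>2 * (\<beta> * R)"
      using r[folded \<beta>_def] by (intro mult_left_mono) auto
    also have "\<dots> = 4 * (\<alpha>\<^sup>2 * R / \<kappa>) * (\<beta> * \<kappa> * t\<^sup>2)" using \<kappa> by (simp add: field_simps)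
    also have "\<dots> \<le> (\<alpha>\<^sup>2 * R / \<kappa> + \<beta> * \<kappa> * t\<^sup>2)\<^sup>2"
      by (rule four_xy_le)
    finally show ?thesis by (rule power2_le_imp_le) (use R \<kappa> \<beta> in simp)
  qed
  have "(\<alpha> * t + r)\<^sup>2 \<le> (\<alpha>\<^sup>2 / \<kappa> + \<beta>) * (\<kappa> * t\<^sup>2 + R)"
  proof -
    have "(\<alpha> * t + r)\<^sup>2 = \<alpha>\<^sup>2 * t\<^sup>2 + 2 * \<alpha> * t * r + r\<^sup>2"
      by (simp add: power2_eq_square algebra_simps)
    also have "\<dots> \<le> \<alpha>\<^sup>2 * t\<^sup>2 + (\<alpha>\<^sup>2 * R / \<kappa> + \<beta> * \<kappa> * t\<^sup>2) + \<beta> * R"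
      using cross r[folded \<beta>_def] by linarith
    also have "\<dots> = (\<alpha>\<^sup>2 / \<kappa> + \<beta>) * (\<kappa> * t\<^sup>2 + R)" using \<kappa> by (simp add: field_simps)
    finally show ?thesis .
  qed
  also have "\<dots> \<le> (D - 1)\<^sup>2 / (D * (D - 2)) * (\<kappa> * t\<^sup>2 + R)"
  proof (rule mult_right_mono)
    \<comment> \<open>The gap vanishes exactly at \<open>\<sigma> = 0\<close> and
      \<open>\<sigma> = 1\<close>: the ellipsoid touches the half-ball at its rim and at its pole,
      which explains the shift \<open>1 / D\<close> and the scaling factor.\<close>
    have "(D - 1)\<^sup>2 / (D * (D - 2)) - (\<alpha>\<^sup>2 / \<kappa> + \<beta>) = 2 * (\<sigma> * (1 - \<sigma>)) / (D - 2)"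
      using D unfolding \<alpha>_def \<beta>_def \<kappa>_def
      by (simp add: divide_simps) (simp add: power2_eq_square algebra_simps)
    moreover have "\<dots> \<ge> 0" using \<sigma> D by (intro divide_nonneg_nonneg) auto
    ultimately show "\<alpha>\<^sup>2 / \<kappa> + \<beta> \<le> (D - 1)\<^sup>2 / (D * (D - 2))" by linarith
    show "0 \<le> \<kappa> * t\<^sup>2 + R" using \<kappa> R by auto
  qed
  also have "\<kappa> * t\<^sup>2 + R = P - 2 / D * t\<^sup>2" by (simp add: R_def \<kappa>_def algebra_simps)
  also have "\<alpha> * t + r = (\<Sum>i<m. (s i - u i / D) * p i)"
  proof -
    have "(\<Sum>i<m. (s i - u i / D) * p i) = (\<Sum>i<m. s i * p i - (1 / D) * (u i * p i))"
      by (intro sum.cong) (auto simp: algebra_simps)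
    also have "\<dots> = q - (1 / D) * t"
      unfolding sum_subtractf sum_distrib_left[symmetric] by (simp add: t_def q_def)
    finally show ?thesis by (simp add: \<alpha>_def r_def algebra_simps)
  qed
  finally show ?thesis by (simp add: P_def t_def)
qed

text \<open>The rank-one term is dominated by \<open>\<mu> W - \<omega> I\<close>: coordinates with \<open>w\<^sub>i \<ge> 5 \<omega>\<close> contribute
  little because \<open>\<mu> w\<^sub>i - \<omega>\<close> is comparable to \<open>\<mu> w\<^sub>i\<close>, the others because \<open>\<omega>\<close> is small against \<open>Q\<close>.\<close>

lemma least_eigenvalue_preserved:
  fixes w \<delta> x :: "nat \<Rightarrow> real"
  assumes w: "\<And>i. i < m \<Longrightarrow> \<omega> \<le> w i" and \<omega>: "0 < \<omega>" "60 * D * \<omega> \<le> Q"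
    and \<delta>: "(\<Sum>i<m. (\<delta> i)\<^sup>2) = 1" and Q: "Q = (\<Sum>i<m. (\<delta> i)\<^sup>2 * w i)" and D: "D \<ge> 3"
  shows "\<omega> * (\<Sum>i<m. (x i)\<^sup>2) \<le> (D - 1)\<^sup>2 / (D * (D - 2)) *
      ((\<Sum>i<m. w i * (x i)\<^sup>2) - 2 / D * ((\<Sum>i<m. w i * \<delta> i * x i)\<^sup>2 / Q))"
proof -
  define \<mu> where "\<mu> = (D - 1)\<^sup>2 / (D * (D - 2))"
  have \<mu>: "\<mu> = 1 + 1 / (D * (D - 2))"
    unfolding \<mu>_def using D by (simp add: divide_simps) (simp add: power2_eq_square algebra_simps)
  have \<mu>1: "\<mu> > 1" unfolding \<mu> using D by auto
  have Q0: "Q > 0" using \<omega> D by (smt (verit) mult_pos_pos)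
  \<comment> \<open>The claim says that the diagonal form \<open>g\<close> dominates the rank-one
    term. By Cauchy-Schwarz with weights \<open>g\<close> it suffices to bound the sum of
    \<open>\<delta>\<^sup>2 * w\<^sup>2 / g\<close> by \<open>D * Q / (2 * \<mu>)\<close>.\<close>
  define g where "g i = \<mu> * w i - \<omega>" for i
  have g: "g i > 0" if "i < m" for i
  proof -
    have "w i > 0" using w[OF that] \<omega> by linarith
    then have "\<mu> * w i > w i" using \<mu>1 by simp
    then show ?thesis using w[OF that] by (simp add: g_def)
  qed
  \<comment> \<open>The right side adds the bounds of both cases, so that one estimate can be summed
    over all coordinates against \<open>\<delta>\<^sup>2\<close>.\<close>
  have pw: "(w i)\<^sup>2 / g i \<le> 5 / (4 * \<mu>) * w i + 5 * \<omega> * (D * (D - 2))" if i: "i < m" for i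
  proof (cases "w i \<ge> 5 * \<omega>")
    case True
    then have "4 / 5 * (\<mu> * w i) \<le> g i"
      using mult_right_mono[OF less_imp_le[OF \<mu>1], of "w i"] w[OF i] \<omega>(1) True
      unfolding g_def by linarith
    then have "(w i)\<^sup>2 / g i \<le> (w i)\<^sup>2 / (4 / 5 * (\<mu> * w i))"
      using w[OF i] \<omega> \<mu>1 by (intro divide_left_mono) (auto intro!: mult_pos_pos g[OF i])
    also have "\<dots> = 5 / (4 * \<mu>) * w i" using w[OF i] \<omega> \<mu>1
      by (simp add: divide_simps power2_eq_square)
    also have "\<dots> \<le> 5 / (4 * \<mu>) * w i + 5 * \<omega> * (D * (D - 2))" using \<omega> D by auto
    finally show ?thesis .
  next
    case False
    have "(\<mu> - 1) * w i \<le> g i" using w[OF i] by (simp add: g_def algebra_simps)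
    then have "(w i)\<^sup>2 / g i \<le> (w i)\<^sup>2 / ((\<mu> - 1) * w i)"
      using w[OF i] \<omega> \<mu>1 by (intro divide_left_mono) (auto intro!: mult_pos_pos g[OF i])
    also have "\<dots> = w i * (D * (D - 2))" using w[OF i] \<omega> D unfolding \<mu>
      by (simp add: divide_simps power2_eq_square)
    also have "\<dots> \<le> 5 * \<omega> * (D * (D - 2))" using False D by (intro mult_right_mono) auto
    also have "\<dots> \<le> 5 / (4 * \<mu>) * w i + 5 * \<omega> * (D * (D - 2))"
      using w[OF i] \<omega> \<mu>1 by auto
    finally show ?thesis .
  qed
  have "(\<Sum>i<m. (\<delta> i)\<^sup>2 * ((w i)\<^sup>2 / g i))
      \<le> (\<Sum>i<m. (\<delta> i)\<^sup>2 * (5 / (4 * \<mu>) * w i + 5 * \<omega> * (D * (D - 2))))"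
    by (intro sum_mono mult_left_mono pw) auto
  also have "\<dots> = (\<Sum>i<m. 5 / (4 * \<mu>) * ((\<delta> i)\<^sup>2 * w i) + 5 * \<omega> * (D * (D - 2)) * (\<delta> i)\<^sup>2)"
    by (intro sum.cong) (auto simp: algebra_simps)
  also have "\<dots> = 5 / (4 * \<mu>) * Q + 5 * \<omega> * (D * (D - 2)) * 1"
    unfolding sum.distrib sum_distrib_left[symmetric] \<delta> Q ..
  also have "\<dots> \<le> 5 / (4 * \<mu>) * Q + Q * (D - 2) / 12"
  proof -
    have "(60 * D * \<omega>) * ((D - 2) / 12) \<le> Q * ((D - 2) / 12)"
      using \<omega>(2) D by (intro mult_right_mono) auto
    moreover have "(60 * D * \<omega>) * ((D - 2) / 12) = 5 * \<omega> * (D * (D - 2)) * 1" by simp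
    ultimately show ?thesis by linarith
  qed
  also have "\<dots> \<le> D * Q / (2 * \<mu>)"
  proof -
    \<comment> \<open>After clearing denominators everything rests on
      \<open>15 * D + (D - 1)\<^sup>2 \<le> 6 * D\<^sup>2\<close>, for which the constants 5 and 60
      leave just enough room: at \<open>D = 3\<close> it reads 49 <= 54.\<close>
    have "3 * D \<le> D * D" using D by (intro mult_right_mono) auto
    moreover have "(D - 1)\<^sup>2 = D * D - 2 * D + 1" by (simp add: power2_eq_square algebra_simps)
    ultimately have "15 * D + (D - 1)\<^sup>2 \<le> 6 * D\<^sup>2"
      using D unfolding power2_eq_square[of D] by linarith
    then have "0 \<le> (6 * D\<^sup>2 - (15 * D + (D - 1)\<^sup>2)) * (D - 2) * Q / (12 * (D - 1)\<^sup>2)"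
      using D Q0 by (intro divide_nonneg_nonneg mult_nonneg_nonneg) auto
    also have "\<dots> = D * Q / (2 * \<mu>) - (5 / (4 * \<mu>) * Q + Q * (D - 2) / 12)"
    proof -
      have 1: "5 / (4 * \<mu>) = 15 * (D * (D - 2)) / (12 * (D - 1)\<^sup>2)"
        "D * Q / (2 * \<mu>) = 6 * (D\<^sup>2 * (D - 2)) * Q / (12 * (D - 1)\<^sup>2)"
        unfolding \<mu>_def by (simp_all add: power2_eq_square)
      have 2: "Q * (D - 2) / 12 = Q * (D - 2) * (D - 1)\<^sup>2 / (12 * (D - 1)\<^sup>2)" using D by simp
      show ?thesis unfolding 1 2 times_divide_eq_left add_divide_distrib[symmetric]
          diff_divide_distrib[symmetric]
        by (simp add: power2_eq_square algebra_simps)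
    qed
    finally show ?thesis by simp
  qed
  finally have B: "(\<Sum>i<m. (\<delta> i)\<^sup>2 * ((w i)\<^sup>2 / g i)) \<le> D * Q / (2 * \<mu>)" .
  have "(\<Sum>i<m. w i * \<delta> i * x i)\<^sup>2 = (\<Sum>i<m. (w i * \<delta> i / sqrt (g i)) * (sqrt (g i) * x i))\<^sup>2"
    using g by (intro arg_cong[of _ _ "\<lambda>z. z\<^sup>2"] sum.cong) (auto simp: less_imp_neq[symmetric] order_less_imp_not_eq2)
  also have "\<dots> \<le> (\<Sum>i<m. (w i * \<delta> i / sqrt (g i))\<^sup>2) * (\<Sum>i<m. (sqrt (g i) * x i)\<^sup>2)"
    by (rule Cauchy_Schwarz_ineq_sum)
  also have "(\<Sum>i<m. (w i * \<delta> i / sqrt (g i))\<^sup>2) = (\<Sum>i<m. (\<delta> i)\<^sup>2 * ((w i)\<^sup>2 / g i))"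
    using g by (intro sum.cong) (auto simp: power_mult_distrib power_divide less_imp_le)
  also have "(\<Sum>i<m. (sqrt (g i) * x i)\<^sup>2) = (\<Sum>i<m. g i * (x i)\<^sup>2)"
    using g by (intro sum.cong) (auto simp: power_mult_distrib less_imp_le)
  also have "(\<Sum>i<m. (\<delta> i)\<^sup>2 * ((w i)\<^sup>2 / g i)) * (\<Sum>i<m. g i * (x i)\<^sup>2)
      \<le> D * Q / (2 * \<mu>) * (\<Sum>i<m. g i * (x i)\<^sup>2)"
    using g by (intro mult_right_mono B sum_nonneg) (auto simp: less_imp_le)
  finally have "(\<Sum>i<m. w i * \<delta> i * x i)\<^sup>2 \<le> D * Q / (2 * \<mu>) * (\<Sum>i<m. g i * (x i)\<^sup>2)" .
  then have "\<mu> * (2 / D * ((\<Sum>i<m. w i * \<delta> i * x i)\<^sup>2 / Q)) \<le> (\<Sum>i<m. g i * (x i)\<^sup>2)"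
    using D Q0 \<mu>1 by (simp add: divide_simps mult_ac)
  also have "\<dots> = \<mu> * (\<Sum>i<m. w i * (x i)\<^sup>2) - \<omega> * (\<Sum>i<m. (x i)\<^sup>2)"
    by (simp add: g_def sum_distrib_left sum_subtractf[symmetric] algebra_simps)
  finally show ?thesis unfolding \<mu>_def[symmetric] by (simp add: algebra_simps)
qed

section \<open>Volume of the cut ellipsoid\<close>

lemma prod_eigenvalues_eq_det:
  assumes "spectral m A V l"
  shows "(\<Prod>i<m. l i) = det (mat m m (\<lambda>(i, j). A i j))"
proof -
  let ?V = "mat m m (\<lambda>(i, j). V i j)"
  let ?L = "mat m m (\<lambda>(i, j). if i = j then l i else 0)"
  have orth: "transpose_mat ?V * ?V = 1\<^sub>m m"
    using assms by (intro eq_matI)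
      (auto simp: scalar_prod_def lessThan_atLeast0[symmetric] spectral_def orthonormal_family_def)
  have LV: "?L * transpose_mat ?V = mat m m (\<lambda>(k, j). l k * V j k)"
    by (intro eq_matI)
      (auto simp: scalar_prod_def lessThan_atLeast0[symmetric] if_distrib[of "\<lambda>z. z * _"] cong: if_cong)
  have A: "mat m m (\<lambda>(i, j). A i j) = ?V * (?L * transpose_mat ?V)"
    unfolding LV using assms by (intro eq_matI)
      (auto simp: scalar_prod_def lessThan_atLeast0[symmetric] spectral_def mult_ac intro!: sum.cong)
  have "det (mat m m (\<lambda>(i, j). A i j)) = det ?V * (det ?L * det (transpose_mat ?V))"
    unfolding A
    by (subst det_mult[of _ m], simp, (simp add: mult_carrier_mat[of _ m m]), subst det_mult[of _ m]) auto
  also have "\<dots> = det ?L * det (transpose_mat ?V * ?V)"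
    by (subst det_mult[of _ m]) auto
  also have "\<dots> = det ?L" by (simp add: orth)
  also have "\<dots> = (\<Prod>i<m. l i)"
    by (subst det_upper_triangular[of _ m])
      (auto simp: prod_list_diag_prod lessThan_atLeast0 intro!: prod.cong)
  finally show ?thesis ..
qed

text \<open>Pulling out the diagonal factor leaves the identity minus a rank-one matrix of trace
  \<open>c * Q / Q = c\<close>.\<close>

lemma det_diag_minus_rank_one:
  fixes w \<delta> :: "nat \<Rightarrow> real"
  assumes Q: "Q = (\<Sum>i<m. (\<delta> i)\<^sup>2 * w i)" "Q \<noteq> 0"
  shows "det (mat m m (\<lambda>(i, j). \<mu> * ((if i = j then w i else 0) - c * (w i * \<delta> i * (w j * \<delta> j) / Q))))
    = \<mu> ^ m * (1 - c) * (\<Prod>i<m. w i)" (is "det ?N = _")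
proof -
  let ?W = "mat m m (\<lambda>(i, j). if i = j then \<mu> * w i else 0)"
  let ?D = "mat m m (\<lambda>(i, j). (if i = j then 1 else 0) - \<delta> i * (c * w j * \<delta> j / Q))"
  have "?N = ?W * ?D"
  proof (intro eq_matI)
    fix i j assume "i < dim_row (?W * ?D)" "j < dim_col (?W * ?D)"
    then have ij: "i < m" "j < m" by auto
    have "(?W * ?D) $$ (i, j) = (\<Sum>k<m. ?W $$ (i, k) * ?D $$ (k, j))"
      using ij by (simp add: scalar_prod_def lessThan_atLeast0[symmetric])
    also have "\<dots> = (\<Sum>k<m. if k = i then \<mu> * w i * ?D $$ (i, j) else 0)"
      using ij by (intro sum.cong) auto
    also have "\<dots> = \<mu> * w i * ?D $$ (i, j)" using ij by simp
    finally show "?N $$ (i, j) = (?W * ?D) $$ (i, j)" using ij by (auto simp: algebra_simps)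
  qed auto
  then have "det ?N = det ?W * det ?D" by (simp add: det_mult[of _ m])
  also have "det ?W = \<mu> ^ m * (\<Prod>i<m. w i)"
    by (subst det_upper_triangular[of _ m])
      (auto simp: prod_list_diag_prod lessThan_atLeast0[symmetric] prod.distrib)
  also have "det ?D = 1 - (\<Sum>i<m. \<delta> i * (c * w i * \<delta> i / Q))"
    by (rule det_one_minus_rank_one)
  also have "(\<Sum>i<m. \<delta> i * (c * w i * \<delta> i / Q)) = (\<Sum>i<m. (\<delta> i)\<^sup>2 * w i) * (c / Q)"
    unfolding sum_distrib_right by (intro sum.cong) (auto simp: power2_eq_square)
  also have "\<dots> = c" using Q by simp
  finally show ?thesis by simp
qed

text \<open>One factor \<open>\<mu>\<close> merges with \<open>1 - 2 / D\<close> into the square of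
  \<open>1 - 1 / D\<close>. By \<open>1 + x <= exp x\<close> this square contributes the exponent
  \<open>- 2 / D\<close>, while the remaining \<open>m - 1 = D - 2\<close> factors contribute
  \<open>(D - 2) / (D * (D - 2)) = 1 / D\<close>.\<close>

lemma volume_factor:
  assumes m: "m \<ge> 2" and D: "D = real (Suc m)"
  shows "((D - 1)\<^sup>2 / (D * (D - 2))) ^ m * (1 - 2 / D) \<le> exp (- 1 / D)"
proof -
  define \<mu> where "\<mu> = (D - 1)\<^sup>2 / (D * (D - 2))"
  have D3: "D \<ge> 3" using m D by simp
  have \<mu>: "\<mu> = 1 + 1 / (D * (D - 2))"
    unfolding \<mu>_def using D3 by (simp add: divide_simps) (simp add: power2_eq_square algebra_simps)
  have \<mu>0: "\<mu> \<ge> 0" unfolding \<mu> using D3 by simp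
  have "\<mu> ^ m * (1 - 2 / D) = \<mu> ^ (m - 1) * (\<mu> * (1 - 2 / D))"
    using m by (cases m) auto
  also have "\<mu> * (1 - 2 / D) = (1 - 1 / D)\<^sup>2"
    unfolding \<mu>_def using D3 by (simp add: divide_simps) (simp add: power2_eq_square algebra_simps)
  also have "\<mu> ^ (m - 1) * (1 - 1 / D)\<^sup>2 \<le> exp (1 / (D * (D - 2))) ^ (m - 1) * (exp (- 1 / D))\<^sup>2"
  proof (intro mult_mono power_mono)
    show "\<mu> \<le> exp (1 / (D * (D - 2)))" unfolding \<mu> by (rule exp_ge_add_one_self)
    show "1 - 1 / D \<le> exp (- 1 / D)" using exp_ge_add_one_self[of "- 1 / D"] by simp
  qed (use \<mu>0 D3 in auto)
  also have "\<dots> = exp (real (m - 1) * (1 / (D * (D - 2))) + 2 * (- 1 / D))"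
    by (simp add: exp_of_nat_mult[symmetric] exp_add power2_eq_square mult_exp_exp)
  also have "real (m - 1) * (1 / (D * (D - 2))) = 1 / D"
    using D m by (simp add: of_nat_diff divide_simps)
  finally show ?thesis by (simp add: \<mu>_def)
qed

section \<open>Elliptic cones\<close>

definition cone_matrix :: "(nat \<Rightarrow> real) \<Rightarrow> (nat \<Rightarrow> nat \<Rightarrow> real) \<Rightarrow> nat \<Rightarrow> nat \<Rightarrow> real" where
  "cone_matrix a N i j =
     (case i of
        0 \<Rightarrow> (case j of 0 \<Rightarrow> 1 | Suc j' \<Rightarrow> a j')
      | Suc i' \<Rightarrow> (case j of 0 \<Rightarrow> a i' | Suc j' \<Rightarrow> a i' * a j' - N i' j'))"

lemma cone_matrix_mult_vec:
  fixes a x :: "nat \<Rightarrow> real" and m :: nat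
  defines "t \<equiv> x 0 + (\<Sum>i<m. a i * x (Suc i))"
  shows "(\<Sum>j<Suc m. cone_matrix a N 0 j * x j) = t"
    and "(\<Sum>j<Suc m. cone_matrix a N (Suc i) j * x j) = a i * t - (\<Sum>j<m. N i j * x (Suc j))"
  unfolding t_def sum.lessThan_Suc_shift
  by (simp_all add: cone_matrix_def algebra_simps sum_subtractf sum_distrib_left)

lemma quad_form_mult_vec: "quad_form m A x = (\<Sum>i<m. x i * (\<Sum>j<m. A i j * x j))"
  by (simp add: quad_form_def sum_distrib_left mult_ac)

text \<open>Completing the square exhibits a congruence with the block diagonal matrix of 1 and
  \<open>- N\<close>. All information on the signs and sizes of the eigenvalues is drawn from
  this.\<close>

lemma quad_form_cone_matrix:
  "quad_form (Suc m) (cone_matrix a N) x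
    = (x 0 + (\<Sum>i<m. a i * x (Suc i)))\<^sup>2 - quad_form m N (\<lambda>i. x (Suc i))"
proof -
  let ?t = "x 0 + (\<Sum>i<m. a i * x (Suc i))"
  have "quad_form (Suc m) (cone_matrix a N) x
      = x 0 * ?t + (\<Sum>i<m. x (Suc i) * (a i * ?t - (\<Sum>j<m. N i j * x (Suc j))))"
    unfolding quad_form_mult_vec
    by (subst sum.lessThan_Suc_shift) (simp only: cone_matrix_mult_vec)
  also have "\<dots> = x 0 * ?t + (\<Sum>i<m. a i * x (Suc i)) * ?t
      - (\<Sum>i<m. x (Suc i) * (\<Sum>j<m. N i j * x (Suc j)))"
    by (simp add: right_diff_distrib sum_subtractf sum_distrib_right mult_ac)
  finally show ?thesis
    unfolding quad_form_mult_vec by (simp add: power2_eq_square algebra_simps)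
qed

section \<open>Spectrum of the cone matrix, and the cone in its eigenbasis\<close>

context
  fixes m :: nat and a E L :: "nat \<Rightarrow> real" and N Q V :: "nat \<Rightarrow> nat \<Rightarrow> real"
  assumes N: "spectral m N Q E" and E: "\<And>k. k < m \<Longrightarrow> 0 < E k"
    and M: "spectral (Suc m) (cone_matrix a N) V L"
begin

lemma quad_form_pos:
  assumes "i < m" "x i \<noteq> 0" shows "0 < quad_form m N x"
proof -
  have "0 < E (m - 1) * (\<Sum>i<m. (x i)\<^sup>2)"
    using assms E[of "m - 1"] by (intro mult_pos_pos sum_pos2[of _ i]) auto
  also have "\<dots> \<le> quad_form m N x"
    using N by (intro spectral_ge_least[OF N]) (auto simp: spectral_def)
  finally show ?thesis .
qed

lemma quad_form_nonneg: "0 \<le> quad_form m N x"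
  using spectral_ge_least[OF N, of 0 x] E by (auto simp: less_imp_le)

text \<open>The first canonical vector is the test vector. The value 1, beyond mere positivity,
  later allows the top eigenvalue to be dropped from the cone inequality.\<close>

lemma cone_matrix_top_eigenvalue: "1 \<le> L 0"
proof -
  define x :: "nat \<Rightarrow> real" where "x i = (if i = 0 then 1 else 0)" for i
  have "quad_form m N (\<lambda>i. x (Suc i)) = 0" by (simp add: quad_form_def x_def)
  then have "1 = quad_form (Suc m) (cone_matrix a N) x"
    unfolding quad_form_cone_matrix by (simp add: x_def)
  also have "\<dots> \<le> L 0 * (\<Sum>i<Suc m. (x i)\<^sup>2)"
    by (intro spectral_le_above[OF M]) auto
  also have "(\<Sum>i<Suc m. (x i)\<^sup>2) = 1"
    unfolding sum.lessThan_Suc_shift by (simp add: x_def)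
  finally show ?thesis by simp
qed

text \<open>Sylvester's law of inertia by a dimension count. If \<open>L 1\<close> were nonnegative,
  so would be the form on vectors orthogonal to the eigenvectors 2 to \<open>m\<close>. These are
  \<open>m - 1\<close> constraints; one more makes the square in
  \<open>quad_form_cone_matrix\<close> vanish, and a nonzero solution remains, on which the form is
  negative.\<close>

lemma cone_matrix_negative_eigenvalues:
  assumes "i < m" shows "L (Suc i) < 0"
proof (rule ccontr)
  assume "\<not> L (Suc i) < 0"
  moreover have "L (Suc i) \<le> L 1" using M assms by (auto simp: spectral_def)
  ultimately have L1: "0 \<le> L 1" by simp
  define A where "A r j = (if r = 0 then (case j of 0 \<Rightarrow> 1 | Suc j' \<Rightarrow> a j') else V j (Suc r))" for r j
  obtain x where x: "\<exists>i<Suc m. x i \<noteq> 0" and A: "\<And>r. r < m \<Longrightarrow> (\<Sum>j<Suc m. A r j * x j) = 0"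
    using homogeneous_nontrivial_solution[of m "Suc m" A] by auto
  have t: "x 0 + (\<Sum>i<m. a i * x (Suc i)) = 0"
    using A[of 0] assms unfolding sum.lessThan_Suc_shift by (simp add: A_def)
  have "\<exists>i<m. x (Suc i) \<noteq> 0"
  proof (rule ccontr)
    assume "\<not> (\<exists>i<m. x (Suc i) \<noteq> 0)"
    then have 0: "x (Suc i) = 0" if "i < m" for i using that by auto
    then have "x 0 = 0" using t by simp
    moreover obtain i where "i < Suc m" "x i \<noteq> 0" using x by blast
    ultimately show False using 0[of "i - 1"] by (cases i) auto
  qed
  then obtain i where "i < m" "x (Suc i) \<noteq> 0" by blast
  then have "0 < quad_form m N (\<lambda>i. x (Suc i))" by (intro quad_form_pos[of i]) auto
  then have "quad_form (Suc m) (cone_matrix a N) x < 0"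
    unfolding quad_form_cone_matrix t by simp
  moreover have "0 \<le> quad_form (Suc m) (cone_matrix a N) x"
    unfolding spectral_quad_form[OF M]
  proof (intro sum_nonneg)
    fix k assume k: "k \<in> {..<Suc m}"
    consider "k = 0" | "k = 1" | r where "k = Suc (Suc r)" by (metis One_nat_def not0_implies_Suc)
    then show "0 \<le> L k * (\<Sum>i<Suc m. V i k * x i)\<^sup>2"
    proof cases
      case 3
      then show ?thesis using A[of "Suc r"] k by (simp add: A_def)
    qed (use L1 cone_matrix_top_eigenvalue in auto)
  qed
  ultimately show False by simp
qed

text \<open>Courant--Fischer by a dimension count: \<open>m\<close> orthogonality constraints on a vector of dimension
  \<open>m + 1\<close> leave a common test vector for both spectra.\<close>

lemma cone_matrix_eigenvalue_bound:
  assumes i: "i < m" shows "- E (m - Suc i) \<le> L (Suc i)"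
proof (rule ccontr)
  assume less: "\<not> ?thesis"
  define A where "A r j = (if r \<le> i then V j r else (case j of 0 \<Rightarrow> 0 | Suc j' \<Rightarrow> Q j' (r - Suc i)))" for r j
  obtain x where x: "\<exists>i<Suc m. x i \<noteq> 0" and A: "\<And>r. r < m \<Longrightarrow> (\<Sum>j<Suc m. A r j * x j) = 0"
    using homogeneous_nontrivial_solution[of m "Suc m" A] by auto
  have x0: "0 < (\<Sum>i<Suc m. (x i)\<^sup>2)"
  proof -
    obtain i where "i < Suc m" "x i \<noteq> 0" using x by blast
    then show ?thesis by (intro sum_pos2[of _ i]) auto
  qed
  have "quad_form (Suc m) (cone_matrix a N) x \<le> L (Suc i) * (\<Sum>i<Suc m. (x i)\<^sup>2)"
  proof (intro spectral_le_above[OF M])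
    fix k assume "k < Suc i"
    then show "(\<Sum>i<Suc m. V i k * x i) = 0" using A[of k] i by (simp add: A_def)
  qed (use i in auto)
  also have "\<dots> < - E (m - Suc i) * (\<Sum>i<Suc m. (x i)\<^sup>2)"
    using less x0 by (intro mult_strict_right_mono) auto
  also have "\<dots> \<le> - (E (m - Suc i) * (\<Sum>i<m. (x (Suc i))\<^sup>2))"
    using E[of "m - Suc i"] i unfolding sum.lessThan_Suc_shift by (simp add: algebra_simps)
  also have "\<dots> \<le> - quad_form m N (\<lambda>i. x (Suc i))"
  proof (subst neg_le_iff_le, intro spectral_le_above[OF N])
    fix k assume "k < m - Suc i"
    then show "(\<Sum>i<m. Q i k * x (Suc i)) = 0"
      using A[of "k + Suc i"] unfolding sum.lessThan_Suc_shift by (simp add: A_def)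
  qed (use i in auto)
  also have "\<dots> \<le> quad_form (Suc m) (cone_matrix a N) x"
    unfolding quad_form_cone_matrix by simp
  finally show False by simp
qed

text \<open>The first row of the eigenvector equation gives the first identity; inserting it into
  the completed square gives the second. Together they place the shifted ellipsoid strictly on the
  positive side of the new axis.\<close>

lemma cone_matrix_top_eigenvector:
  shows "(\<Sum>i<m. a i * V (Suc i) 0) = (L 0 - 1) * V 0 0"
    and "quad_form m N (\<lambda>i. V (Suc i) 0) = (L 0 * V 0 0)\<^sup>2 - L 0"
proof -
  have orth: "(\<Sum>j<Suc m. V j k * V j 0) = (if k = 0 then 1 else 0)" if "k < Suc m" for k
    using M that by (auto simp: spectral_def orthonormal_family_def)
  have "V 0 0 + (\<Sum>i<m. a i * V (Suc i) 0) = (\<Sum>j<Suc m. cone_matrix a N 0 j * V j 0)"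
    unfolding cone_matrix_mult_vec ..
  also have "\<dots> = (\<Sum>k<Suc m. L k * V 0 k * (\<Sum>j<Suc m. V j k * V j 0))"
    by (rule spectral_mult_vec[OF M]) simp
  also have "\<dots> = (\<Sum>k<Suc m. L k * V 0 k * (if k = 0 then 1 else 0))"
    by (intro sum.cong refl) (simp only: orth lessThan_iff)
  also have "\<dots> = L 0 * V 0 0" unfolding sum.lessThan_Suc_shift by simp
  finally have *: "V 0 0 + (\<Sum>i<m. a i * V (Suc i) 0) = L 0 * V 0 0" .
  then show "(\<Sum>i<m. a i * V (Suc i) 0) = (L 0 - 1) * V 0 0" by (simp add: algebra_simps)
  have "quad_form (Suc m) (cone_matrix a N) (\<lambda>i. V i 0) = L 0"
    by (rule spectral_eigenvalue[OF M]) simp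
  then show "quad_form m N (\<lambda>i. V (Suc i) 0) = (L 0 * V 0 0)\<^sup>2 - L 0"
    unfolding quad_form_cone_matrix * by simp
qed

text \<open>The cone over the ellipsoid is \<open>{x. x \<bullet> M\<inverse> x \<ge> 0}\<close>, which is a diagonal form in the
  coordinates \<open>V\<^sup>T x\<close>; replacing the eigenvalue moduli by the larger \<open>E\<close> only enlarges it.\<close>

lemma cone_in_eigenbasis:
  fixes z :: "nat \<Rightarrow> real"
  assumes z: "\<And>q. (\<Sum>i<m. (z i - a i) * q i)\<^sup>2 \<le> quad_form m N q" and V00: "0 \<le> V 0 0"
  defines "x \<equiv> (\<lambda>i. case i of 0 \<Rightarrow> 1 | Suc j \<Rightarrow> z j)"
  defines "y \<equiv> (\<lambda>k. \<Sum>i<Suc m. V i k * x i)"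
  shows "0 < y 0"
    and "(\<Sum>i<m. y (Suc i) * q i)\<^sup>2 \<le> (y 0)\<^sup>2 * (\<Sum>i<m. E (m - Suc i) * (q i)\<^sup>2)"
proof -
  note L0 = cone_matrix_top_eigenvalue
  have orth: "orthonormal_family (Suc m) V" using M by (simp add: spectral_def)
  \<comment> \<open>Otherwise the form of \<open>N\<close> would take the value
    \<open>- L 0 < 0\<close>.\<close>
  have "V 0 0 \<noteq> 0"
    using cone_matrix_top_eigenvector(2) quad_form_nonneg[of "\<lambda>i. V (Suc i) 0"] L0 by auto
  then have p: "0 < L 0 * V 0 0" using V00 L0 by simp
  have "(\<Sum>i<m. (z i - a i) * V (Suc i) 0)\<^sup>2 < (L 0 * V 0 0)\<^sup>2"
    using z[of "\<lambda>i. V (Suc i) 0"] L0 unfolding cone_matrix_top_eigenvector by linarith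
  then have "\<bar>\<Sum>i<m. (z i - a i) * V (Suc i) 0\<bar> < L 0 * V 0 0"
    using p by (metis abs_of_pos power2_less_imp_less abs_ge_zero order_less_imp_le power2_abs)
  moreover have "y 0 = L 0 * V 0 0 + (\<Sum>i<m. (z i - a i) * V (Suc i) 0)"
    using cone_matrix_top_eigenvector(1) unfolding y_def sum.lessThan_Suc_shift
    by (simp add: x_def left_diff_distrib sum_subtractf algebra_simps)
  ultimately show y0: "0 < y 0" by linarith
  \<comment> \<open>\<open>k\<close> is the inverse of \<open>M\<close> applied to \<open>x\<close>,
    obtained by dividing the eigenbasis coordinates by the eigenvalues.\<close>
  define k where "k i = (\<Sum>l<Suc m. V i l * (y l / L l))" for i
  have Lnz: "L l \<noteq> 0" if "l < Suc m" for l
    using that L0 cone_matrix_negative_eigenvalues[of "l - 1"] by (cases l) auto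
  have Mk: "(\<Sum>j<Suc m. cone_matrix a N i j * k j) = x i" if i: "i < Suc m" for i
  proof -
    have "(\<Sum>j<Suc m. cone_matrix a N i j * k j) = (\<Sum>l<Suc m. L l * V i l * (\<Sum>j<Suc m. V j l * k j))"
      by (rule spectral_mult_vec[OF M i])
    also have "\<dots> = (\<Sum>l<Suc m. V i l * y l)"
    proof (intro sum.cong refl)
      fix l assume "l \<in> {..<Suc m}"
      then have l: "l < Suc m" by simp
      have kl: "(\<Sum>j<Suc m. V j l * k j) = y l / L l"
        unfolding k_def by (rule orthonormal_family_coords[OF orth l])
      show "L l * V i l * (\<Sum>j<Suc m. V j l * k j) = V i l * y l"
        unfolding kl using Lnz[OF l] by simp
    qed
    also have "\<dots> = x i" unfolding y_def by (rule orthonormal_family_expand[OF orth i])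
    finally show ?thesis .
  qed
  have s: "k 0 + (\<Sum>i<m. a i * k (Suc i)) = 1"
    using Mk[of 0] unfolding cone_matrix_mult_vec by (simp add: x_def)
  have Nk: "(\<Sum>j<m. N i j * k (Suc j)) = a i - z i" if "i < m" for i
    using Mk[of "Suc i"] that unfolding cone_matrix_mult_vec s by (simp add: x_def)
  define \<theta> where "\<theta> = quad_form m N (\<lambda>i. k (Suc i))"
  have \<theta>: "\<theta> = - (\<Sum>i<m. (z i - a i) * k (Suc i))"
    unfolding \<theta>_def quad_form_mult_vec sum_negf[symmetric]
    by (intro sum.cong refl) (simp add: Nk algebra_simps)
  \<comment> \<open>The tail of \<open>k\<close> solves \<open>N k = a - z\<close>, so
    \<open>\<theta>\<close> is the value of the inverse form at \<open>z - a\<close>. Testing the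
    hypothesis with this tail yields membership in the form \<open>\<theta> \<le> 1\<close>.\<close>
  have "\<theta>\<^sup>2 \<le> \<theta>"
    using z[of "\<lambda>i. k (Suc i)"] unfolding \<theta>_def[symmetric] by (simp add: \<theta>)
  moreover have "0 \<le> \<theta>" unfolding \<theta>_def by (rule quad_form_nonneg)
  ultimately have \<theta>1: "\<theta> \<le> 1" by (cases "\<theta> = 0") (auto simp: power2_eq_square)
  have "(\<Sum>l<Suc m. y l * (y l / L l)) = (\<Sum>i<Suc m. x i * k i)"
  proof -
    have "(\<Sum>l<Suc m. y l * (y l / L l)) = (\<Sum>l<Suc m. (\<Sum>j<Suc m. V j l * x j) * (\<Sum>j<Suc m. V j l * k j))"
    proof (intro sum.cong refl)
      fix l assume "l \<in> {..<Suc m}"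
      then have l: "l < Suc m" by simp
      have kl: "(\<Sum>j<Suc m. V j l * k j) = y l / L l"
        unfolding k_def by (rule orthonormal_family_coords[OF orth l])
      show "y l * (y l / L l) = (\<Sum>j<Suc m. V j l * x j) * (\<Sum>j<Suc m. V j l * k j)"
        unfolding kl y_def ..
    qed
    then show ?thesis unfolding orthonormal_family_inner[OF orth] .
  qed
  also have "\<dots> = k 0 + (\<Sum>i<m. z i * k (Suc i))"
    unfolding sum.lessThan_Suc_shift by (simp add: x_def)
  also have "\<dots> = 1 - \<theta>"
    using s unfolding \<theta> by (simp add: left_diff_distrib sum_subtractf)
  finally have "0 \<le> (\<Sum>l<Suc m. y l * (y l / L l))" using \<theta>1 by simp
  then have "(\<Sum>i<m. (y (Suc i))\<^sup>2 / - L (Suc i)) \<le> (y 0)\<^sup>2 / L 0"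
    unfolding sum.lessThan_Suc_shift by (simp add: sum_negf power2_eq_square)
  \<comment> \<open>The top eigenvalue is discarded here. Cauchy-Schwarz then leads from the inverse
    form back to the support form, where the moduli are replaced by \<open>E\<close>.\<close>
  also have "\<dots> \<le> (y 0)\<^sup>2 / 1" using L0 by (intro divide_left_mono) auto
  finally have cone: "(\<Sum>i<m. (y (Suc i))\<^sup>2 / - L (Suc i)) \<le> (y 0)\<^sup>2" by simp
  have neg: "0 < - L (Suc i)" if "i < m" for i
    using cone_matrix_negative_eigenvalues[OF that] by simp
  have "(\<Sum>i<m. y (Suc i) * q i)\<^sup>2
      = (\<Sum>i<m. (y (Suc i) / sqrt (- L (Suc i))) * (sqrt (- L (Suc i)) * q i))\<^sup>2"
    by (intro arg_cong[of _ _ "\<lambda>z. z\<^sup>2"] sum.cong refl) (use neg in fastforce)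
  also have "\<dots> \<le> (\<Sum>i<m. (y (Suc i) / sqrt (- L (Suc i)))\<^sup>2) * (\<Sum>i<m. (sqrt (- L (Suc i)) * q i)\<^sup>2)"
    by (rule Cauchy_Schwarz_ineq_sum)
  also have "(\<Sum>i<m. (y (Suc i) / sqrt (- L (Suc i)))\<^sup>2) = (\<Sum>i<m. (y (Suc i))\<^sup>2 / - L (Suc i))"
    by (intro sum.cong refl) (use neg in \<open>simp add: power_divide less_imp_le\<close>)
  also have "(\<Sum>i<m. (sqrt (- L (Suc i)) * q i)\<^sup>2) = (\<Sum>i<m. - L (Suc i) * (q i)\<^sup>2)"
    by (intro sum.cong refl) (use neg in \<open>simp add: power_mult_distrib less_imp_le\<close>)
  also have "(\<Sum>i<m. (y (Suc i))\<^sup>2 / - L (Suc i)) * (\<Sum>i<m. - L (Suc i) * (q i)\<^sup>2)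
      \<le> (y 0)\<^sup>2 * (\<Sum>i<m. E (m - Suc i) * (q i)\<^sup>2)"
  proof (intro mult_mono cone sum_mono sum_nonneg mult_right_mono)
    fix i assume "i \<in> {..<m}"
    then show "- L (Suc i) \<le> E (m - Suc i)" using cone_matrix_eigenvalue_bound[of i] by simp
    show "0 \<le> - L (Suc i) * (q i)\<^sup>2"
      using neg[of i] \<open>i \<in> {..<m}\<close> by (intro mult_nonneg_nonneg) auto
  qed (use E in \<open>auto simp: less_imp_le\<close>)
  finally show "(\<Sum>i<m. y (Suc i) * q i)\<^sup>2 \<le> (y 0)\<^sup>2 * (\<Sum>i<m. E (m - Suc i) * (q i)\<^sup>2)" .
qed

end

text \<open>From the support form to the inverse form: for the sum \<open>S\<close> on the left, the
  test vector \<open>z / w\<close> turns the hypothesis into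
  \<open>S\<^sup>2 \<le> S\<close>.\<close>

lemma inverse_form_le_one:
  fixes w z :: "nat \<Rightarrow> real"
  assumes w: "\<And>i. i < m \<Longrightarrow> 0 < w i"
    and z: "\<And>q. (\<Sum>i<m. z i * q i)\<^sup>2 \<le> (\<Sum>i<m. w i * (q i)\<^sup>2)"
  shows "(\<Sum>i<m. (z i / sqrt (w i))\<^sup>2) \<le> 1"
proof -
  define S where "S = (\<Sum>i<m. (z i / sqrt (w i))\<^sup>2)"
  have S0: "0 \<le> S" unfolding S_def by (intro sum_nonneg) auto
  have "(\<Sum>i<m. z i * (z i / w i)) = S" "(\<Sum>i<m. w i * (z i / w i)\<^sup>2) = S"
    unfolding S_def by (intro sum.cong refl; use w in \<open>force simp: power_divide power2_eq_square less_imp_le\<close>)+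
  then have "S\<^sup>2 \<le> S" using z[of "\<lambda>i. z i / w i"] by simp
  then show ?thesis using S0 unfolding S_def[symmetric]
    by (cases "S = 0") (auto simp: power2_eq_square)
qed

section \<open>A central cut of a diagonal ellipsoid in dimension at least two\<close>

context
  fixes m :: nat and D \<mu> Q \<omega> :: real and w \<delta> a b E :: "nat \<Rightarrow> real" and N P :: "nat \<Rightarrow> nat \<Rightarrow> real"
  assumes m: "2 \<le> m" and D: "D = real (Suc m)"
    and w: "\<And>i. i < m \<Longrightarrow> \<omega> \<le> w i" and \<omega>: "0 < \<omega>" "60 * D * \<omega> \<le> Q"
    and \<delta>: "(\<Sum>i<m. (\<delta> i)\<^sup>2) = 1" and Q: "Q = (\<Sum>i<m. (\<delta> i)\<^sup>2 * w i)"
    and \<mu>: "\<mu> = (D - 1)\<^sup>2 / ((D - 1)\<^sup>2 - 1)"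
    and b: "\<And>i. i < m \<Longrightarrow> b i = w i * \<delta> i / sqrt Q"
    and a: "\<And>i. i < m \<Longrightarrow> a i = 1 / D * b i"
    and N: "\<And>i j. i < m \<Longrightarrow> j < m \<Longrightarrow>
      N i j = \<mu> * ((if i = j then w i else 0) - 2 / D * (b i * b j))"
    and E: "spectral m N P E"
begin

lemma cut_D_ge_3: "3 \<le> D" using m D by simp

lemma cut_Q_pos: "0 < Q"
  using \<omega> cut_D_ge_3 by (smt (verit) mult_pos_pos)

lemma cut_\<mu>: "\<mu> = (D - 1)\<^sup>2 / (D * (D - 2))"
  unfolding \<mu> by (rule arg_cong[of _ _ "\<lambda>z. _ / z"]) (simp add: power2_eq_square algebra_simps)

lemma cut_w_pos: "i < m \<Longrightarrow> 0 < w i"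
  using w \<omega> by force

lemma quad_form_cut:
  "quad_form m N q = \<mu> * ((\<Sum>i<m. w i * (q i)\<^sup>2) - 2 / D * (\<Sum>i<m. b i * q i)\<^sup>2)"
proof -
  have "quad_form m N q = (\<Sum>i<m. \<Sum>j<m.
      (if i = j then \<mu> * (w i * (q i)\<^sup>2) else 0) - \<mu> * (2 / D) * ((b i * q i) * (b j * q j)))"
    unfolding quad_form_def by (intro sum.cong refl) (simp add: N power2_eq_square algebra_simps)
  also have "\<dots> = (\<Sum>i<m. \<mu> * (w i * (q i)\<^sup>2))
      - \<mu> * (2 / D) * (\<Sum>i<m. \<Sum>j<m. (b i * q i) * (b j * q j))"
    by (simp add: sum_subtractf sum_distrib_left)
  also have "\<dots> = \<mu> * ((\<Sum>i<m. w i * (q i)\<^sup>2) - 2 / D * (\<Sum>i<m. b i * q i)\<^sup>2)"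
    by (simp add: power2_eq_square sum_product sum_distrib_left[symmetric] right_diff_distrib)
  finally show ?thesis .
qed

lemma cut_eigenvalue_ge:
  assumes "k < m" shows "\<omega> \<le> E k"
proof -
  have "(\<Sum>i<m. b i * x i) = (\<Sum>i<m. w i * \<delta> i * x i) / sqrt Q" for x :: "nat \<Rightarrow> real"
    unfolding sum_divide_distrib by (intro sum.cong refl) (simp add: b)
  then have "quad_form m N (\<lambda>i. P i k) = (D - 1)\<^sup>2 / (D * (D - 2)) *
      ((\<Sum>i<m. w i * (P i k)\<^sup>2) - 2 / D * ((\<Sum>i<m. w i * \<delta> i * P i k)\<^sup>2 / Q))"
    unfolding quad_form_cut cut_\<mu> using cut_Q_pos by (simp add: power_divide)
  moreover have "\<omega> * (\<Sum>i<m. (P i k)\<^sup>2) \<le> (D - 1)\<^sup>2 / (D * (D - 2)) *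
      ((\<Sum>i<m. w i * (P i k)\<^sup>2) - 2 / D * ((\<Sum>i<m. w i * \<delta> i * P i k)\<^sup>2 / Q))"
    by (rule least_eigenvalue_preserved[OF w \<omega> \<delta> Q cut_D_ge_3])
  ultimately show ?thesis using spectral_eigenvalue[OF E assms] by simp
qed

lemma cut_volume: "(\<Prod>k<m. E k) \<le> exp (- 1 / D) * (\<Prod>k<m. w k)"
proof -
  have "mat m m (\<lambda>(i, j). N i j)
    = mat m m (\<lambda>(i, j). \<mu> * ((if i = j then w i else 0) - 2 / D * (w i * \<delta> i * (w j * \<delta> j) / Q)))"
    using cut_Q_pos by (intro eq_matI) (simp_all add: N b)
  then have "(\<Prod>k<m. E k) = \<mu> ^ m * (1 - 2 / D) * (\<Prod>k<m. w k)"
    using prod_eigenvalues_eq_det[OF E] det_diag_minus_rank_one[OF Q, of \<mu> "2 / D"] cut_Q_pos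
    by simp
  also have "\<dots> \<le> exp (- 1 / D) * (\<Prod>k<m. w k)"
    unfolding cut_\<mu> using volume_factor[OF m D] cut_w_pos
    by (intro mult_right_mono prod_nonneg) (auto simp: less_imp_le)
  finally show ?thesis .
qed

text \<open>The scaling \<open>s = z / sqrt w\<close>,
  \<open>u = sqrt w * \<delta> / sqrt Q\<close>, \<open>p = sqrt w * q\<close> maps the ellipsoid to
  the unit ball and reduces the claim to \<open>central_cut\<close>. The vector \<open>u\<close> is
  normalized because \<open>Q\<close> is the value of the form at \<open>\<delta>\<close>.\<close>

lemma cut_contains:
  assumes z: "(\<Sum>i<m. (z i / sqrt (w i))\<^sup>2) \<le> 1" and cut: "0 \<le> (\<Sum>i<m. z i * \<delta> i)"
  shows "(\<Sum>i<m. (z i - a i) * q i)\<^sup>2 \<le> quad_form m N q"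
proof -
  let ?s = "\<lambda>i. z i / sqrt (w i)" and ?u = "\<lambda>i. sqrt (w i) * \<delta> i / sqrt Q"
    and ?p = "\<lambda>i. sqrt (w i) * q i"
  have u: "(\<Sum>i<m. (?u i)\<^sup>2) = 1"
  proof -
    have "(\<Sum>i<m. (?u i)\<^sup>2) = (\<Sum>i<m. (\<delta> i)\<^sup>2 * w i) / Q"
      unfolding sum_divide_distrib using cut_Q_pos cut_w_pos
      by (intro sum.cong refl) (simp add: power_divide power_mult_distrib less_imp_le)
    then show ?thesis using Q cut_Q_pos by simp
  qed
  have su: "(\<Sum>i<m. ?s i * ?u i) = (\<Sum>i<m. z i * \<delta> i) / sqrt Q"
    unfolding sum_divide_distrib
    by (intro sum.cong refl) (use cut_w_pos in \<open>force\<close>)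
  have 1: "(\<Sum>i<m. (?s i - ?u i / D) * ?p i) = (\<Sum>i<m. (z i - a i) * q i)"
  proof (intro sum.cong refl)
    fix i assume "i \<in> {..<m}"
    then have "0 < w i" and ab: "a i = 1 / D * (w i * \<delta> i / sqrt Q)" using cut_w_pos a b by auto
    define c where "c = sqrt (w i)"
    have "0 < c" "w i = c * c" using \<open>0 < w i\<close> by (auto simp: c_def)
    then show "(?s i - ?u i / D) * ?p i = (z i - a i) * q i"
      unfolding ab c_def[symmetric] by (simp add: field_simps)
  qed
  have 2: "(\<Sum>i<m. (?p i)\<^sup>2) = (\<Sum>i<m. w i * (q i)\<^sup>2)"
    using cut_w_pos by (intro sum.cong refl) (simp add: power_mult_distrib less_imp_le)
  have 3: "(\<Sum>i<m. ?u i * ?p i) = (\<Sum>i<m. b i * q i)"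
  proof (intro sum.cong refl)
    fix i assume "i \<in> {..<m}"
    then have "0 < w i" "b i = w i * \<delta> i / sqrt Q" using cut_w_pos b by auto
    then show "?u i * ?p i = b i * q i" by simp
  qed
  have "0 \<le> (\<Sum>i<m. ?s i * ?u i)" unfolding su using cut cut_Q_pos by simp
  from central_cut[OF z u this, of D ?p] show ?thesis
    unfolding 1 2 3 quad_form_cut cut_\<mu> using cut_D_ge_3 by simp
qed

text \<open>All conditions are homogeneous in \<open>y\<close>. Dividing by \<open>y 0\<close> moves
  to the slice of the cone that is an ellipsoid, where cut and eigenbasis are treated, and
  multiplying back gives the coordinates \<open>y'\<close> in the rotated frame.\<close>

lemma cone_update_correct:
  fixes y :: "nat \<Rightarrow> real"
  assumes M: "spectral (Suc m) (cone_matrix a N) V L" and V00: "0 \<le> V 0 0"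
    and y0: "0 < y 0"
    and y: "\<And>q. (\<Sum>i<m. y (Suc i) * q i)\<^sup>2 \<le> (y 0)\<^sup>2 * (\<Sum>i<m. w i * (q i)\<^sup>2)"
    and cut: "0 \<le> (\<Sum>i<m. y (Suc i) * \<delta> i)"
  defines "y' \<equiv> (\<lambda>k. \<Sum>i<Suc m. V i k * y i)"
  shows "0 < y' 0"
    and "(\<Sum>i<m. y' (Suc i) * q i)\<^sup>2 \<le> (y' 0)\<^sup>2 * (\<Sum>i<m. E (m - Suc i) * (q i)\<^sup>2)"
proof -
  define z where "z i = y (Suc i) / y 0" for i
  define x where "x = (\<lambda>i. case i of 0 \<Rightarrow> 1 | Suc j \<Rightarrow> z j)"
  have yx: "y i = y 0 * x i" for i using y0 by (cases i) (auto simp: x_def z_def)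
  have y'x: "y' k = y 0 * (\<Sum>i<Suc m. V i k * x i)" for k
  proof -
    have "y' k = (\<Sum>i<Suc m. V i k * (y 0 * x i))" unfolding y'_def by (subst yx) (rule refl)
    then show ?thesis by (simp only: sum_distrib_left mult.left_commute)
  qed
  have z1: "(\<Sum>i<m. (z i / sqrt (w i))\<^sup>2) \<le> 1"
  proof (rule inverse_form_le_one)
    fix q :: "nat \<Rightarrow> real"
    have "(\<Sum>i<m. z i * q i)\<^sup>2 = (\<Sum>i<m. y (Suc i) * q i)\<^sup>2 / (y 0)\<^sup>2"
      by (simp add: z_def power_divide[symmetric] sum_divide_distrib)
    also have "\<dots> \<le> (\<Sum>i<m. w i * (q i)\<^sup>2)"
      using y[of q] y0 by (simp add: divide_simps mult_ac)
    finally show "(\<Sum>i<m. z i * q i)\<^sup>2 \<le> (\<Sum>i<m. w i * (q i)\<^sup>2)" .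
  qed (rule cut_w_pos)
  have z2: "0 \<le> (\<Sum>i<m. z i * \<delta> i)"
    using cut y0 by (simp add: z_def sum_divide_distrib[symmetric])
  have E0: "0 < E k" if "k < m" for k using cut_eigenvalue_ge[OF that] \<omega> by simp
  note basis = cone_in_eigenbasis[OF E E0 M cut_contains[OF z1 z2] V00, folded x_def]
  show "0 < y' 0" unfolding y'x using basis(1) y0 by simp
  have "(\<Sum>i<m. y' (Suc i) * q i) = y 0 * (\<Sum>i<m. (\<Sum>j<Suc m. V j (Suc i) * x j) * q i)"
    unfolding y'x mult.assoc by (rule sum_distrib_left[symmetric])
  then have "(\<Sum>i<m. y' (Suc i) * q i)\<^sup>2 = (y 0)\<^sup>2 * (\<Sum>i<m. (\<Sum>j<Suc m. V j (Suc i) * x j) * q i)\<^sup>2"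
    by (simp only: power_mult_distrib)
  also have "\<dots> \<le> (y 0)\<^sup>2 * ((\<Sum>i<Suc m. V i 0 * x i)\<^sup>2 * (\<Sum>i<m. E (m - Suc i) * (q i)\<^sup>2))"
    using basis(2) by (intro mult_left_mono) auto
  also have "\<dots> = (y' 0)\<^sup>2 * (\<Sum>i<m. E (m - Suc i) * (q i)\<^sup>2)"
    unfolding y'x by (simp only: power_mult_distrib mult.assoc)
  finally show "(\<Sum>i<m. y' (Suc i) * q i)\<^sup>2 \<le> (y' 0)\<^sup>2 * (\<Sum>i<m. E (m - Suc i) * (q i)\<^sup>2)" .
qed

end

text \<open>In the plane the cone is a sector of slopes, and the cut keeps the slopes from 0 to
  \<open>sqrt w\<close> on the side of \<open>\<delta>\<close>, an interval whose midpoint has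
  modulus \<open>sqrt w / 2\<close>. The new axis points to this midpoint.\<close>

lemma planar_cone_update_correct:
  fixes y :: "nat \<Rightarrow> real" and V :: "nat \<Rightarrow> nat \<Rightarrow> real"
  assumes V: "orthonormal_family 2 V" and V0: "V 0 0 = 1 / r" "V 1 0 = a / r"
    and r: "r = sqrt (1 + a * a)" and a: "a = 1 / 2 * sqrt w * \<delta>" and \<delta>: "\<delta>\<^sup>2 = 1" and w: "0 < w"
    and y0: "0 < y 0" and y1: "(y 1)\<^sup>2 \<le> (y 0)\<^sup>2 * w" and cut: "0 \<le> y 1 * \<delta>"
  defines "y' \<equiv> (\<lambda>k. \<Sum>i<2. V i k * y i)"
  shows "0 < y' 0" and "(y' 1)\<^sup>2 \<le> (y' 0)\<^sup>2 * (w / 2)"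
proof -
  have r0: "0 < r" unfolding r by (smt (verit) real_sqrt_gt_0_iff zero_le_square)
  have r2: "r\<^sup>2 = 1 + a\<^sup>2" unfolding r by (simp add: power2_eq_square)
  define t where "t = y 1 * \<delta>"
  have y't: "y' 0 = (y 0 + sqrt w / 2 * t) / r"
    by (simp add: y'_def lessThan_Suc numeral_2_eq_2 V0[simplified] a t_def add_divide_distrib)
  have t: "0 \<le> t" "t \<le> sqrt w * y 0"
  proof -
    have "t\<^sup>2 \<le> (sqrt w * y 0)\<^sup>2" using y1 w \<delta> by (simp add: t_def power_mult_distrib mult_ac)
    then show "t \<le> sqrt w * y 0" by (rule power2_le_imp_le) (use w y0 in simp)
  qed (use cut in \<open>simp add: t_def\<close>)
  have p: "y 0 \<le> y 0 + sqrt w / 2 * t" using t w by simp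
  then show y'0: "0 < y' 0" unfolding y't using y0 r0 by (intro divide_pos_pos) linarith+
  \<comment> \<open>A rotation preserves length, so \<open>y' 1\<close> is controlled through
    \<open>y' 0\<close>, and the arbitrary second column of \<open>V\<close> drops out.\<close>
  have "(y' 0)\<^sup>2 + (y' 1)\<^sup>2 = (y 0)\<^sup>2 + (y 1)\<^sup>2"
    using orthonormal_family_inner[OF V, of y y]
    by (simp add: y'_def lessThan_Suc numeral_2_eq_2 power2_eq_square)
  moreover have "(y 1)\<^sup>2 = t\<^sup>2" using \<delta> by (simp add: t_def power_mult_distrib)
  ultimately have "(y' 1)\<^sup>2 = (y 0)\<^sup>2 + t\<^sup>2 - (y' 0)\<^sup>2" by linarith
  then have "r\<^sup>2 * (y' 1)\<^sup>2 = r\<^sup>2 * ((y 0)\<^sup>2 + t\<^sup>2) - (r * y' 0)\<^sup>2"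
    by (simp only: power_mult_distrib right_diff_distrib)
  also have "r * y' 0 = y 0 + sqrt w / 2 * t" using r0 y't by simp
  also have "r\<^sup>2 * ((y 0)\<^sup>2 + t\<^sup>2) - (y 0 + sqrt w / 2 * t)\<^sup>2 = (t - sqrt w / 2 * y 0)\<^sup>2"
  proof -
    have "r\<^sup>2 = 1 + (sqrt w / 2)\<^sup>2"
      unfolding r2 a using \<delta> by (simp add: power_mult_distrib power_divide)
    then show ?thesis by (simp add: power2_eq_square algebra_simps)
  qed
  also have "\<dots> \<le> (sqrt w / 2 * y 0)\<^sup>2"
  proof -
    have "\<bar>t - sqrt w / 2 * y 0\<bar> \<le> sqrt w / 2 * y 0"
      using t unfolding abs_le_iff by simp
    then show ?thesis by (metis abs_ge_zero power2_abs power_mono)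
  qed
  \<comment> \<open>The square is \<open>w / 4 * (y 0)\<^sup>2\<close>; the algorithm's choice
    \<open>w / 2\<close> is not tight.\<close>
  also have "\<dots> \<le> w / 2 * (y 0)\<^sup>2" using w by (simp add: power_mult_distrib power_divide)
  also have "\<dots> \<le> w / 2 * (r * y' 0)\<^sup>2"
    using y't p y0 r0 w by (intro mult_left_mono power_mono) auto
  also have "\<dots> = r\<^sup>2 * ((y' 0)\<^sup>2 * (w / 2))" by (simp add: power_mult_distrib)
  finally show "(y' 1)\<^sup>2 \<le> (y' 0)\<^sup>2 * (w / 2)"
    by (rule mult_left_le_imp_le) (use r0 in simp)
qed

text \<open>The product of the \<open>w i\<close> is at least the \<open>m\<close>-th power of the
  floor and at most the initial volume times the decay of \<open>k\<close> updates; taking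
  logarithms bounds \<open>k\<close>. The summand \<open>D\<close> stands for the total cost of the
  periods without update.\<close>

lemma cone_update_count:
  fixes w :: "nat \<Rightarrow> real"
  assumes m: "1 \<le> m" and D: "D = real (Suc m)" and T: "0 < T" and x: "T * \<tau> > D" and \<tau>: "0 < \<tau>"
    and w: "\<And>i. i < m \<Longrightarrow> (D / T)\<^sup>2 / (60 * D) \<le> w i"
    and vol: "(\<Prod>i<m. w i) \<le> (\<tau>\<^sup>2) ^ m * exp (- real k / D)"
  shows "D + real k \<le> 10 * D\<^sup>2 * ln (T * \<tau>)"
proof -
  define \<omega> where "\<omega> = (D / T)\<^sup>2 / (60 * D)"
  have D2: "2 \<le> D" using m D by simp
  have \<omega>0: "0 < \<omega>" unfolding \<omega>_def using D2 T by simp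
  have "\<omega> ^ m \<le> (\<Prod>i<m. w i)"
    using prod_mono[of "{..<m}" "\<lambda>_. \<omega>" w] w \<omega>0 by (simp add: \<omega>_def)
  also note vol
  finally have "ln (\<omega> ^ m) \<le> ln ((\<tau>\<^sup>2) ^ m * exp (- real k / D))"
    using \<omega>0 by (intro ln_mono) auto
  then have "m * ln \<omega> \<le> m * ln (\<tau>\<^sup>2) - real k / D"
    using \<tau> \<omega>0 by (simp add: ln_mult ln_realpow)
  then have "real k \<le> D * (m * (ln (\<tau>\<^sup>2) - ln \<omega>))"
    using D2 by (simp add: field_simps)
  also have "ln (\<tau>\<^sup>2) - ln \<omega> = ln (60 * (T * \<tau>)\<^sup>2 / D)"
  proof -
    have "\<tau>\<^sup>2 / \<omega> = 60 * (T * \<tau>)\<^sup>2 / D"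
      unfolding \<omega>_def using D2 T by (simp add: divide_simps power2_eq_square)
    moreover have "ln (\<tau>\<^sup>2 / \<omega>) = ln (\<tau>\<^sup>2) - ln \<omega>" using \<tau> \<omega>0 by (simp add: ln_div)
    ultimately show ?thesis by simp
  qed
  also have "D * (m * ln (60 * (T * \<tau>)\<^sup>2 / D)) \<le> D * (D * (8 * ln (T * \<tau>)))"
  proof -
    have x2: "2 < T * \<tau>" using x D2 by linarith
    have "60 * (T * \<tau>)\<^sup>2 / D \<le> 60 * (T * \<tau>)\<^sup>2"
      using divide_left_mono[of 1 D "60 * (T * \<tau>)\<^sup>2"] D2 by simp
    \<comment> \<open>\<open>60 <= 2 ^ 6\<close> and \<open>T * \<tau> > 2\<close>, so the constant
      60 is paid for by a power of \<open>T * \<tau>\<close>; this is where the factor 8 comes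
      from.\<close>
    also have "\<dots> \<le> (T * \<tau>) ^ 6 * (T * \<tau>)\<^sup>2"
      using power_mono[of 2 "T * \<tau>" 6] x2 by (intro mult_mono) auto
    also have "\<dots> = (T * \<tau>) ^ 8" by (simp add: power_add[symmetric])
    finally have "ln (60 * (T * \<tau>)\<^sup>2 / D) \<le> ln ((T * \<tau>) ^ 8)"
      using D2 T \<tau> by (intro ln_mono divide_pos_pos mult_pos_pos zero_less_power) auto
    also have "\<dots> = 8 * ln (T * \<tau>)" using x2 by (subst ln_realpow) auto
    finally have "ln (60 * (T * \<tau>)\<^sup>2 / D) \<le> 8 * ln (T * \<tau>)" .
    then have "m * ln (60 * (T * \<tau>)\<^sup>2 / D) \<le> m * (8 * ln (T * \<tau>))" by (intro mult_left_mono) auto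
    also have "\<dots> \<le> D * (8 * ln (T * \<tau>))" using D x2 by (intro mult_right_mono) auto
    finally show ?thesis using D2 by (intro mult_left_mono) auto
  qed
  finally have k: "real k \<le> 8 * D\<^sup>2 * ln (T * \<tau>)" by (simp add: power2_eq_square mult_ac)
  \<comment> \<open>Hence \<open>D\<close> is at most
    \<open>2 * D\<^sup>2 * ln (T * \<tau>)\<close>, and 8 + 2 makes the final constant 10.\<close>
  have "1 / 2 \<le> ln (2 :: real)"
    using ln_ge_iff[of 2 "1 / 2"] exp_le exp_half_le2 by simp
  also have "\<dots> \<le> ln (T * \<tau>)" using x D2 by simp
  finally have "D * D * 1 \<le> D * D * (2 * ln (T * \<tau>))" by (intro mult_left_mono) auto
  moreover have "D \<le> D * D" using D2 by simp
  ultimately show ?thesis using k by (simp add: power2_eq_square algebra_simps)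
qed

section \<open>Programs and their running time\<close>

lemma in_ops_iff [simp]: "(y, t) \<in> ops k x \<longleftrightarrow> y = x \<and> t = k"
  by (auto simp: ops_def any_of_def)

lemma in_any_of_iff [simp]: "(y, t) \<in> any_of k A \<longleftrightarrow> y \<in> A \<and> t = k"
  by (auto simp: any_of_def)

lemma in_bind_any_of_iff [simp]:
  "(y, t) \<in> bind_program (any_of k A) g \<longleftrightarrow> (\<exists>x\<in>A. \<exists>j. (y, j) \<in> g x \<and> t = k + j)"
  by (auto simp: bind_program_def any_of_def)

lemma in_bind_ops_iff [simp]:
  "(y, t) \<in> bind_program (ops k x) g \<longleftrightarrow> (\<exists>j. (y, j) \<in> g x \<and> t = k + j)"
  by (auto simp: ops_def)

lemma in_bind_program_iff:
  "(y, t) \<in> bind_program m g \<longleftrightarrow> (\<exists>x j k. (x, j) \<in> m \<and> (y, k) \<in> g x \<and> t = j + k)"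
  by (auto simp: bind_program_def)

lemma vec_program_ops: "vec_program n (\<lambda>i. ops k (h i)) = ops (n * k) (vec n h)"
proof -
  have "(v, t) \<in> vec_program n (\<lambda>i. ops k (h i)) \<longleftrightarrow> (v, t) \<in> ops (n * k) (vec n h)" for v t
  proof
    assume "(v, t) \<in> vec_program n (\<lambda>i. ops k (h i))"
    then obtain l where l: "v \<in> carrier_vec n" "t = (\<Sum>i<n. l i)" "\<forall>i<n. v $ i = h i \<and> l i = k"
      unfolding vec_program_def in_ops_iff by blast
    then have "v = vec n h" by (auto intro!: eq_vecI)
    moreover have "t = (\<Sum>i<n. k)" unfolding l(2) using l(3) by (intro sum.cong) auto
    ultimately show "(v, t) \<in> ops (n * k) (vec n h)" by simp
  next
    assume "(v, t) \<in> ops (n * k) (vec n h)"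
    then show "(v, t) \<in> vec_program n (\<lambda>i. ops k (h i))"
      by (auto simp: vec_program_def intro!: exI[of _ "\<lambda>_. k"])
  qed
  then show ?thesis by auto
qed

lemma mat_program_ops:
  "mat_program m n (\<lambda>i j. ops (k i j) (h i j)) = ops (\<Sum>i<m. \<Sum>j<n. k i j) (mat m n (\<lambda>(i, j). h i j))"
proof -
  have "(A, t) \<in> mat_program m n (\<lambda>i j. ops (k i j) (h i j))
    \<longleftrightarrow> (A, t) \<in> ops (\<Sum>i<m. \<Sum>j<n. k i j) (mat m n (\<lambda>(i, j). h i j))" for A t
  proof
    assume "(A, t) \<in> mat_program m n (\<lambda>i j. ops (k i j) (h i j))"
    then obtain l where l: "A \<in> carrier_mat m n" "t = (\<Sum>i<m. \<Sum>j<n. l i j)"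
      "\<forall>i<m. \<forall>j<n. A $$ (i, j) = h i j \<and> l i j = k i j"
      unfolding mat_program_def in_ops_iff by blast
    then have "A = mat m n (\<lambda>(i, j). h i j)" by (auto intro!: eq_matI)
    moreover have "t = (\<Sum>i<m. \<Sum>j<n. k i j)" unfolding l(2) using l(3) by (intro sum.cong) auto
    ultimately show "(A, t) \<in> ops (\<Sum>i<m. \<Sum>j<n. k i j) (mat m n (\<lambda>(i, j). h i j))" by simp
  next
    assume "(A, t) \<in> ops (\<Sum>i<m. \<Sum>j<n. k i j) (mat m n (\<lambda>(i, j). h i j))"
    then show "(A, t) \<in> mat_program m n (\<lambda>i j. ops (k i j) (h i j))"
      by (auto simp: mat_program_def)
  qed
  then show ?thesis by auto
qed

definition orient :: "real mat \<Rightarrow> real mat" where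
  "orient V = mat (dim_row V) (dim_col V)
     (\<lambda>(i, j). if V $$ (0, 0) < 0 \<and> j = 0 then - V $$ (i, j) else V $$ (i, j))"

lemma orient_program_result:
  assumes "(V', t) \<in> orient_program V"
  shows "V' = orient V" "t \<le> 1 + dim_row V * dim_col V"
proof -
  \<comment> \<open>The conditional moves inside \<open>ops\<close>, so that
    \<open>mat_program_ops\<close> applies with an entry-dependent cost.\<close>
  have *: "(if b then ops 1 x else ret y) = ops (if b then 1 else 0) (if b then x else y)"
    for b and x y :: real by simp
  from assms have "V' = orient V" and t: "t = 1 + (\<Sum>i<dim_row V. \<Sum>j<dim_col V. if V $$ (0, 0) < 0 \<and> j = 0 then 1 else 0)"
    unfolding orient_program_def orient_def * mat_program_ops by auto
  then show "V' = orient V" by blast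
  have "(\<Sum>i<dim_row V. \<Sum>j<dim_col V. if V $$ (0, 0) < 0 \<and> j = 0 then 1 else 0)
      \<le> (\<Sum>i<dim_row V. \<Sum>j<dim_col V. 1::nat)"
    by (intro sum_mono) auto
  then show "t \<le> 1 + dim_row V * dim_col V" unfolding t by simp
qed

text \<open>The count 25 is 3 for \<open>a\<close>, 3 for the norm, 2 for the unit vector, 16 for
  the matrix product and 1 for halving \<open>W\<close>.\<close>

lemma cone_update_2_result:
  assumes "(s, t) \<in> cone_update_2 p \<delta> (W, U)" and "U \<in> carrier_mat 2 2"
  defines "a \<equiv> 1 / 2 * sqrt (W $$ (0, 0)) * \<delta> $ 0"
  obtains V where "orthonormal_mat 2 V"
    "col V 0 = vec 2 (\<lambda>i. (if i = 0 then 1 else a) / sqrt (1 + a * a))"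
    "s = (mat 1 1 (\<lambda>_. W $$ (0, 0) / 2), U * V)"
    "t = 25 + poly p 2"
proof -
  have dims: "dim_vec (vec 2 h) = 2" "dim_row U = 2" for h :: "nat \<Rightarrow> real" using assms(2) by auto
  obtain V where V: "orthonormal_mat 2 V"
      "col V 0 = vec 2 (\<lambda>i. (if i = 0 then 1 else a) / sqrt (1 + a * a))"
      "s = (mat 1 1 (\<lambda>_. W $$ (0, 0) / 2), U * V)"
      and t: "t = 3 + (3 + (2 * 1 + (poly p 2 + (2 * (dim_col V * (2 * dim_row V)) + (1 + 0)))))"
    using assms(1)
    unfolding cone_update_2_def prod.case mult_mat_program_eq vec_program_ops completion_program_def
      in_bind_ops_iff in_bind_any_of_iff in_ops_iff Let_def a_def[symmetric] dims
    by blast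
  have "dim_col V = 2" "dim_row V = 2" using V(1) by (auto simp: orthonormal_mat_def)
  then have "t = 25 + poly p 2" using t by simp
  then show ?thesis using that V by blast
qed

text \<open>Only the two spectral decompositions involve a choice; the image under
  \<open>fst\<close> forgets their cost, which is collected in the time bound. The cubic term comes
  from the product with \<open>U\<close>.\<close>

lemma cone_update_ge3_result:
  assumes st: "(s, t) \<in> cone_update_ge3 p d \<delta> (W, U)" and U: "U \<in> carrier_mat d d"
    and W: "W \<in> carrier_mat (d - 1) (d - 1)" and \<delta>: "\<delta> \<in> carrier_vec (d - 1)" and d: "1 \<le> d"
  defines "b \<equiv> vec (d - 1) (\<lambda>i. (W *\<^sub>v \<delta>) $ i / sqrt (\<delta> \<bullet> (W *\<^sub>v \<delta>)))"
  defines "a \<equiv> vec (d - 1) (\<lambda>i. 1 / real d * b $ i)"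
  defines "N \<equiv> mat (d - 1) (d - 1) (\<lambda>(i, j). (real d - 1)\<^sup>2 / ((real d - 1)\<^sup>2 - 1) *
      (W $$ (i, j) - 2 / real d * (b $ i * b $ j)))"
  defines "M \<equiv> four_block_mat (1\<^sub>m 1) (mat_of_rows (d - 1) [a]) (mat_of_cols (d - 1) [a])
      (mat (d - 1) (d - 1) (\<lambda>(i, j). a $ i * a $ j - N $$ (i, j)))"
  obtains V L Q E where "(V, L) \<in> fst ` spectral_program p M" "(Q, E) \<in> fst ` spectral_program p N"
    "s = (mat (d - 1) (d - 1) (\<lambda>(i, j). if i = j then E $$ (d - 2 - i, d - 2 - i) else 0), U * orient V)"
    "t \<le> 30 * d ^ 3 + poly p d + poly p (d - 1)"
proof -
  have dims: "dim_row M = d" "dim_row N = d - 1" using d by (auto simp: M_def N_def)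
  have k: "k = poly p (dim_row A)" if "(y, k) \<in> spectral_program p A" for y k A
    using that by (auto simp: spectral_program_def Let_def)
  have dims': "dim_row W = d - 1" "dim_row U = d" "dim_vec \<delta> = d - 1" using W U \<delta> by auto
  obtain V L Q E k k' j V' where *: "((V, L), k) \<in> spectral_program p M" "((Q, E), k') \<in> spectral_program p N"
    "(V', j) \<in> orient_program V"
    and s: "s = (mat (d - 1) (d - 1) (\<lambda>(i, j). if i = j then E $$ (d - 2 - i, d - 2 - i) else 0), U * V')"
    and t: "t = (d - 1) * (2 * (d - 1)) + (2 * (d - 1) + (1 + ((d - 1) * 1 + ((d - 1) * 2 + (6 +
      ((\<Sum>i<d - 1. \<Sum>j<d - 1. 5) + ((\<Sum>i<d - 1. \<Sum>j<d - 1. 2) +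
      (k + (j + (d * (dim_col V' * (2 * dim_row V')) + (k' + 0)))))))))))"
    using st
    unfolding cone_update_ge3_def prod.case mult_vec_program_eq inner_program_eq mult_mat_program_eq
      vec_program_ops mat_program_ops in_bind_ops_iff Let_def
    unfolding in_bind_program_iff in_bind_ops_iff in_ops_iff split_paired_Ex prod.case dim_mult_mat_vec dims'
      b_def[symmetric] a_def[symmetric] N_def[symmetric] M_def[symmetric]
    by blast
  have V: "dim_row V = d" "dim_col V = d"
    using *(1) dims by (auto simp: spectral_program_def orthonormal_mat_def)
  note V' = orient_program_result[OF *(3)]
  have "t \<le> 30 * d ^ 3 + poly p d + poly p (d - 1)"
  proof -
    have 1: "(d - 1) * (d - 1) \<le> d * d" by (intro mult_mono) auto
    have "d \<le> d * d" "d * d \<le> d * d * d" using d by auto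
    moreover have "t \<le> 9 * (d * d) + 5 * d + 8 + poly p d + d * d + 2 * (d * d * d) + poly p (d - 1)"
    proof -
      have "j \<le> 1 + d * d" using V'(2) V by simp
      moreover have "dim_row V' = d" "dim_col V' = d" using V'(1) V by (auto simp: orient_def)
      moreover have "k = poly p d" "k' = poly p (d - 1)" using k *(1,2) dims by metis+
      ultimately show ?thesis unfolding t using 1 U by simp
    qed
    ultimately show ?thesis using d unfolding power3_eq_cube by linarith
  qed
  then show ?thesis using that[of V L Q E] * s V'(1) by force
qed

lemma ec_period_result:
  assumes st: "((x, s), k) \<in> ec_period p d \<epsilon> X f xs (W, U)" and U: "U \<in> carrier_mat d d"
    and W: "W \<in> carrier_mat (d - 1) (d - 1)" and d: "2 \<le> d"
  defines "g \<equiv> vec d (\<lambda>i. f x $ i - f xs $ i)"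
  defines "\<delta> \<equiv> (if vnorm g = 0 then 0\<^sub>v d else vec d (\<lambda>i. g $ i / vnorm g))"
  defines "v \<equiv> vec_last (transpose_mat U *\<^sub>v \<delta>) (d - 1)"
  defines "\<delta>' \<equiv> vec (d - 1) (\<lambda>i. v $ i / vnorm v)"
  shows "x \<in> optimal_actions (U *\<^sub>v unit_vec d 0) X f" (is ?thesis1)
    and "v \<bullet> (W *\<^sub>v v) \<le> \<epsilon>\<^sup>2 \<and> s = (W, U) \<or>
      \<not> v \<bullet> (W *\<^sub>v v) \<le> \<epsilon>\<^sup>2 \<and> d = 2 \<and> (\<exists>t. (s, t) \<in> cone_update_2 p \<delta>' (W, U)) \<or>
      \<not> v \<bullet> (W *\<^sub>v v) \<le> \<epsilon>\<^sup>2 \<and> 3 \<le> d \<and> (\<exists>t. (s, t) \<in> cone_update_ge3 p d \<delta>' (W, U))" (is ?thesis2)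
    and "k \<le> 60 * d ^ 3 + poly p d + poly p (d - 1)" (is ?thesis3)
proof -
  \<comment> \<open>The difference vector, its direction and its tail are taken as functions of the
    action \<open>y\<close>, which is bound inside the program; only afterwards is \<open>y\<close>
    identified with the returned action \<open>x\<close>.\<close>
  define G where "G y = vec d (\<lambda>i. f y $ i - f xs $ i)" for y
  define \<Delta> where "\<Delta> y = (if vnorm (G y) = 0 then 0\<^sub>v d else vec d (\<lambda>i. G y $ i / vnorm (G y)))" for y
  define F where "F y = vec_last (transpose_mat U *\<^sub>v \<Delta> y) (d - 1)" for y
  have dims: "dim_row W = d - 1" "dim_row U = d" "dim_row (transpose_mat U) = d"
    "dim_vec (unit_vec d 0 :: real vec) = d" "dim_vec (G y) = d" "dim_vec (\<Delta> y) = d"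
    "dim_vec (F y) = d - 1" for y
    using W U by (auto simp: \<Delta>_def G_def F_def)
  have \<Delta>_prog: "(if b then ret (0\<^sub>v d) else ops (d * 1) y) =
      ops (if b then 0 else d) (if b then 0\<^sub>v d else y)" for b and y :: "real vec"
    by simp
  let ?rest = "\<lambda>y. if F y \<bullet> (W *\<^sub>v F y) \<le> \<epsilon>\<^sup>2 then ret (y, W, U)
     else bind_program (ops (2 * (d - 1) + 1) (vnorm (F y))) (\<lambda>r.
       bind_program (ops ((d - 1) * 1) (vec (d - 1) (\<lambda>i. F y $ i / r))) (\<lambda>\<delta>'.
       bind_program (if d = 2 then cone_update_2 p \<delta>' (W, U) else cone_update_ge3 p d \<delta>' (W, U)) (\<lambda>s.
       ret (y, s))))"
  obtain y k' where y: "y \<in> optimal_actions (U *\<^sub>v unit_vec d 0) X f"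
    and k: "k = d * (2 * d) + (1 + (1 + (1 + (d * 1 + (2 * d + 1 + (1 + ((if vnorm (G y) = 0 then 0 else d)
      + (d * (2 * d) + ((d - 1) * (2 * (d - 1)) + (2 * (d - 1) + (2 + k')))))))))))"
    and k': "((x, s), k') \<in> ?rest y"
    using st
    unfolding ec_period_def prod.case mult_vec_program_eq norm_program_eq inner_program_eq
      vec_program_ops Let_def ops_def[symmetric] \<Delta>_prog in_bind_any_of_iff
    unfolding in_bind_ops_iff in_bind_any_of_iff dim_mult_mat_vec G_def[symmetric] \<Delta>_def[symmetric] F_def[symmetric] dims
    by blast
  have xy: "y = x"
    using k' by (cases "F y \<bullet> (W *\<^sub>v F y) \<le> \<epsilon>\<^sup>2") (auto simp: in_bind_program_iff[of _ _ "if _ then _ else _"])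
  have Fx: "F x = v" by (simp add: F_def \<Delta>_def G_def v_def \<delta>_def g_def)
  show ?thesis1 using y xy by simp
  note k' = k'[unfolded xy Fx]
  have k'_cases: "(v \<bullet> (W *\<^sub>v v) \<le> \<epsilon>\<^sup>2 \<and> s = (W, U) \<and> k' = 0) \<or> \<not> v \<bullet> (W *\<^sub>v v) \<le> \<epsilon>\<^sup>2 \<and> 
      (\<exists>t. (s, t) \<in> (if d = 2 then cone_update_2 p \<delta>' (W, U) else cone_update_ge3 p d \<delta>' (W, U)) \<and>
        k' = (2 * (d - 1) + 1) + ((d - 1) * 1 + t))"
  proof (cases "v \<bullet> (W *\<^sub>v v) \<le> \<epsilon>\<^sup>2")
    case True
    then show ?thesis using k' by auto
  next
    case False
    then show ?thesis
      using k' unfolding if_not_P[OF False] in_bind_ops_iff in_bind_program_iff[of _ _ "if _ then _ else _"]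
        \<delta>'_def[symmetric] by auto
  qed
  show ?thesis2 using k'_cases d by (auto split: if_splits)
  have t: "t \<le> 30 * d ^ 3 + poly p d + poly p (d - 1)"
    if "(s, t) \<in> (if d = 2 then cone_update_2 p \<delta>' (W, U) else cone_update_ge3 p d \<delta>' (W, U))" for t
  proof (cases "d = 2")
    case True
    obtain s1 s2 where s: "s = (s1, s2)" by fastforce
    have "t = 25 + poly p 2"
      by (rule cone_update_2_result[of s t p \<delta>' W U]) (use that True U in auto)
    then show ?thesis using True by simp
  next
    case False
    have "\<delta>' \<in> carrier_vec (d - 1)" by (simp add: \<delta>'_def)
    then show ?thesis
      using that False d U W by (auto elim!: cone_update_ge3_result[of s t p d \<delta>' W U])
  qed
  have "k' \<le> 3 * d + (30 * d ^ 3 + poly p d + poly p (d - 1))"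
    using k'_cases d by (auto dest!: t)
  moreover have "(d - 1) * (2 * (d - 1)) \<le> d * (2 * d)" by (intro mult_mono) auto
  moreover have "d * (2 * d) = 2 * (d * d)" by simp
  moreover have "2 * (d - 1) \<le> 2 * d" by simp
  moreover have "d \<le> d * d" "d * d \<le> d * d * d" using d by auto
  moreover have "(if vnorm (G y) = 0 then 0 else d) \<le> d" by simp
  ultimately show ?thesis3 unfolding k power3_eq_cube using d by linarith
qed

section \<open>The cone invariant\<close>

lemma scalar_prod_lessThan: "v \<in> carrier_vec m \<Longrightarrow> u \<bullet> v = (\<Sum>i<m. u $ i * v $ i)"
  by (auto simp: scalar_prod_def lessThan_atLeast0)

lemma orthonormal_mat_imp_family:
  assumes "orthonormal_mat d V"
  shows "orthonormal_family d (\<lambda>i j. V $$ (i, j))"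
proof -
  have V: "V \<in> carrier_mat d d" and 1: "transpose_mat V * V = 1\<^sub>m d"
    using assms by (auto simp: orthonormal_mat_def)
  have 2: "V * transpose_mat V = 1\<^sub>m d"
    by (rule mat_mult_left_right_inverse[OF _ V 1]) (use V in simp)
  have "(\<Sum>i<d. V $$ (i, k) * V $$ (i, l)) = (if k = l then 1 else 0)" if "k < d" "l < d" for k l
  proof -
    have "(transpose_mat V * V) $$ (k, l) = (\<Sum>i<d. V $$ (i, k) * V $$ (i, l))"
      using V that by (simp add: scalar_prod_def lessThan_atLeast0)
    then show ?thesis using 1 that by simp
  qed
  moreover have "(\<Sum>k<d. V $$ (i, k) * V $$ (j, k)) = (if i = j then 1 else 0)" if "i < d" "j < d" for i j
  proof -
    have "(V * transpose_mat V) $$ (i, j) = (\<Sum>k<d. V $$ (i, k) * V $$ (j, k))"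
      using V that by (simp add: scalar_prod_def lessThan_atLeast0)
    then show ?thesis using 2 that by simp
  qed
  ultimately show ?thesis by (simp add: orthonormal_family_def)
qed

lemma orthonormal_mat_of_family:
  assumes "V \<in> carrier_mat d d" "orthonormal_family d (\<lambda>i j. V $$ (i, j))"
  shows "orthonormal_mat d V"
  unfolding orthonormal_mat_def using assms
  by (auto simp: scalar_prod_def lessThan_atLeast0[symmetric] orthonormal_family_def intro!: eq_matI)

lemma orthonormal_mat_mult:
  assumes "orthonormal_mat d U" "orthonormal_mat d V"
  shows "orthonormal_mat d (U * V)"
proof -
  have c: "U \<in> carrier_mat d d" "V \<in> carrier_mat d d"
    and 1: "transpose_mat U * U = 1\<^sub>m d" "transpose_mat V * V = 1\<^sub>m d"
    using assms by (auto simp: orthonormal_mat_def)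
  have "transpose_mat (U * V) * (U * V) = (transpose_mat V * transpose_mat U) * (U * V)"
    using transpose_mult[OF c] by simp
  also have "\<dots> = transpose_mat V * (transpose_mat U * (U * V))"
    by (rule assoc_mult_mat[of _ d d _ d _ d]) (use c in auto)
  also have "transpose_mat U * (U * V) = (transpose_mat U * U) * V"
    by (rule assoc_mult_mat[of _ d d _ d _ d, symmetric]) (use c in auto)
  finally show ?thesis using c 1 by (simp add: orthonormal_mat_def)
qed

lemma spectral_program_spectral:
  assumes "(V, L) \<in> fst ` spectral_program p A" and A: "A \<in> carrier_mat m m"
  shows "V \<in> carrier_mat m m"
    and "spectral m (\<lambda>i j. A $$ (i, j)) (\<lambda>i j. V $$ (i, j)) (\<lambda>i. L $$ (i, i))"
proof -
  have V: "orthonormal_mat m V" "L \<in> carrier_mat m m" "diagonal_mat L"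
    "\<And>i j. i \<le> j \<Longrightarrow> j < m \<Longrightarrow> L $$ (j, j) \<le> L $$ (i, i)"
    and eq: "A = V * L * transpose_mat V"
    using assms by (auto simp: spectral_program_def Let_def any_of_def)
  show c: "V \<in> carrier_mat m m" using V by (simp add: orthonormal_mat_def)
  have VL: "(V * L) $$ (i, k) = L $$ (k, k) * V $$ (i, k)" if "i < m" "k < m" for i k
  proof -
    have "(V * L) $$ (i, k) = (\<Sum>j<m. V $$ (i, j) * L $$ (j, k))"
      using that c V(2) by (simp add: scalar_prod_def lessThan_atLeast0)
    also have "\<dots> = (\<Sum>j<m. if j = k then L $$ (k, k) * V $$ (i, k) else 0)"
      using that V(2,3) by (intro sum.cong) (auto simp: diagonal_mat_def)
    finally show ?thesis using that by simp
  qed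
  have "A $$ (i, j) = (\<Sum>k<m. L $$ (k, k) * V $$ (i, k) * V $$ (j, k))" if "i < m" "j < m" for i j
  proof -
    have "A $$ (i, j) = (\<Sum>k<m. (V * L) $$ (i, k) * V $$ (j, k))"
      unfolding eq using that c V(2) 
      by (simp add: scalar_prod_def lessThan_atLeast0 del: assoc_mult_mat)
    also have "\<dots> = (\<Sum>k<m. L $$ (k, k) * V $$ (i, k) * V $$ (j, k))"
      using that by (intro sum.cong refl) (simp only: VL lessThan_iff)
    finally show ?thesis .
  qed
  then show "spectral m (\<lambda>i j. A $$ (i, j)) (\<lambda>i j. V $$ (i, j)) (\<lambda>i. L $$ (i, i))"
    using V orthonormal_mat_imp_family[OF V(1)] by (simp add: spectral_def)
qed

text \<open>Eigenvectors matter only up to sign, which justifies orienting the first column. The two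
  matrices need agree only on the index range, so that \<open>cone_matrix\<close> can replace the
  block matrix \<open>M\<close>.\<close>

lemma spectral_sign_change:
  assumes "spectral m A V l" and A: "\<And>i j. i < m \<Longrightarrow> j < m \<Longrightarrow> A' i j = A i j"
    and V: "\<And>i k. i < m \<Longrightarrow> k < m \<Longrightarrow> V' i k = \<sigma> k * V i k" and \<sigma>: "\<And>k. \<sigma> k * \<sigma> k = (1 :: real)"
  shows "spectral m A' V' l"
proof -
  have "(\<Sum>i<m. V' i k * V' i j) = (if k = j then 1 else 0)" if "k < m" "j < m" for k j
  proof -
    have "(\<Sum>i<m. V' i k * V' i j) = \<sigma> k * \<sigma> j * (\<Sum>i<m. V i k * V i j)"
      unfolding sum_distrib_left by (intro sum.cong refl) (use V that in simp)
    then show ?thesis using assms(1) that \<sigma> by (auto simp: spectral_def orthonormal_family_def)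
  qed
  moreover have VV: "V' i k * V' j k = V i k * V j k" if "i < m" "j < m" "k < m" for i j k
  proof -
    have "V' i k * V' j k = (\<sigma> k * \<sigma> k) * (V i k * V j k)" using V that by simp
    then show ?thesis using \<sigma> by simp
  qed
  moreover from VV have "(\<Sum>k<m. l k * V' i k * V' j k) = (\<Sum>k<m. l k * V i k * V j k)"
    if "i < m" "j < m" for i j
    using that by (intro sum.cong refl) (simp add: mult.assoc)
  ultimately show ?thesis using assms(1) A
    by (auto simp: spectral_def orthonormal_family_def)
qed

definition coords :: "real mat \<Rightarrow> real vec \<Rightarrow> nat \<Rightarrow> real" where
  "coords U c k = (\<Sum>i<dim_row U. U $$ (i, k) * c $ i)"

lemma coords_mult:
  assumes "U \<in> carrier_mat d d" "V \<in> carrier_mat d d" "k < d"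
  shows "coords (U * V) c k = (\<Sum>i<d. V $$ (i, k) * coords U c i)"
proof -
  have "coords (U * V) c k = (\<Sum>r<d. \<Sum>i<d. V $$ (i, k) * (U $$ (r, i) * c $ r))"
    using assms unfolding coords_def
    by (auto simp: scalar_prod_def lessThan_atLeast0[symmetric] sum_distrib_left mult_ac intro!: sum.cong)
  also have "\<dots> = (\<Sum>i<d. V $$ (i, k) * coords U c i)"
    using assms unfolding coords_def by (subst sum.swap) (simp add: sum_distrib_left)
  finally show ?thesis .
qed

lemma coords_inner:
  assumes "orthonormal_mat d U" "c \<in> carrier_vec d"
  shows "(\<Sum>k<d. coords U u k * coords U c k) = u \<bullet> c"
  using orthonormal_family_inner[OF orthonormal_mat_imp_family[OF assms(1)], of "\<lambda>i. u $ i" "\<lambda>i. c $ i"]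
    assms by (auto simp: coords_def orthonormal_mat_def scalar_prod_lessThan)

text \<open>The quantified inequality is the support form of membership in the ellipsoid, multiplied
  by the square of the leading coordinate. No positivity of \<open>W\<close> is demanded, so the
  degenerate start \<open>W = 0\<close> is included.\<close>

definition cone_state :: "nat \<Rightarrow> real vec \<Rightarrow> ec_state \<Rightarrow> bool" where
  "cone_state m c s \<longleftrightarrow> (case s of (W, U) \<Rightarrow>
     W \<in> carrier_mat m m \<and> (\<forall>i<m. \<forall>j<m. i \<noteq> j \<longrightarrow> W $$ (i, j) = 0) \<and>
     orthonormal_mat (Suc m) U \<and> 0 < coords U c 0 \<and>
     (\<forall>q. (\<Sum>i<m. coords U c (Suc i) * q i)\<^sup>2 \<le> (coords U c 0)\<^sup>2 * (\<Sum>i<m. W $$ (i, i) * (q i)\<^sup>2)))"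

lemma diag_mult_vec:
  assumes "cone_state m c (W, U)" "v \<in> carrier_vec m" "i < m"
  shows "(W *\<^sub>v v) $ i = W $$ (i, i) * v $ i"
proof -
  have "(W *\<^sub>v v) $ i = (\<Sum>j<m. W $$ (i, j) * v $ j)"
    using assms by (auto simp: cone_state_def scalar_prod_def lessThan_atLeast0)
  also have "\<dots> = (\<Sum>j<m. if j = i then W $$ (i, i) * v $ i else 0)"
    using assms by (intro sum.cong) (auto simp: cone_state_def)
  finally show ?thesis using assms by simp
qed

lemma diag_quadratic:
  assumes "cone_state m c (W, U)" "v \<in> carrier_vec m"
  shows "v \<bullet> (W *\<^sub>v v) = (\<Sum>i<m. (v $ i)\<^sup>2 * W $$ (i, i))"
proof -
  have "W *\<^sub>v v \<in> carrier_vec m" using assms by (auto simp: cone_state_def)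
  then have "v \<bullet> (W *\<^sub>v v) = (\<Sum>i<m. v $ i * (W *\<^sub>v v) $ i)" by (rule scalar_prod_lessThan)
  also have "\<dots> = (\<Sum>i<m. (v $ i)\<^sup>2 * W $$ (i, i))"
    by (intro sum.cong refl)
      (simp add: diag_mult_vec[OF assms] power2_eq_square del: index_mult_mat_vec)
  finally show ?thesis .
qed

lemma cone_update_ge3_step:
  assumes cs: "cone_state m c (W, U)" and m: "2 \<le> m"
    and st: "(s, t) \<in> cone_update_ge3 p (Suc m) \<delta> (W, U)"
    and \<delta>: "\<delta> \<in> carrier_vec m" "(\<Sum>i<m. (\<delta> $ i)\<^sup>2) = 1"
    and cut: "0 \<le> (\<Sum>i<m. coords U c (Suc i) * \<delta> $ i)"
    and w: "\<And>i. i < m \<Longrightarrow> \<omega> \<le> W $$ (i, i)"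
    and \<omega>: "0 < \<omega>" "60 * real (Suc m) * \<omega> \<le> (\<Sum>i<m. (\<delta> $ i)\<^sup>2 * W $$ (i, i))"
  shows "cone_state m c s" and "\<And>i. i < m \<Longrightarrow> \<omega> \<le> fst s $$ (i, i)"
    and "(\<Prod>i<m. fst s $$ (i, i)) \<le> exp (- 1 / real (Suc m)) * (\<Prod>i<m. W $$ (i, i))"
proof -
  have W: "W \<in> carrier_mat m m" and off: "\<And>i j. i < m \<Longrightarrow> j < m \<Longrightarrow> i \<noteq> j \<Longrightarrow> W $$ (i, j) = 0"
    and U: "orthonormal_mat (Suc m) U" and y0: "0 < coords U c 0"
    and y: "\<And>q. (\<Sum>i<m. coords U c (Suc i) * q i)\<^sup>2 \<le> (coords U c 0)\<^sup>2 * (\<Sum>i<m. W $$ (i, i) * (q i)\<^sup>2)"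
    using cs by (auto simp: cone_state_def)
  have Uc: "U \<in> carrier_mat (Suc m) (Suc m)" using U by (simp add: orthonormal_mat_def)
  define b where "b = vec m (\<lambda>i. (W *\<^sub>v \<delta>) $ i / sqrt (\<delta> \<bullet> (W *\<^sub>v \<delta>)))"
  define a where "a = vec m (\<lambda>i. 1 / real (Suc m) * b $ i)"
  define N where "N = mat m m (\<lambda>(i, j). (real (Suc m) - 1)\<^sup>2 / ((real (Suc m) - 1)\<^sup>2 - 1) *
      (W $$ (i, j) - 2 / real (Suc m) * (b $ i * b $ j)))"
  define M where "M = four_block_mat (1\<^sub>m 1) (mat_of_rows m [a]) (mat_of_cols m [a])
      (mat m m (\<lambda>(i, j). a $ i * a $ j - N $$ (i, j)))"
  have d1: "1 \<le> Suc m" by simp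
  have idx: "Suc m - 2 - i = m - Suc i" for i by simp
  note result = cone_update_ge3_result[OF st Uc, unfolded diff_Suc_1 idx, OF W \<delta>(1) d1,
      folded b_def, folded a_def, folded N_def, folded M_def]
  have "\<exists>V L P E. (V, L) \<in> fst ` spectral_program p M \<and> (P, E) \<in> fst ` spectral_program p N \<and>
    s = (mat m m (\<lambda>(i, j). if i = j then E $$ (m - Suc i, m - Suc i) else 0), U * orient V)"
    by (rule result) (intro exI conjI)
  then obtain V L P E where VL: "(V, L) \<in> fst ` spectral_program p M"
    and PE: "(P, E) \<in> fst ` spectral_program p N"
    and s: "s = (mat m m (\<lambda>(i, j). if i = j then E $$ (m - Suc i, m - Suc i) else 0), U * orient V)"
    by (elim exE conjE)
  have Nc: "N \<in> carrier_mat m m" and Mc: "M \<in> carrier_mat (Suc m) (Suc m)"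
    by (auto simp: N_def M_def)
  have Vc: "V \<in> carrier_mat (Suc m) (Suc m)" by (rule spectral_program_spectral(1)[OF VL Mc])
  have specN: "spectral m (\<lambda>i j. N $$ (i, j)) (\<lambda>i j. P $$ (i, j)) (\<lambda>i. E $$ (i, i))"
    by (rule spectral_program_spectral(2)[OF PE Nc])
  have specM: "spectral (Suc m) (cone_matrix (\<lambda>i. a $ i) (\<lambda>i j. N $$ (i, j)))
      (\<lambda>i j. orient V $$ (i, j)) (\<lambda>i. L $$ (i, i))"
  proof (rule spectral_sign_change[OF spectral_program_spectral(2)[OF VL Mc],
        where \<sigma> = "\<lambda>k. if V $$ (0, 0) < 0 \<and> k = 0 then - 1 else 1"])
    fix i j assume "i < Suc m" "j < Suc m"
    then show "cone_matrix (\<lambda>i. a $ i) (\<lambda>i j. N $$ (i, j)) i j = M $$ (i, j)"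
      by (cases i; cases j) (auto simp: cone_matrix_def M_def mat_of_rows_def mat_of_cols_def a_def)
    show "orient V $$ (i, j) = (if V $$ (0, 0) < 0 \<and> j = 0 then - 1 else 1) * V $$ (i, j)"
      using Vc \<open>i < Suc m\<close> \<open>j < Suc m\<close> by (simp add: orient_def)
  qed auto
  \<comment> \<open>The orientation step ensures this, so the new first axis points to the side of
    the hidden cost vector.\<close>
  have V00: "0 \<le> orient V $$ (0, 0)" using Vc by (simp add: orient_def)
  have oc: "orient V \<in> carrier_mat (Suc m) (Suc m)" using Vc by (simp add: orient_def)
  have orth: "orthonormal_mat (Suc m) (orient V)"
    using specM by (intro orthonormal_mat_of_family oc) (simp add: spectral_def)
  note Q = diag_quadratic[OF cs \<delta>(1)]
  have b: "b $ i = W $$ (i, i) * \<delta> $ i / sqrt (\<Sum>i<m. (\<delta> $ i)\<^sup>2 * W $$ (i, i))" if "i < m" for i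
    using that diag_mult_vec[OF cs \<delta>(1) that] by (simp add: b_def Q del: index_mult_mat_vec)
  have a: "a $ i = 1 / real (Suc m) * b $ i" if "i < m" for i using that by (simp add: a_def)
  have N: "N $$ (i, j) = (real (Suc m) - 1)\<^sup>2 / ((real (Suc m) - 1)\<^sup>2 - 1) *
      ((if i = j then W $$ (i, i) else 0) - 2 / real (Suc m) * (b $ i * b $ j))" if "i < m" "j < m" for i j
    using that off by (simp add: N_def)
  note facts = m refl w \<omega> \<delta>(2) refl refl b a N specN
  note new = cone_update_correct[OF facts specM V00 y0 y cut]
  show "\<omega> \<le> fst s $$ (i, i)" if "i < m" for i
    using cut_eigenvalue_ge[OF facts, of "m - Suc i"] that by (simp add: s)
  have "(\<Prod>i<m. fst s $$ (i, i)) = (\<Prod>i<m. E $$ (m - Suc i, m - Suc i))" by (simp add: s)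
  \<comment> \<open>The algorithm stores the eigenvalues of \<open>N\<close> in reverse order to
    pair them with the columns of the new frame; the volume does not see the order.\<close>
  also have "\<dots> = (\<Prod>i<m. E $$ (i, i))" by (rule prod.nat_diff_reindex)
  also have "\<dots> \<le> exp (- 1 / real (Suc m)) * (\<Prod>i<m. W $$ (i, i))" by (rule cut_volume[OF facts])
  finally show "(\<Prod>i<m. fst s $$ (i, i)) \<le> exp (- 1 / real (Suc m)) * (\<Prod>i<m. W $$ (i, i))" .
  show "cone_state m c s"
    unfolding cone_state_def s prod.case
  proof (intro conjI allI)
    show "orthonormal_mat (Suc m) (U * orient V)" by (rule orthonormal_mat_mult[OF U orth])
    show "0 < coords (U * orient V) c 0"
      using new(1) by (simp only: coords_mult[OF Uc oc])
    fix q
    show "(\<Sum>i<m. coords (U * orient V) c (Suc i) * q i)\<^sup>2 \<le> (coords (U * orient V) c 0)\<^sup>2 *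
      (\<Sum>i<m. mat m m (\<lambda>(i, j). if i = j then E $$ (m - Suc i, m - Suc i) else 0) $$ (i, i) * (q i)\<^sup>2)"
      using new(2)[of q] by (simp add: coords_mult[OF Uc oc] del: sum.lessThan_Suc)
  qed auto
qed

lemma cone_update_2_step:
  assumes cs: "cone_state 1 c (W, U)" and st: "(s, t) \<in> cone_update_2 p \<delta> (W, U)"
    and \<delta>: "(\<delta> $ 0)\<^sup>2 = 1" and cut: "0 \<le> coords U c 1 * \<delta> $ 0" and w: "0 < W $$ (0, 0)"
  shows "cone_state 1 c s" and "fst s $$ (0, 0) = W $$ (0, 0) / 2"
proof -
  define a where "a = 1 / 2 * sqrt (W $$ (0, 0)) * \<delta> $ 0"
  have W: "W \<in> carrier_mat 1 1" and U: "orthonormal_mat 2 U" and y0: "0 < coords U c 0"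
    and y: "\<And>q. (coords U c 1 * q)\<^sup>2 \<le> (coords U c 0)\<^sup>2 * (W $$ (0, 0) * q\<^sup>2)"
    using cs by (auto simp: cone_state_def numeral_2_eq_2)
  have Uc: "U \<in> carrier_mat 2 2" using U by (simp add: orthonormal_mat_def)
  obtain V where V: "orthonormal_mat 2 V"
    and col: "col V 0 = vec 2 (\<lambda>i. (if i = 0 then 1 else a) / sqrt (1 + a * a))"
    and s: "s = (mat 1 1 (\<lambda>_. W $$ (0, 0) / 2), U * V)"
    using cone_update_2_result[OF st Uc, folded a_def] by blast
  have Vc: "V \<in> carrier_mat 2 2" using V by (simp add: orthonormal_mat_def)
  have V0: "V $$ (0, 0) = 1 / sqrt (1 + a * a)" "V $$ (1, 0) = a / sqrt (1 + a * a)"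
    using arg_cong[OF col, of "\<lambda>v. v $ 0"] arg_cong[OF col, of "\<lambda>v. v $ 1"] Vc by auto
  have "(coords U c 1)\<^sup>2 \<le> (coords U c 0)\<^sup>2 * W $$ (0, 0)" using y[of 1] by simp
  note new = planar_cone_update_correct[OF orthonormal_mat_imp_family[OF V] V0 refl a_def \<delta> w y0 this cut]
  show "fst s $$ (0, 0) = W $$ (0, 0) / 2" by (simp add: s)
  show "cone_state 1 c s"
    unfolding cone_state_def s prod.case
  proof (intro conjI allI)
    show "orthonormal_mat (Suc 1) (U * V)" using orthonormal_mat_mult[OF U V] by (simp add: numeral_2_eq_2)
    show "0 < coords (U * V) c 0"
      using new(1) by (simp only: coords_mult[OF Uc Vc])
    fix q :: "nat \<Rightarrow> real"
    have "(coords (U * V) c 1)\<^sup>2 \<le> (coords (U * V) c 0)\<^sup>2 * (W $$ (0, 0) / 2)"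
      using new(2) coords_mult[OF Uc Vc, of 0 c] coords_mult[OF Uc Vc, of 1 c] by simp
    then have "(coords (U * V) c 1)\<^sup>2 * (q 0)\<^sup>2 \<le> (coords (U * V) c 0)\<^sup>2 * (W $$ (0, 0) / 2) * (q 0)\<^sup>2"
      by (intro mult_right_mono) auto
    then show "(\<Sum>i<1. coords (U * V) c (Suc i) * q i)\<^sup>2 \<le> (coords (U * V) c 0)\<^sup>2 *
      (\<Sum>i<1. mat 1 1 (\<lambda>_. W $$ (0, 0) / 2) $$ (i, i) * (q i)\<^sup>2)"
      by (simp add: power_mult_distrib mult_ac)
  qed auto
qed

section \<open>One period\<close>

lemma vnorm_power2: "v \<in> carrier_vec m \<Longrightarrow> (vnorm v)\<^sup>2 = (\<Sum>i<m. (v $ i)\<^sup>2)"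
  by (simp add: vnorm_def scalar_prod_lessThan sum_nonneg power2_eq_square)

lemma vnorm_nonneg: "0 \<le> vnorm v"
  by (simp add: vnorm_def scalar_prod_def sum_nonneg)

lemma scalar_prod_le_one:
  fixes u v :: "real vec"
  assumes "u \<in> carrier_vec d" "v \<in> carrier_vec d"
    "(\<Sum>i<d. (u $ i)\<^sup>2) \<le> 1" "(\<Sum>i<d. (v $ i)\<^sup>2) \<le> 1"
  shows "\<bar>u \<bullet> v\<bar> \<le> 1"
proof -
  have "(u \<bullet> v)\<^sup>2 \<le> (\<Sum>i<d. (u $ i)\<^sup>2) * (\<Sum>i<d. (v $ i)\<^sup>2)"
    unfolding scalar_prod_lessThan[OF assms(2)] by (rule Cauchy_Schwarz_ineq_sum)
  also have "\<dots> \<le> 1 * 1" using assms by (intro mult_mono sum_nonneg) auto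
  finally show ?thesis by (simp add: abs_square_le_1)
qed

lemma unit_sphere_sum: "c \<in> unit_sphere d \<Longrightarrow> (\<Sum>i<d. (c $ i)\<^sup>2) = 1"
  using vnorm_power2[of c d] by (simp add: unit_sphere_def)

lemma decision_sets_carrier:
  assumes "X \<in> decision_sets n" "x \<in> X"
  shows "x \<in> carrier_vec n"
proof -
  interpret Metric_space "carrier_vec n" "vdist n" by (rule Metric_space_vec)
  show ?thesis using assms compactin_subset_topspace[of mtopology X]
    by (auto simp: decision_sets_def vec_topology_def)
qed

lemma optimal_actions_le:
  assumes "x \<in> optimal_actions c X f" "y \<in> X"
  shows "x \<in> X" "f x \<bullet> c \<le> f y \<bullet> c"
  using assms by (auto simp: optimal_actions_def is_arg_min_def not_less)

section \<open>What the two optimal actions of one period reveal\<close>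

context
  fixes m d n :: nat and c x xs :: "real vec" and W U :: "real mat" and X :: "real vec set"
    and f :: "real vec \<Rightarrow> real vec" and g \<delta> v :: "real vec"
  assumes d: "d = Suc m" and cs: "cone_state m c (W, U)" and c: "c \<in> unit_sphere d"
    and X: "X \<in> decision_sets n" and f: "f \<in> context_maps n d"
    and xs: "xs \<in> optimal_actions c X f" and x: "x \<in> optimal_actions (U *\<^sub>v unit_vec d 0) X f"
    and g: "g = vec d (\<lambda>i. f x $ i - f xs $ i)"
    and \<delta>: "\<delta> = (if vnorm g = 0 then 0\<^sub>v d else vec d (\<lambda>i. g $ i / vnorm g))"
    and v: "v = vec_last (transpose_mat U *\<^sub>v \<delta>) (d - 1)"
begin

lemma period_carriers:
  "g \<in> carrier_vec d" "\<delta> \<in> carrier_vec d" "v \<in> carrier_vec m" "c \<in> carrier_vec d"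
  "f x \<in> carrier_vec d" "f xs \<in> carrier_vec d" "orthonormal_mat d U" "U \<in> carrier_mat d d"
  "f x - f xs = g"
proof -
  have "x \<in> carrier_vec n" "xs \<in> carrier_vec n"
    using x xs X by (auto intro: decision_sets_carrier simp: optimal_actions_def is_arg_min_def)
  then show fc: "f x \<in> carrier_vec d" "f xs \<in> carrier_vec d"
    using f by (auto simp: context_maps_def)
  show "f x - f xs = g" unfolding g using fc by (intro eq_vecI) auto
  show "orthonormal_mat d U" "U \<in> carrier_mat d d"
    using cs d by (auto simp: cone_state_def orthonormal_mat_def)
  show "v \<in> carrier_vec m" unfolding v d by (simp add: vec_last_def Let_def carrier_vecI)
qed (use c in \<open>auto simp: g \<delta> unit_sphere_def\<close>)

text \<open>This also covers \<open>g = 0\<close>, where \<open>\<delta>\<close> is 0 by convention,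
  so the product form is available without a case distinction.\<close>

lemma period_g: "i < d \<Longrightarrow> g $ i = vnorm g * \<delta> $ i"
proof (cases "vnorm g = 0")
  case True
  assume i: "i < d"
  have "(\<Sum>i<d. (g $ i)\<^sup>2) = 0" using vnorm_power2[OF period_carriers(1)] True by simp
  then have "g $ i = 0" using i by (simp add: sum_nonneg_eq_0_iff)
  then show ?thesis using True by simp
qed (auto simp: \<delta>)

lemma period_g_scalar_prod:
  assumes "u \<in> carrier_vec d" shows "g \<bullet> u = vnorm g * (\<delta> \<bullet> u)"
  unfolding scalar_prod_lessThan[OF assms] sum_distrib_left
  by (intro sum.cong refl) (simp add: period_g)

text \<open>The bound on \<open>g\<close> combines the diameter bound on \<open>X\<close> with the
  Lipschitz bound on \<open>f\<close>. The vector \<open>\<delta>\<close> is either a unit vector or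
  0.\<close>

lemma period_norms: "vnorm g \<le> 1" "(\<Sum>i<d. (\<delta> $ i)\<^sup>2) \<le> 1"
proof -
  have X': "x \<in> X" "xs \<in> X" using x xs by (auto simp: optimal_actions_def is_arg_min_def)
  then have xc: "x \<in> carrier_vec n" "xs \<in> carrier_vec n" using decision_sets_carrier[OF X] by auto
  have "vnorm g = vdist d (f x) (f xs)"
    using vdist_eq_vnorm[OF period_carriers(5,6)] period_carriers(9) by simp
  also have "\<dots> \<le> vdist n x xs" using f xc by (auto simp: context_maps_def)
  also have "\<dots> \<le> 1" using X X' by (auto simp: decision_sets_def)
  finally show "vnorm g \<le> 1" .
  show "(\<Sum>i<d. (\<delta> $ i)\<^sup>2) \<le> 1"
  proof (cases "vnorm g = 0")
    case False
    then have "(\<Sum>i<d. (\<delta> $ i)\<^sup>2) = (\<Sum>i<d. (g $ i)\<^sup>2) / (vnorm g)\<^sup>2"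
      by (simp add: \<delta> power_divide sum_divide_distrib)
    then show ?thesis using False vnorm_power2[OF period_carriers(1)] by simp
  qed (simp add: \<delta>)
qed

text \<open>Two optimality conditions give two signs: \<open>x\<close> is optimal for the axis of
  the cone, so \<open>\<delta>\<close> has nonpositive product with it; \<open>xs\<close> is optimal
  for \<open>c\<close>, so \<open>\<delta>\<close> has nonnegative product with
  \<open>c\<close>.\<close>

lemma period_coords:
  shows "i < m \<Longrightarrow> v $ i = coords U \<delta> (Suc i)"
    and "coords U \<delta> 0 \<le> 0" and "0 \<le> \<delta> \<bullet> c"
proof -
  note car = period_carriers
  have coords: "(transpose_mat U *\<^sub>v \<delta>) $ k = coords U \<delta> k" if "k < d" for k
    using that car(2,8) by (auto simp: coords_def scalar_prod_lessThan)
  show "v $ i = coords U \<delta> (Suc i)" if "i < m" for i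
    using that coords[of "Suc i"] car(8) unfolding v d
    by (simp add: vec_last_def Let_def del: index_mult_mat_vec)
  have col: "U *\<^sub>v unit_vec d 0 = col U 0" using car(8) d by (intro eq_vecI) (auto simp: scalar_prod_right_unit)
  have colc: "col U 0 \<in> carrier_vec d" using car(8) by (intro carrier_vecI) simp
  have X': "x \<in> X" "xs \<in> X" using x xs by (auto simp: optimal_actions_def is_arg_min_def)
  have "g \<bullet> col U 0 \<le> 0"
    using optimal_actions_le(2)[OF x X'(2)] minus_scalar_prod_distrib[OF car(5,6) colc]
    unfolding car(9) col by simp
  moreover have "\<delta> \<bullet> col U 0 = coords U \<delta> 0"
    unfolding coords_def scalar_prod_lessThan[OF colc] using car(8) d
    by (intro sum.cong) (auto simp: mult.commute)
  ultimately have "vnorm g * coords U \<delta> 0 \<le> 0" using period_g_scalar_prod[OF colc] by simp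
  moreover have "coords U \<delta> 0 = 0" if "vnorm g = 0"
    using that car(8) d by (simp add: coords_def \<delta>)
  ultimately show "coords U \<delta> 0 \<le> 0"
    using vnorm_nonneg[of g] by (cases "vnorm g = 0") (auto simp: mult_le_0_iff)
  have "0 \<le> g \<bullet> c"
    using optimal_actions_le(2)[OF xs X'(1)] minus_scalar_prod_distrib[OF car(5,6,4)]
    unfolding car(9) by simp
  then have "0 \<le> vnorm g * (\<delta> \<bullet> c)" using period_g_scalar_prod[OF car(4)] by simp
  moreover have "\<delta> \<bullet> c = 0" if "vnorm g = 0" using that car(4) by (simp add: \<delta>)
  ultimately show "0 \<le> \<delta> \<bullet> c"
    using vnorm_nonneg[of g] by (cases "vnorm g = 0") (auto simp: zero_le_mult_iff)
qed

text \<open>The axis component of \<open>\<delta>\<close> is nonpositive while that of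
  \<open>c\<close> is positive, so dropping it only increases the product. Hence the cut by
  \<open>v\<close>, which passes through the centre, is valid for \<open>c\<close>, and the same
  quantity bounds the regret.\<close>

lemma period_cut: "\<delta> \<bullet> c \<le> (\<Sum>i<m. coords U c (Suc i) * v $ i)"
    and period_v_norm: "(\<Sum>i<m. (v $ i)\<^sup>2) \<le> 1"
proof -
  note car = period_carriers
  have "\<delta> \<bullet> c = coords U \<delta> 0 * coords U c 0 + (\<Sum>i<m. coords U \<delta> (Suc i) * coords U c (Suc i))"
    using coords_inner[OF car(7,4), of \<delta>] unfolding d sum.lessThan_Suc_shift by simp
  also have "(\<Sum>i<m. coords U \<delta> (Suc i) * coords U c (Suc i)) = (\<Sum>i<m. coords U c (Suc i) * v $ i)"
    by (intro sum.cong refl) (simp add: period_coords(1))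
  finally have "\<delta> \<bullet> c = coords U \<delta> 0 * coords U c 0 + (\<Sum>i<m. coords U c (Suc i) * v $ i)" .
  moreover have "coords U \<delta> 0 * coords U c 0 \<le> 0"
    using period_coords(2) cs by (intro mult_nonpos_nonneg) (auto simp: cone_state_def)
  ultimately show "\<delta> \<bullet> c \<le> (\<Sum>i<m. coords U c (Suc i) * v $ i)" by simp
  have "(coords U \<delta> 0)\<^sup>2 + (\<Sum>i<m. (coords U \<delta> (Suc i))\<^sup>2) = (\<Sum>i<d. (\<delta> $ i)\<^sup>2)"
    using coords_inner[OF car(7,2), of \<delta>] scalar_prod_lessThan[OF car(2), of \<delta>]
    unfolding d sum.lessThan_Suc_shift by (simp add: power2_eq_square)
  moreover have "(\<Sum>i<m. (v $ i)\<^sup>2) = (\<Sum>i<m. (coords U \<delta> (Suc i))\<^sup>2)"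
    by (intro sum.cong refl) (simp add: period_coords(1))
  ultimately show "(\<Sum>i<m. (v $ i)\<^sup>2) \<le> 1"
    using period_norms(2) zero_le_power2[of "coords U \<delta> 0"] by linarith
qed

lemma period_cut_nonneg: "0 \<le> (\<Sum>i<m. coords U c (Suc i) * v $ i)"
  using period_coords(3) period_cut by linarith

lemma period_regret_le:
  assumes "\<delta> \<bullet> c \<le> B"
  shows "(f x - f xs) \<bullet> c \<le> B"
proof -
  have "(f x - f xs) \<bullet> c = vnorm g * (\<delta> \<bullet> c)"
    using period_g_scalar_prod[OF period_carriers(4)] period_carriers(9) by simp
  also have "\<dots> \<le> 1 * (\<delta> \<bullet> c)"
    using period_norms(1) period_coords(3) by (intro mult_right_mono) auto
  finally show ?thesis using assms by simp
qed

lemma period_regret_le_one: "(f x - f xs) \<bullet> c \<le> 1"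
proof (rule period_regret_le)
  show "\<delta> \<bullet> c \<le> 1"
    using scalar_prod_le_one[OF period_carriers(2,4) period_norms(2)] unit_sphere_sum[OF c] by simp
qed

lemma period_regret_small:
  assumes small: "v \<bullet> (W *\<^sub>v v) \<le> \<epsilon>\<^sup>2" and \<epsilon>: "0 \<le> \<epsilon>"
  shows "(f x - f xs) \<bullet> c \<le> \<epsilon>"
proof (rule period_regret_le)
  have y0: "0 < coords U c 0"
    and y: "(\<Sum>i<m. coords U c (Suc i) * v $ i)\<^sup>2 \<le> (coords U c 0)\<^sup>2 * (\<Sum>i<m. W $$ (i, i) * (v $ i)\<^sup>2)"
    using cs by (auto simp: cone_state_def)
  have "(coords U c 0)\<^sup>2 + (\<Sum>i<m. (coords U c (Suc i))\<^sup>2) = (\<Sum>i<d. (c $ i)\<^sup>2)"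
    using coords_inner[OF period_carriers(7,4), of c] scalar_prod_lessThan[OF period_carriers(4), of c]
    unfolding d sum.lessThan_Suc_shift by (simp add: power2_eq_square)
  then have "(coords U c 0)\<^sup>2 + (\<Sum>i<m. (coords U c (Suc i))\<^sup>2) = 1"
    using unit_sphere_sum[OF c] by simp
  moreover have "0 \<le> (\<Sum>i<m. (coords U c (Suc i))\<^sup>2)" by (intro sum_nonneg) auto
  ultimately have y1: "(coords U c 0)\<^sup>2 \<le> 1" by linarith
  have "v \<bullet> (W *\<^sub>v v) = (\<Sum>i<m. W $$ (i, i) * (v $ i)\<^sup>2)"
    by (simp add: diag_quadratic[OF cs period_carriers(3)] mult.commute)
  then have "(\<Sum>i<m. coords U c (Suc i) * v $ i)\<^sup>2 \<le> (coords U c 0)\<^sup>2 * \<epsilon>\<^sup>2"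
    using y small by (smt (verit) mult_left_mono zero_le_power2)
  also have "\<dots> \<le> 1 * \<epsilon>\<^sup>2" using y1 by (intro mult_right_mono) auto
  finally have "(\<Sum>i<m. coords U c (Suc i) * v $ i)\<^sup>2 \<le> \<epsilon>\<^sup>2" by simp
  then have "(\<Sum>i<m. coords U c (Suc i) * v $ i) \<le> \<epsilon>"
    by (rule power2_le_imp_le) (rule \<epsilon>)
  then show "\<delta> \<bullet> c \<le> \<epsilon>" using period_cut by linarith
qed

end

text \<open>\<open>k\<close> counts the updates so far. The floor \<open>\<omega>\<close> and the
  decaying product are the two sides that \<open>cone_update_count\<close> compares.\<close>

definition volume_state :: "nat \<Rightarrow> real \<Rightarrow> real \<Rightarrow> nat \<Rightarrow> real vec \<Rightarrow> ec_state \<Rightarrow> bool" where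
  "volume_state m \<tau> \<omega> k c s \<longleftrightarrow> cone_state m c s \<and> (\<forall>i<m. \<omega> \<le> fst s $$ (i, i)) \<and>
     (\<Prod>i<m. fst s $$ (i, i)) \<le> (\<tau>\<^sup>2) ^ m * exp (- real k / real (Suc m))"

text \<open>Amortized form: a period costs at most \<open>\<epsilon>\<close> plus the increase of
  the update counter. Without update the counter stays and the regret is at most
  \<open>\<epsilon>\<close>; with an update it grows by 1, which pays for a regret of at most
  1.\<close>

lemma period_step:
  assumes d: "d = Suc m" "2 \<le> d" and vs: "volume_state m \<tau> \<omega> k c s0" and c: "c \<in> unit_sphere d"
    and X: "X \<in> decision_sets n" and f: "f \<in> context_maps n d"
    and xs: "xs \<in> optimal_actions c X f"
    and st: "((x, s), t) \<in> ec_period p d \<epsilon> X f xs s0"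
    and \<epsilon>: "0 < \<epsilon>" and \<omega>: "\<omega> = \<epsilon>\<^sup>2 / (60 * real d)"
  obtains k' where "volume_state m \<tau> \<omega> k' c s" "(f x - f xs) \<bullet> c \<le> \<epsilon> + (real k' - real k)"
proof -
  obtain W U where s0: "s0 = (W, U)" by fastforce
  have cs: "cone_state m c (W, U)" and w: "\<And>i. i < m \<Longrightarrow> \<omega> \<le> W $$ (i, i)"
    and vol: "(\<Prod>i<m. W $$ (i, i)) \<le> (\<tau>\<^sup>2) ^ m * exp (- real k / real d)"
    using vs d(1) by (auto simp: volume_state_def s0)
  have WU: "U \<in> carrier_mat d d" "W \<in> carrier_mat (d - 1) (d - 1)"
    using cs d by (auto simp: cone_state_def orthonormal_mat_def)
  have \<omega>0: "0 < \<omega>" using \<epsilon> d by (simp add: \<omega>)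
  define g where "g = vec d (\<lambda>i. f x $ i - f xs $ i)"
  define \<delta> where "\<delta> = (if vnorm g = 0 then 0\<^sub>v d else vec d (\<lambda>i. g $ i / vnorm g))"
  define v where "v = vec_last (transpose_mat U *\<^sub>v \<delta>) (d - 1)"
  define \<delta>' where "\<delta>' = vec m (\<lambda>i. v $ i / vnorm v)"
  have m: "d - 1 = m" using d by simp
  note res = ec_period_result[OF st[unfolded s0] WU d(2), folded g_def, folded \<delta>_def, folded v_def,
      unfolded m, folded \<delta>'_def]
  note facts = d(1) cs c X f xs res(1) g_def \<delta>_def v_def
  have vc: "v \<in> carrier_vec m" by (rule period_carriers(3)[OF facts])
  have "volume_state m \<tau> \<omega> (Suc k) c s" if big: "\<not> v \<bullet> (W *\<^sub>v v) \<le> \<epsilon>\<^sup>2"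
  proof -
    have "vnorm v \<noteq> 0"
    proof
      assume "vnorm v = 0"
      then have "(\<Sum>i<m. (v $ i)\<^sup>2) = 0" using vnorm_power2[OF vc] by simp
      then have "\<And>i. i < m \<Longrightarrow> v $ i = 0" by (simp add: sum_nonneg_eq_0_iff)
      then have "v \<bullet> (W *\<^sub>v v) = 0" unfolding diag_quadratic[OF cs vc] by simp
      then show False using big by simp
    qed
    then have v0: "0 < vnorm v" using vnorm_nonneg[of v] by simp
    have \<delta>'c: "\<delta>' \<in> carrier_vec m" by (simp add: \<delta>'_def)
    have "(\<Sum>i<m. (\<delta>' $ i)\<^sup>2) = (\<Sum>i<m. (v $ i)\<^sup>2) / (vnorm v)\<^sup>2"
      by (simp add: \<delta>'_def power_divide sum_divide_distrib)
    then have \<delta>'1: "(\<Sum>i<m. (\<delta>' $ i)\<^sup>2) = 1" using v0 by (simp flip: vnorm_power2[OF vc])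
    have "(\<Sum>i<m. coords U c (Suc i) * \<delta>' $ i) = (\<Sum>i<m. coords U c (Suc i) * v $ i) / vnorm v"
      by (simp add: \<delta>'_def sum_divide_distrib)
    then have cut: "0 \<le> (\<Sum>i<m. coords U c (Suc i) * \<delta>' $ i)"
      using period_cut_nonneg[OF facts] v0 by simp
    \<comment> \<open>Normalizing \<open>v\<close>, of norm at most 1, can only increase the value
      of the form. The result exceeds \<open>\<epsilon>\<^sup>2 = 60 * d * \<omega>\<close>, the
      threshold under which the eigenvalue floor is preserved.\<close>
    have Q: "\<epsilon>\<^sup>2 < (\<Sum>i<m. (\<delta>' $ i)\<^sup>2 * W $$ (i, i))"
    proof -
      have "(\<Sum>i<m. (\<delta>' $ i)\<^sup>2 * W $$ (i, i)) = v \<bullet> (W *\<^sub>v v) / (vnorm v)\<^sup>2"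
        unfolding diag_quadratic[OF cs vc] by (simp add: \<delta>'_def power_divide sum_divide_distrib)
      moreover have "v \<bullet> (W *\<^sub>v v) / 1 \<le> v \<bullet> (W *\<^sub>v v) / (vnorm v)\<^sup>2"
      proof (rule divide_left_mono)
        show "(vnorm v)\<^sup>2 \<le> 1" using period_v_norm[OF facts] by (simp add: vnorm_power2[OF vc])
        show "0 \<le> v \<bullet> (W *\<^sub>v v)" using big zero_le_power2[of \<epsilon>] by linarith
        show "0 < 1 * (vnorm v)\<^sup>2" using v0 by simp
      qed
      ultimately show ?thesis using big by simp
    qed
    have exp_Suc: "exp (- 1 / real d) * exp (- real k / real d) = exp (- real (Suc k) / real d)"
      unfolding exp_add[symmetric] add_divide_distrib[symmetric] by simp
    have "cone_state m c s \<and> (\<forall>i<m. \<omega> \<le> fst s $$ (i, i)) \<and>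
        (\<Prod>i<m. fst s $$ (i, i)) \<le> exp (- 1 / real d) * (\<Prod>i<m. W $$ (i, i))"
    proof (cases "d = 2")
      case True
      then have m1: "m = 1" using d by simp
      obtain t' where t': "(s, t') \<in> cone_update_2 p \<delta>' (W, U)" using res(2) big True by auto
      have W0: "\<epsilon>\<^sup>2 < W $$ (0, 0)" using Q \<delta>'1 by (simp add: m1)
      then have W1: "0 < W $$ (0, 0)" by (rule order_le_less_trans[OF zero_le_power2])
      \<comment> \<open>Halving the single entry is at least as fast as the rate
        \<open>exp (- 1 / d)\<close> at \<open>d = 2\<close>, so both kinds of update share one
        volume bound.\<close>
      have "1 / 2 \<le> exp (- (1 :: real) / 2)"
        using exp_half_le2 by (simp add: exp_minus field_simps)
      then have "W $$ (0, 0) / 2 \<le> exp (- 1 / 2) * W $$ (0, 0)"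
        using mult_right_mono[of "1 / 2" "exp (- (1 :: real) / 2)" "W $$ (0, 0)"] W1 by simp
      moreover have "cone_state m c s" "fst s $$ (0, 0) = W $$ (0, 0) / 2"
        using cone_update_2_step[OF cs[unfolded m1] t'] \<delta>'1 cut W1
        by (auto simp: m1)
      moreover have "\<omega> \<le> W $$ (0, 0) / 2"
        using W0 W1 unfolding \<omega> True by simp
      ultimately show ?thesis using True by (simp add: m1)
    next
      case False
      then have m2: "2 \<le> m" using d by simp
      obtain t' where t': "(s, t') \<in> cone_update_ge3 p (Suc m) \<delta>' (W, U)"
        using res(2) big False d(1) by auto
      have "60 * real (Suc m) * \<omega> \<le> (\<Sum>i<m. (\<delta>' $ i)\<^sup>2 * W $$ (i, i))"
        using Q by (simp add: \<omega> d(1))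
      from cone_update_ge3_step[OF cs m2 t' \<delta>'c \<delta>'1 cut w \<omega>0 this]
      show ?thesis by (simp add: d(1))
    qed
    moreover from this have "(\<Prod>i<m. fst s $$ (i, i)) \<le> (\<tau>\<^sup>2) ^ m * exp (- real (Suc k) / real d)"
      unfolding exp_Suc[symmetric] mult.left_commute[of "(\<tau>\<^sup>2) ^ m"]
      using mult_left_mono[OF vol exp_ge_zero[of "- 1 / real d"]] by linarith
    ultimately show ?thesis unfolding volume_state_def d(1)[symmetric] by blast
  qed
  moreover have "s = s0" if "v \<bullet> (W *\<^sub>v v) \<le> \<epsilon>\<^sup>2"
    using res(2) that s0 by blast
  ultimately show ?thesis
    using that[of k] that[of "Suc k"] vs period_regret_le_one[OF facts] period_regret_small[OF facts] \<epsilon>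
    by (cases "v \<bullet> (W *\<^sub>v v) \<le> \<epsilon>\<^sup>2") force+
qed

section \<open>Regret and running time\<close>

lemma angle_unit_sphere:
  assumes "c \<in> unit_sphere d" "u \<in> unit_sphere d"
  shows "angle c u = arccos (c \<bullet> u)" "\<bar>c \<bullet> u\<bar> \<le> 1" "0 \<le> angle c u" "angle c u \<le> pi"
    "cos (angle c u) = c \<bullet> u"
proof -
  show a: "angle c u = arccos (c \<bullet> u)" using assms by (simp add: angle_def unit_sphere_def)
  show b: "\<bar>c \<bullet> u\<bar> \<le> 1"
    using assms by (intro scalar_prod_le_one[of _ d]) (auto simp: unit_sphere_sum unit_sphere_def)
  then show "0 \<le> angle c u" "angle c u \<le> pi" "cos (angle c u) = c \<bullet> u"
    unfolding a by (auto simp: abs_le_iff intro!: arccos_lbound arccos_ubound)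
qed

lemma circumcenter_angle_le:
  assumes "is_circumcenter d C u" "C \<subseteq> unit_sphere d" "c \<in> C"
  shows "angle c u \<le> uncertainty_angle d C"
proof -
  have u: "u \<in> unit_sphere d" and eq: "(SUP c\<in>C. angle c u) = uncertainty_angle d C"
    using assms by (auto simp: is_circumcenter_def)
  \<comment> \<open>Angles are at most \<open>pi\<close>, so the real supremum is a genuine upper
    bound.\<close>
  have "bdd_above ((\<lambda>c. angle c u) ` C)"
    using angle_unit_sphere(4)[OF _ u] assms(2) by (intro bdd_aboveI[of _ pi]) auto
  then show ?thesis unfolding eq[symmetric] using assms(3) by (rule cSUP_upper2) simp
qed

lemma ec_init_result:
  assumes "(s, t) \<in> ec_init p d C0"
  obtains u U where "is_circumcenter d C0 u" "orthonormal_mat d U" "col U 0 = u"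
    "s = ((tan (uncertainty_angle d C0))\<^sup>2 \<cdot>\<^sub>m 1\<^sub>m (d - 1), U)" "t = 2 + poly p d"
proof -
  obtain u U where *: "is_circumcenter d C0 u" "orthonormal_mat (dim_vec u) U" "col U 0 = u"
    "s = ((tan (uncertainty_angle d C0))\<^sup>2 \<cdot>\<^sub>m 1\<^sub>m (d - 1), U)" "t = 0 + (2 + (poly p (dim_vec u) + 0))"
    using assms unfolding ec_init_def completion_program_def Let_def in_bind_any_of_iff in_bind_ops_iff in_ops_iff
    by blast
  have "dim_vec u = d" using *(1) by (auto simp: is_circumcenter_def unit_sphere_def)
  then show ?thesis using that * by simp
qed

text \<open>The angle between \<open>c\<close> and the circumcenter is at most the uncertainty
  angle, so \<open>y 0\<close> is at least its cosine, which is positive. The remaining coordinates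
  have squared norm \<open>1 - (y 0)\<^sup>2 \<le> (y 0)\<^sup>2 * \<tau>\<^sup>2\<close>, and
  Cauchy-Schwarz gives the support form.\<close>

lemma initial_cone_state:
  assumes "(s, t) \<in> ec_init p d C0" and d: "d = Suc m" and C0: "C0 \<subseteq> unit_sphere d" and c: "c \<in> C0"
    and \<alpha>: "uncertainty_angle d C0 < pi / 2"
  defines "\<tau> \<equiv> tan (uncertainty_angle d C0)"
  shows "0 \<le> uncertainty_angle d C0" and "cone_state m c s"
    and "\<And>i. i < m \<Longrightarrow> fst s $$ (i, i) = \<tau>\<^sup>2" and "t = 2 + poly p d"
proof -
  obtain u U where u: "is_circumcenter d C0 u" and U: "orthonormal_mat d U" "col U 0 = u"
    and s: "s = (\<tau>\<^sup>2 \<cdot>\<^sub>m 1\<^sub>m (d - 1), U)" and t: "t = 2 + poly p d"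
    by (rule ec_init_result[OF assms(1)]) (simp add: \<tau>_def)
  define \<alpha> where "\<alpha> = uncertainty_angle d C0"
  have us: "u \<in> unit_sphere d" using u by (simp add: is_circumcenter_def)
  have cs: "c \<in> unit_sphere d" using c C0 by auto
  note ang = angle_unit_sphere[OF cs us]
  have le: "angle c u \<le> \<alpha>" unfolding \<alpha>_def by (rule circumcenter_angle_le[OF u C0 c])
  show \<alpha>0: "0 \<le> uncertainty_angle d C0" using le ang(3) unfolding \<alpha>_def by linarith
  have cos: "0 < cos \<alpha>" using \<alpha>0 \<open>uncertainty_angle d C0 < pi / 2\<close> unfolding \<alpha>_def[symmetric]
    by (intro cos_gt_zero_pi) linarith+
  have Uc: "U \<in> carrier_mat d d" using U by (simp add: orthonormal_mat_def)
  have cc: "c \<in> carrier_vec d" using cs by (simp add: unit_sphere_def)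
  define y where "y = coords U c"
  have "y 0 = c \<bullet> u"
    unfolding y_def coords_def U(2)[symmetric] using Uc d by (simp add: scalar_prod_def lessThan_atLeast0 mult.commute)
  also have "\<dots> = cos (angle c u)" using ang(5) by simp
  finally have "cos \<alpha> \<le> y 0"
    using cos_monotone_0_pi_le[OF ang(3) le] \<open>uncertainty_angle d C0 < pi / 2\<close> pi_gt_zero
    unfolding \<alpha>_def[symmetric] by linarith
  then have y0: "0 < y 0" and y0c: "(cos \<alpha>)\<^sup>2 \<le> (y 0)\<^sup>2" using cos by (auto intro: power_mono)
  have "(y 0)\<^sup>2 + (\<Sum>i<m. (y (Suc i))\<^sup>2) = 1"
    using coords_inner[OF U(1) cc, of c] scalar_prod_lessThan[OF cc, of c] unit_sphere_sum[OF cs]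
    unfolding d sum.lessThan_Suc_shift y_def by (simp add: power2_eq_square)
  moreover have "1 \<le> (y 0)\<^sup>2 * (1 + \<tau>\<^sup>2)"
  proof -
    have "1 + \<tau>\<^sup>2 = 1 / (cos \<alpha>)\<^sup>2"
      using tan_sec[of \<alpha>] cos unfolding \<tau>_def \<alpha>_def[symmetric] by (simp add: field_simps)
    then have "1 = (cos \<alpha>)\<^sup>2 * (1 + \<tau>\<^sup>2)" using cos by simp
    also have "\<dots> \<le> (y 0)\<^sup>2 * (1 + \<tau>\<^sup>2)" using y0c by (intro mult_right_mono) auto
    finally show ?thesis .
  qed
  ultimately have tail: "(\<Sum>i<m. (y (Suc i))\<^sup>2) \<le> (y 0)\<^sup>2 * \<tau>\<^sup>2" by (simp add: algebra_simps)
  show diag: "fst s $$ (i, i) = \<tau>\<^sup>2" if "i < m" for i using that d by (simp add: s)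
  show "t = 2 + poly p d" by (rule t)
  show "cone_state m c s"
    unfolding cone_state_def s prod.case y_def[symmetric]
  proof (intro conjI allI)
    fix q :: "nat \<Rightarrow> real"
    have "(\<Sum>i<m. y (Suc i) * q i)\<^sup>2 \<le> (\<Sum>i<m. (y (Suc i))\<^sup>2) * (\<Sum>i<m. (q i)\<^sup>2)"
      by (rule Cauchy_Schwarz_ineq_sum)
    also have "\<dots> \<le> (y 0)\<^sup>2 * \<tau>\<^sup>2 * (\<Sum>i<m. (q i)\<^sup>2)"
      using tail by (intro mult_right_mono sum_nonneg) auto
    also have "\<dots> = (y 0)\<^sup>2 * (\<Sum>i<m. (\<tau>\<^sup>2 \<cdot>\<^sub>m 1\<^sub>m (d - 1)) $$ (i, i) * (q i)\<^sup>2)"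
      using d by (simp add: sum_distrib_left mult.assoc)
    finally show "(\<Sum>i<m. y (Suc i) * q i)\<^sup>2 \<le> (y 0)\<^sup>2 * (\<Sum>i<m. (\<tau>\<^sup>2 \<cdot>\<^sub>m 1\<^sub>m (d - 1)) $$ (i, i) * (q i)\<^sup>2)" .
  qed (use U y0 d in auto)
qed

lemma poly_nat_le:
  fixes p :: "nat poly"
  assumes "1 \<le> X" "j \<le> X"
  shows "poly p j \<le> (\<Sum>i\<le>degree p. coeff p i) * X ^ degree p"
  unfolding poly_altdef sum_distrib_right
proof (intro sum_mono mult_left_mono)
  fix i assume "i \<in> {..degree p}"
  then have "j ^ i \<le> X ^ i" "X ^ i \<le> X ^ degree p"
    using assms by (auto intro: power_mono power_increasing)
  then show "j ^ i \<le> X ^ degree p" by simp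
qed auto

section \<open>A fixed run of the algorithm against a fixed play\<close>

context
  fixes p :: "nat poly" and n d T m :: nat and \<epsilon> :: real and C0 :: "real vec set"
    and \<pi> :: policy and \<sigma> :: "observation list \<Rightarrow> ec_state \<times> nat" and c :: "real vec" and h :: "observation list"
  assumes d: "d = Suc m" "2 \<le> d" and T: "1 \<le> T" and C0: "C0 \<subseteq> unit_sphere d"
    and \<alpha>: "uncertainty_angle d C0 < pi / 2"
    and ec: "ellipsoidal_cones p n d T \<epsilon> C0 \<pi> \<sigma>" and ch: "(c, h) \<in> plays n d T C0"
    and \<epsilon>: "\<epsilon> = real d / real T"
begin

abbreviation (input) initial_slope :: real where "initial_slope \<equiv> tan (uncertainty_angle d C0)"

abbreviation (input) least_width :: real where "least_width \<equiv> \<epsilon>\<^sup>2 / (60 * real d)"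

definition period_regret :: "nat \<Rightarrow> real" where
  "period_regret t = (case h ! t of (X, f, x) \<Rightarrow> (f (\<pi> (take t h) X f) - f x) \<bullet> c)"

lemma play_facts: "c \<in> C0" "length h = T" "c \<in> unit_sphere d"
  using ch C0 by (auto simp: plays_def)

lemma \<epsilon>_pos: "0 < \<epsilon>" using d T by (simp add: \<epsilon>)

lemma regret_eq: "regret \<pi> c h = (\<Sum>t<T. period_regret t)"
  by (simp add: regret_def period_regret_def play_facts)

lemma play_period:
  assumes "t < T"
  obtains X f xs s k where "h ! t = (X, f, xs)" "X \<in> decision_sets n" "f \<in> context_maps n d"
    "xs \<in> optimal_actions c X f"
    "((\<pi> (take t h) X f, s), k) \<in> ec_period p d \<epsilon> X f xs (fst (\<sigma> (take t h)))"
    "\<sigma> (take (Suc t) h) = (s, snd (\<sigma> (take t h)) + k)"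
proof -
  obtain X f xs where o: "h ! t = (X, f, xs)" by (cases "h ! t") auto
  have mem: "h ! t \<in> set h" using assms play_facts by auto
  then have 1: "X \<in> decision_sets n" "f \<in> context_maps n d" "xs \<in> optimal_actions c X f"
    using ch o by (auto simp: plays_def)
  have tk: "take (Suc t) h = take t h @ [(X, f, xs)]"
    using assms play_facts o by (simp add: take_Suc_conv_app_nth)
  \<comment> \<open>Every prefix of a play is a play of its own length for the same
    \<open>c\<close>, so the defining property of the algorithm applies to it.\<close>
  have "set (take (Suc t) h) \<subseteq> set h" by (rule set_take_subset)
  then have "(c, take t h @ [(X, f, xs)]) \<in> plays n d (Suc (length (take t h))) C0"
    using ch assms play_facts unfolding tk[symmetric] by (auto simp: plays_def)
  moreover have "length (take t h) < T" using assms play_facts by simp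
  ultimately show ?thesis
    using ec that[OF o 1] unfolding ellipsoidal_cones_def tk by blast
qed

lemma initial_play_state:
  shows "0 \<le> uncertainty_angle d C0" and "cone_state m c (fst (\<sigma> []))"
    and "\<And>i. i < m \<Longrightarrow> fst (fst (\<sigma> [])) $$ (i, i) = initial_slope\<^sup>2" and "snd (\<sigma> []) = 2 + poly p d"
proof -
  have "(fst (\<sigma> []), snd (\<sigma> [])) \<in> ec_init p d C0"
    using ec by (simp add: ellipsoidal_cones_def)
  note initial_cone_state[OF this d(1) C0 play_facts(1) \<alpha>]
  then show "0 \<le> uncertainty_angle d C0" and "cone_state m c (fst (\<sigma> []))"
    and "\<And>i. i < m \<Longrightarrow> fst (fst (\<sigma> [])) $$ (i, i) = initial_slope\<^sup>2" and "snd (\<sigma> []) = 2 + poly p d" by auto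
qed

lemma large_angle_invariant:
  assumes \<tau>: "\<epsilon> \<le> initial_slope" and "t \<le> T"
  shows "\<exists>k. volume_state m initial_slope least_width k c (fst (\<sigma> (take t h))) \<and> (\<Sum>i<t. period_regret i) \<le> real t * \<epsilon> + real k"
  using assms(2)
proof (induction t)
  case 0
  have "\<epsilon>\<^sup>2 \<le> initial_slope\<^sup>2" using \<tau> \<epsilon>_pos by (intro power_mono) auto
  moreover have "least_width \<le> \<epsilon>\<^sup>2 / 1" using d by (intro divide_left_mono) auto
  ultimately have "volume_state m initial_slope least_width 0 c (fst (\<sigma> []))"
    using initial_play_state by (simp add: volume_state_def)
  then show ?case by auto
next
  case (Suc t)
  then obtain k where vs: "volume_state m initial_slope least_width k c (fst (\<sigma> (take t h)))"
    and reg: "(\<Sum>i<t. period_regret i) \<le> real t * \<epsilon> + real k" by auto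
  have tT: "t < T" using Suc.prems by simp
  obtain X f xs s j where o: "h ! t = (X, f, xs)" "X \<in> decision_sets n" "f \<in> context_maps n d"
    "xs \<in> optimal_actions c X f"
    and st: "((\<pi> (take t h) X f, s), j) \<in> ec_period p d \<epsilon> X f xs (fst (\<sigma> (take t h)))"
    and \<sigma>: "\<sigma> (take (Suc t) h) = (s, snd (\<sigma> (take t h)) + j)"
    by (rule play_period[OF tT])
  obtain k' where k': "volume_state m initial_slope least_width k' c s"
    and r: "(f (\<pi> (take t h) X f) - f xs) \<bullet> c \<le> \<epsilon> + (real k' - real k)"
    by (rule period_step[OF d vs play_facts(3) o(2-4) st \<epsilon>_pos refl])
  have "(\<Sum>i<Suc t. period_regret i) \<le> real (Suc t) * \<epsilon> + real k'"
    using reg r by (simp add: period_regret_def o(1) algebra_simps)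
  then show ?case using k' \<sigma> by auto
qed

text \<open>Here \<open>W\<close> starts as \<open>\<tau>\<^sup>2\<close> times the identity with
  \<open>\<tau> \<le> \<epsilon>\<close>, and \<open>v\<close> has norm at most 1. The test
  therefore never triggers an update, and every period costs at most
  \<open>\<epsilon>\<close>.\<close>

lemma small_angle_invariant:
  assumes \<tau>: "0 \<le> initial_slope" "initial_slope \<le> \<epsilon>" and "t \<le> T"
  shows "fst (\<sigma> (take t h)) = fst (\<sigma> []) \<and> (\<Sum>i<t. period_regret i) \<le> real t * \<epsilon>"
  using assms(3)
proof (induction t)
  case (Suc t)
  then have same: "fst (\<sigma> (take t h)) = fst (\<sigma> [])"
    and reg: "(\<Sum>i<t. period_regret i) \<le> real t * \<epsilon>" by auto
  have tT: "t < T" using Suc.prems by simp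
  obtain X f xs s j where o: "h ! t = (X, f, xs)" "X \<in> decision_sets n" "f \<in> context_maps n d"
    "xs \<in> optimal_actions c X f"
    and st: "((\<pi> (take t h) X f, s), j) \<in> ec_period p d \<epsilon> X f xs (fst (\<sigma> (take t h)))"
    and \<sigma>: "\<sigma> (take (Suc t) h) = (s, snd (\<sigma> (take t h)) + j)"
    by (rule play_period[OF tT])
  obtain W U where WU: "fst (\<sigma> []) = (W, U)" by fastforce
  have cs: "cone_state m c (W, U)" and W: "\<And>i. i < m \<Longrightarrow> W $$ (i, i) = initial_slope\<^sup>2"
    using initial_play_state by (auto simp: WU)
  have dims: "U \<in> carrier_mat d d" "W \<in> carrier_mat (d - 1) (d - 1)"
    using cs d by (auto simp: cone_state_def orthonormal_mat_def)
  define x where "x = \<pi> (take t h) X f"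
  define g where "g = vec d (\<lambda>i. f x $ i - f xs $ i)"
  define \<delta> where "\<delta> = (if vnorm g = 0 then 0\<^sub>v d else vec d (\<lambda>i. g $ i / vnorm g))"
  define v where "v = vec_last (transpose_mat U *\<^sub>v \<delta>) (d - 1)"
  note res = ec_period_result[OF st[unfolded same WU, folded x_def] dims d(2), folded g_def, folded \<delta>_def, folded v_def]
  note facts = d(1) cs play_facts(3) o(2-4) res(1) g_def \<delta>_def v_def
  have "v \<bullet> (W *\<^sub>v v) = initial_slope\<^sup>2 * (\<Sum>i<m. (v $ i)\<^sup>2)"
    unfolding diag_quadratic[OF cs period_carriers(3)[OF facts]] sum_distrib_left
    by (intro sum.cong refl) (simp add: W)
  also have "\<dots> \<le> \<epsilon>\<^sup>2 * 1"
    using period_v_norm[OF facts] \<tau> by (intro mult_mono power_mono sum_nonneg) auto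
  finally have small: "v \<bullet> (W *\<^sub>v v) \<le> \<epsilon>\<^sup>2" by simp
  have "(f x - f xs) \<bullet> c \<le> \<epsilon>" using period_regret_small[OF facts small] \<epsilon>_pos by simp
  moreover have "s = (W, U)" using res(2) small by blast
  ultimately show ?case using reg \<sigma> by (simp add: period_regret_def o(1) x_def WU algebra_simps)
qed simp

text \<open>The cone invariant supplies the dimensions of \<open>W\<close> and \<open>U\<close>, on
  which the cost of a period depends.\<close>

lemma time_bound:
  assumes "\<And>t. t \<le> T \<Longrightarrow> cone_state m c (fst (\<sigma> (take t h)))" and "t \<le> T"
  shows "snd (\<sigma> (take t h)) \<le> 2 + poly p d + t * (60 * d ^ 3 + poly p d + poly p (d - 1))"
  using assms(2)
proof (induction t)
  case 0
  then show ?case by (simp add: initial_play_state)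
next
  case (Suc t)
  have tT: "t < T" using Suc.prems by simp
  obtain X f xs s j where
    st: "((\<pi> (take t h) X f, s), j) \<in> ec_period p d \<epsilon> X f xs (fst (\<sigma> (take t h)))"
    and \<sigma>: "\<sigma> (take (Suc t) h) = (s, snd (\<sigma> (take t h)) + j)"
    by (rule play_period[OF tT]) blast
  obtain W U where WU: "fst (\<sigma> (take t h)) = (W, U)" by fastforce
  have "cone_state m c (W, U)" using assms(1)[of t] Suc.prems by (simp add: WU)
  then have dims: "U \<in> carrier_mat d d" "W \<in> carrier_mat (d - 1) (d - 1)"
    using d by (auto simp: cone_state_def orthonormal_mat_def)
  have "j \<le> 60 * d ^ 3 + poly p d + poly p (d - 1)"
    by (rule ec_period_result(3)[OF st[unfolded WU] dims d(2)])
  then show ?case using Suc \<sigma> by simp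
qed

lemma horizon_\<epsilon>: "real T * \<epsilon> = real d" using T by (simp add: \<epsilon>)

lemma play_bounds:
  shows "arctan \<epsilon> < uncertainty_angle d C0 \<Longrightarrow> regret \<pi> c h \<le> 10 * (real d)\<^sup>2 * ln (real T * initial_slope)"
    and "uncertainty_angle d C0 \<le> arctan \<epsilon> \<Longrightarrow> regret \<pi> c h \<le> real d"
    and "snd (\<sigma> h) \<le> 2 + poly p d + T * (60 * d ^ 3 + poly p d + poly p (d - 1))"
proof -
  note \<alpha>0 = initial_play_state(1)
  \<comment> \<open>The angle lies in \<open>[0, pi / 2)\<close>, so comparing it with
    \<open>arctan \<epsilon>\<close> amounts to comparing its tangent with
    \<open>\<epsilon>\<close>.\<close>
  have arctan: "arctan initial_slope = uncertainty_angle d C0" using \<alpha>0 \<alpha> pi_half_gt_zero by (intro arctan_tan) linarith+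
  have \<tau>0: "0 \<le> initial_slope" using \<alpha>0 arctan by (metis zero_le_arctan_iff)
  have h: "take T h = h" by (simp add: play_facts)
  show "regret \<pi> c h \<le> 10 * (real d)\<^sup>2 * ln (real T * initial_slope)" if "arctan \<epsilon> < uncertainty_angle d C0"
  proof -
    have "arctan \<epsilon> < arctan initial_slope" using that by (subst arctan)
    then have \<tau>: "\<epsilon> < initial_slope" by (simp only: arctan_less_iff)
    obtain k where vs: "volume_state m initial_slope least_width k c (fst (\<sigma> h))"
      and reg: "(\<Sum>i<T. period_regret i) \<le> real T * \<epsilon> + real k"
      using large_angle_invariant[of T] \<tau> by (auto simp: h)
    have "real d + real k \<le> 10 * (real d)\<^sup>2 * ln (real T * initial_slope)"
    proof (rule cone_update_count[of m "real d" "real T" initial_slope "\<lambda>i. fst (fst (\<sigma> h)) $$ (i, i)"])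
      show "real d < real T * initial_slope" using \<tau> T unfolding horizon_\<epsilon>[symmetric] by simp
      show "0 < initial_slope" using \<tau> \<epsilon>_pos by simp
    qed (use d T vs in \<open>auto simp: volume_state_def \<epsilon>\<close>)
    then show ?thesis using reg unfolding regret_eq horizon_\<epsilon> by simp
  qed
  show "regret \<pi> c h \<le> real d" if "uncertainty_angle d C0 \<le> arctan \<epsilon>"
  proof -
    have "arctan initial_slope \<le> arctan \<epsilon>" using that by (subst arctan)
    then have \<tau>: "initial_slope \<le> \<epsilon>" by (simp only: arctan_le_iff)
    show ?thesis using small_angle_invariant[OF \<tau>0 \<tau>, of T] unfolding regret_eq horizon_\<epsilon> by simp
  qed
  have "cone_state m c (fst (\<sigma> (take t h)))" if "t \<le> T" for t
  proof (cases "initial_slope \<le> \<epsilon>")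
    case True
    then show ?thesis using small_angle_invariant[OF \<tau>0 True that] initial_play_state(2) by simp
  next
    case False
    then show ?thesis using large_angle_invariant[of t] that by (auto simp: volume_state_def)
  qed
  then show "snd (\<sigma> h) \<le> 2 + poly p d + T * (60 * d ^ 3 + poly p d + poly p (d - 1))"
    using time_bound[of T] by (simp add: h)
qed

end

text \<open>With \<open>X = d + T\<close> the terms are at most of the orders
  \<open>T * d ^ 3 <= X ^ 4\<close> and \<open>T * poly p j <= S * X ^ (degree p + 1)\<close>; the
  exponent \<open>degree p + 4\<close> covers both. The coefficient is 2 + 60 plus three times the
  coefficient sum of \<open>p\<close>.\<close>

lemma time_polynomial:
  fixes p :: "nat poly"
  assumes "2 \<le> d" "1 \<le> T"
  shows "2 + poly p d + T * (60 * d ^ 3 + poly p d + poly p (d - 1))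
    \<le> (62 + 3 * (\<Sum>i\<le>degree p. coeff p i)) * (d + T) ^ (degree p + 4)"
proof -
  define X where "X = d + T"
  define S where "S = (\<Sum>i\<le>degree p. coeff p i)"
  define Y where "Y = X ^ (degree p + 4)"
  have X: "1 \<le> X" "d \<le> X" "d - 1 \<le> X" "T \<le> X" using assms by (auto simp: X_def)
  have Y1: "X * X ^ degree p \<le> Y" "X ^ degree p \<le> Y" "X ^ 4 \<le> Y" "1 \<le> Y"
    using X(1) power_increasing[of "Suc (degree p)" "degree p + 4" X]
      power_increasing[of "degree p" "degree p + 4" X] power_increasing[of 4 "degree p + 4" X]
    by (auto simp: Y_def)
  have P: "poly p j \<le> S * X ^ degree p" if "j \<le> X" for j
    unfolding S_def by (rule poly_nat_le[OF X(1) that])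
  have P1: "poly p d \<le> S * Y" by (rule order_trans[OF P[OF X(2)]]) (intro mult_left_mono Y1(2) zero_le)
  have P2: "T * poly p j \<le> S * Y" if "j \<le> X" for j
  proof -
    have "T * poly p j \<le> X * (S * X ^ degree p)" using P[OF that] X(4) by (intro mult_mono) auto
    also have "\<dots> = S * (X * X ^ degree p)" by simp
    also have "\<dots> \<le> S * Y" using Y1(1) by (intro mult_left_mono) auto
    finally show ?thesis .
  qed
  have "T * d ^ 3 \<le> X * X ^ 3" using X by (intro mult_mono power_mono) auto
  also have "\<dots> = X ^ 4" by (simp add: numeral_eq_Suc)
  also note Y1(3)
  finally have P3: "T * d ^ 3 \<le> Y" .
  have "2 + poly p d + T * (60 * d ^ 3 + poly p d + poly p (d - 1))
      = 2 + poly p d + (60 * (T * d ^ 3) + T * poly p d + T * poly p (d - 1))"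
    by (simp add: algebra_simps)
  also have "\<dots> \<le> 2 * Y + S * Y + (60 * Y + S * Y + S * Y)"
    using P1 P2[OF X(2)] P2[OF X(3)] P3 Y1(4) by linarith
  also have "\<dots> = (62 + 3 * S) * Y" by (simp add: algebra_simps)
  finally show ?thesis unfolding S_def Y_def X_def .
qed

theorem theorem3:
  shows "\<exists>K>0::real. \<forall>p :: nat poly. \<exists>A m :: nat.
    \<forall>(n::nat) (d::nat) (T::nat) (C0 :: real vec set) (\<pi> :: policy) \<sigma>.
      n \<ge> 1 \<longrightarrow> d \<ge> 2 \<longrightarrow> T \<ge> 1 \<longrightarrow>
      C0 \<noteq> {} \<longrightarrow> closedin (vec_topology d) C0 \<longrightarrow> C0 \<subseteq> unit_sphere d \<longrightarrow>
      uncertainty_angle d C0 < pi / 2 \<longrightarrow>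
      ellipsoidal_cones p n d T (real d / real T) C0 \<pi> \<sigma> \<longrightarrow>
        (uncertainty_angle d C0 > arctan (real d / real T) \<longrightarrow>
           worst_case_regret n d T C0 \<pi>
             \<le> ereal (K * (real d)\<^sup>2 * ln (real T * tan (uncertainty_angle d C0)))) \<and>
        (uncertainty_angle d C0 \<le> arctan (real d / real T) \<longrightarrow>
           worst_case_regret n d T C0 \<pi> \<le> ereal (K * real d)) \<and>
        (\<forall>(c, h)\<in>plays n d T C0. snd (\<sigma> h) \<le> A * (d + T) ^ m)"
proof (intro exI[of _ "10 :: real"] conjI allI)
  fix p :: "nat poly"
  show "\<exists>A m :: nat.
    \<forall>(n::nat) (d::nat) (T::nat) (C0 :: real vec set) (\<pi> :: policy) \<sigma>.
      n \<ge> 1 \<longrightarrow> d \<ge> 2 \<longrightarrow> T \<ge> 1 \<longrightarrow>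
      C0 \<noteq> {} \<longrightarrow> closedin (vec_topology d) C0 \<longrightarrow> C0 \<subseteq> unit_sphere d \<longrightarrow>
      uncertainty_angle d C0 < pi / 2 \<longrightarrow>
      ellipsoidal_cones p n d T (real d / real T) C0 \<pi> \<sigma> \<longrightarrow>
        (uncertainty_angle d C0 > arctan (real d / real T) \<longrightarrow>
           worst_case_regret n d T C0 \<pi>
             \<le> ereal (10 * (real d)\<^sup>2 * ln (real T * tan (uncertainty_angle d C0)))) \<and>
        (uncertainty_angle d C0 \<le> arctan (real d / real T) \<longrightarrow>
           worst_case_regret n d T C0 \<pi> \<le> ereal (10 * real d)) \<and>
        (\<forall>(c, h)\<in>plays n d T C0. snd (\<sigma> h) \<le> A * (d + T) ^ m)"
  \<comment> \<open>The witnesses depend on the subroutine cost \<open>p\<close> alone and come from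
    \<open>time_polynomial\<close>; the regret constant 10, fixed before \<open>p\<close>, comes
    from \<open>cone_update_count\<close>.\<close>
  proof (rule exI[of _ "62 + 3 * (\<Sum>i\<le>degree p. coeff p i)"], rule exI[of _ "degree p + 4"],
      intro allI impI conjI)
    fix n d T :: nat and C0 :: "real vec set" and \<pi> :: policy and \<sigma>
    assume d: "d \<ge> 2" and T: "T \<ge> 1" and C0: "C0 \<subseteq> unit_sphere d"
      and \<alpha>: "uncertainty_angle d C0 < pi / 2"
      and ec: "ellipsoidal_cones p n d T (real d / real T) C0 \<pi> \<sigma>"
    have d': "d = Suc (d - 1)" using d by simp
    note bounds = play_bounds[OF d' d T C0 \<alpha> ec _ refl]
    show "worst_case_regret n d T C0 \<pi>
        \<le> ereal (10 * (real d)\<^sup>2 * ln (real T * tan (uncertainty_angle d C0)))"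
      if "uncertainty_angle d C0 > arctan (real d / real T)"
      unfolding worst_case_regret_def using bounds(1) that by (auto intro!: SUP_least)
    \<comment> \<open>The small-angle regret is in fact at most \<open>d\<close>; the factor 10
      merely reuses the common constant.\<close>
    show "worst_case_regret n d T C0 \<pi> \<le> ereal (10 * real d)"
      if "uncertainty_angle d C0 \<le> arctan (real d / real T)"
      unfolding worst_case_regret_def using bounds(2) that d by (fastforce intro!: SUP_least)
    show "\<forall>(c, h)\<in>plays n d T C0.
        snd (\<sigma> h) \<le> (62 + 3 * (\<Sum>i\<le>degree p. coeff p i)) * (d + T) ^ (degree p + 4)"
      using order_trans[OF bounds(3) time_polynomial[OF d T]] by auto
  qed
qed simp

end
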